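(* The prop $\mathbf{Gauss}$ is presented by causal Graphical Quadratic Algebra $\overrightarrow{\mathbf{GQA}}$; that is, the interpretation prop morphism from $\overrightarrow{\mathbf{GQA}}$ to $\mathbf{Gauss}$ described below is an isomorphism of props.
   Context: $\mathbf{Gauss}$ is the prop whose morphisms $m\to n$ are triples $(A,b,\Sigma)$ with $A\in\mathbb R^{n\times m}$, $b\in\mathbb R^n$, $\Sigma\in\mathbb R^{n\times n}$ positive semidefinite, written $f(x)=Ax+\mathcal N(b,\Sigma)$; composition is $(A,b,\Sigma);(C,d,\Xi)=(CA,\,Cb+d,\,C\Sigma C^T+\Xi)$ and monoidal product is block-diagonal direct sum. $\overrightarrow{\mathbf{GQA}}$ is the prop freely generated by the string-diagram generators copy ($1\to2$), discard ($1\to0$), addition ($2\to1$), zero ($0\to1$), scalar multiplication by $k\in\mathbb R$ ($1\to1$), the constant one ($0\to1$), and a new generator $\nu:0\to1$, modulo the axioms of Hopf bimonoids/affine algebra (presenting affine maps) together with two quadratic axioms: discarding $\nu$ gives the empty diagram (D), and two parallel copies of $\nu$ followed by the rotation matrix by angle $\varphi$ equals two parallel copies of $\nu$ (RI, for all $\varphi\in[0,2\pi)$). The interpretation sends copy to $x\mapsto (x,x)+\mathcal N(0,0)$, discard to the unique map to $\mathbb R^0$, addition to $(x_1,x_2)\mapsto x_1+x_2$, zero to the constant $0$, scalar $k$ to $x\mapsto kx$, the constant one to $\mathcal N(1,0)$, and $\nu$ to the standard normal $\mathcal N(0,1)$, extended to sequential and parallel composites. *)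

theory Defs
  imports Complex_Main "Jordan_Normal_Form.Matrix"
begin

section \<open>Props\<close>

text \<open>A prop is a strict symmetric monoidal category whose monoid of objects is the natural
  numbers under addition. Composition is written in diagrammatic order: in \<open>f \<Zcomp> g\<close>, the
  morphism \<open>f\<close> comes first. As usual for categories, a morphism determines its domain and
  codomain (\<open>hom_disjoint\<close>), so the operations need not be indexed by objects; they are
  only meaningful on (composable) morphisms.\<close>

record 'a prop_cat =
  arr :: "nat \<Rightarrow> nat \<Rightarrow> 'a set"
  ide :: "nat \<Rightarrow> 'a"
  seq :: "'a \<Rightarrow> 'a \<Rightarrow> 'a" (infixl \<open>\<Zcomp>\<index>\<close> 60)
  tens :: "'a \<Rightarrow> 'a \<Rightarrow> 'a" (infixl \<open>\<boxplus>\<index>\<close> 65)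
  swp :: "nat \<Rightarrow> nat \<Rightarrow> 'a"

locale prop_category =
  fixes P :: "'a prop_cat" (structure)
  assumes hom_disjoint:
      "\<lbrakk>f \<in> arr P m n; f \<in> arr P m' n'\<rbrakk> \<Longrightarrow> m = m' \<and> n = n'"
    and ide_arr: "ide P n \<in> arr P n n"
    and seq_arr: "\<lbrakk>f \<in> arr P m n; g \<in> arr P n p\<rbrakk> \<Longrightarrow> f \<Zcomp> g \<in> arr P m p"
    and tens_arr: "\<lbrakk>f \<in> arr P m n; g \<in> arr P m' n'\<rbrakk> \<Longrightarrow> f \<boxplus> g \<in> arr P (m + m') (n + n')"
    and swp_arr: "swp P m n \<in> arr P (m + n) (n + m)"
    and ide_seq: "f \<in> arr P m n \<Longrightarrow> ide P m \<Zcomp> f = f"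
    and seq_ide: "f \<in> arr P m n \<Longrightarrow> f \<Zcomp> ide P n = f"
    and seq_assoc:
      "\<lbrakk>f \<in> arr P m n; g \<in> arr P n p; h \<in> arr P p q\<rbrakk>
        \<Longrightarrow> (f \<Zcomp> g) \<Zcomp> h = f \<Zcomp> (g \<Zcomp> h)"
    and ide_tens: "f \<in> arr P m n \<Longrightarrow> ide P 0 \<boxplus> f = f"
    and tens_ide: "f \<in> arr P m n \<Longrightarrow> f \<boxplus> ide P 0 = f"
    and tens_assoc:
      "\<lbrakk>f \<in> arr P m n; g \<in> arr P m' n'; h \<in> arr P m'' n''\<rbrakk>
        \<Longrightarrow> (f \<boxplus> g) \<boxplus> h = f \<boxplus> (g \<boxplus> h)"
    and ide_tens_ide: "ide P m \<boxplus> ide P n = ide P (m + n)"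
    and interchange:
      "\<lbrakk>f \<in> arr P m n; g \<in> arr P n p; f' \<in> arr P m' n'; g' \<in> arr P n' p'\<rbrakk>
        \<Longrightarrow> (f \<Zcomp> g) \<boxplus> (f' \<Zcomp> g') = (f \<boxplus> f') \<Zcomp> (g \<boxplus> g')"
    and swp_natural:
      "\<lbrakk>f \<in> arr P m n; g \<in> arr P m' n'\<rbrakk>
        \<Longrightarrow> (f \<boxplus> g) \<Zcomp> swp P n n' = swp P m m' \<Zcomp> (g \<boxplus> f)"
    and swp_swp: "swp P m n \<Zcomp> swp P n m = ide P (m + n)"
    and swp_hexagon:
      "swp P m (n + p) = (swp P m n \<boxplus> ide P p) \<Zcomp> (ide P n \<boxplus> swp P m p)"

text \<open>Prop morphisms are identity-on-objects strict symmetric monoidal functors.\<close>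

locale prop_morphism = P: prop_category P + Q: prop_category Q
  for P :: "'a prop_cat" and Q :: "'b prop_cat" +
  fixes F :: "'a \<Rightarrow> 'b"
  assumes map_arr: "f \<in> arr P m n \<Longrightarrow> F f \<in> arr Q m n"
    and map_ide: "F (ide P n) = ide Q n"
    and map_seq:
      "\<lbrakk>f \<in> arr P m n; g \<in> arr P n p\<rbrakk> \<Longrightarrow> F (f \<Zcomp>\<^bsub>P\<^esub> g) = F f \<Zcomp>\<^bsub>Q\<^esub> F g"
    and map_tens:
      "\<lbrakk>f \<in> arr P m n; g \<in> arr P m' n'\<rbrakk> \<Longrightarrow> F (f \<boxplus>\<^bsub>P\<^esub> g) = F f \<boxplus>\<^bsub>Q\<^esub> F g"
    and map_swp: "F (swp P m n) = swp Q m n"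

definition prop_isomorphism ::
    "'a prop_cat \<Rightarrow> 'b prop_cat \<Rightarrow> ('a \<Rightarrow> 'b) \<Rightarrow> bool" where
  "prop_isomorphism P Q F \<longleftrightarrow> prop_morphism P Q F \<and>
    (\<exists>G. prop_morphism Q P G \<and>
      (\<forall>m n. \<forall>f \<in> arr P m n. G (F f) = f) \<and>
      (\<forall>m n. \<forall>g \<in> arr Q m n. F (G g) = g))"


section \<open>Props presented by generators and equations\<close>

datatype 'g diagram =
    Idn nat
  | Swap nat nat
  | Gen 'g
  | Seq "'g diagram" "'g diagram" (infixl \<open>;;\<close> 60)
  | Par "'g diagram" "'g diagram" (infixl \<open>\<parallel>\<close> 65)

text \<open>A signature \<open>ar\<close> assigns to each generator its numbers of input and output wires.\<close>

inductive typed :: "('g \<Rightarrow> nat \<times> nat) \<Rightarrow> 'g diagram \<Rightarrow> nat \<Rightarrow> nat \<Rightarrow> bool"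
  for ar where
  "typed ar (Idn n) n n"
| "typed ar (Swap m n) (m + n) (n + m)"
| "ar g = (m, n) \<Longrightarrow> typed ar (Gen g) m n"
| "\<lbrakk>typed ar t m n; typed ar u n p\<rbrakk> \<Longrightarrow> typed ar (t ;; u) m p"
| "\<lbrakk>typed ar t m n; typed ar u m' n'\<rbrakk> \<Longrightarrow> typed ar (t \<parallel> u) (m + m') (n + n')"

text \<open>\<open>diagram_eq ar E m n t u\<close>: the well-typed diagrams \<open>t, u : m \<rightarrow> n\<close> are
  identified by the smallest congruence containing the laws of props and the equations \<open>E\<close>.\<close>

inductive diagram_eq ::
    "('g \<Rightarrow> nat \<times> nat) \<Rightarrow> ('g diagram \<times> 'g diagram) set \<Rightarrow> nat \<Rightarrow> nat
      \<Rightarrow> 'g diagram \<Rightarrow> 'g diagram \<Rightarrow> bool"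
  for ar E where
  equation: "\<lbrakk>(t, u) \<in> E; typed ar t m n; typed ar u m n\<rbrakk> \<Longrightarrow> diagram_eq ar E m n t u"
| refl: "typed ar t m n \<Longrightarrow> diagram_eq ar E m n t t"
| sym: "diagram_eq ar E m n t u \<Longrightarrow> diagram_eq ar E m n u t"
| trans: "\<lbrakk>diagram_eq ar E m n t u; diagram_eq ar E m n u v\<rbrakk> \<Longrightarrow> diagram_eq ar E m n t v"
| seq_cong:
    "\<lbrakk>diagram_eq ar E m n t t'; diagram_eq ar E n p u u'\<rbrakk>
      \<Longrightarrow> diagram_eq ar E m p (t ;; u) (t' ;; u')"
| par_cong:
    "\<lbrakk>diagram_eq ar E m n t t'; diagram_eq ar E m' n' u u'\<rbrakk>
      \<Longrightarrow> diagram_eq ar E (m + m') (n + n') (t \<parallel> u) (t' \<parallel> u')"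
| id_seq: "typed ar t m n \<Longrightarrow> diagram_eq ar E m n (Idn m ;; t) t"
| seq_id: "typed ar t m n \<Longrightarrow> diagram_eq ar E m n (t ;; Idn n) t"
| seq_assoc:
    "\<lbrakk>typed ar t m n; typed ar u n p; typed ar v p q\<rbrakk>
      \<Longrightarrow> diagram_eq ar E m q ((t ;; u) ;; v) (t ;; (u ;; v))"
| id_par: "typed ar t m n \<Longrightarrow> diagram_eq ar E m n (Idn 0 \<parallel> t) t"
| par_id: "typed ar t m n \<Longrightarrow> diagram_eq ar E m n (t \<parallel> Idn 0) t"
| par_assoc:
    "\<lbrakk>typed ar t m n; typed ar u m' n'; typed ar v m'' n''\<rbrakk>
      \<Longrightarrow> diagram_eq ar E (m + m' + m'') (n + n' + n'') ((t \<parallel> u) \<parallel> v) (t \<parallel> (u \<parallel> v))"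
| id_par_id: "diagram_eq ar E (m + n) (m + n) (Idn m \<parallel> Idn n) (Idn (m + n))"
| interchange:
    "\<lbrakk>typed ar t m n; typed ar u n p; typed ar t' m' n'; typed ar u' n' p'\<rbrakk>
      \<Longrightarrow> diagram_eq ar E (m + m') (p + p')
            ((t ;; u) \<parallel> (t' ;; u')) ((t \<parallel> t') ;; (u \<parallel> u'))"
| swap_natural:
    "\<lbrakk>typed ar t m n; typed ar u m' n'\<rbrakk>
      \<Longrightarrow> diagram_eq ar E (m + m') (n' + n) ((t \<parallel> u) ;; Swap n n') (Swap m m' ;; (u \<parallel> t))"
| swap_swap: "diagram_eq ar E (m + n) (m + n) (Swap m n ;; Swap n m) (Idn (m + n))"
| swap_hexagon:
    "diagram_eq ar E (m + (n + p)) (n + p + m)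
      (Swap m (n + p)) ((Swap m n \<parallel> Idn p) ;; (Idn n \<parallel> Swap m p))"

definition diagram_class ::
    "('g \<Rightarrow> nat \<times> nat) \<Rightarrow> ('g diagram \<times> 'g diagram) set \<Rightarrow> 'g diagram \<Rightarrow> 'g diagram set" where
  "diagram_class ar E t = {u. \<exists>m n. diagram_eq ar E m n t u}"

text \<open>The prop freely generated by the signature \<open>ar\<close>, modulo the equations \<open>E\<close>. Since
  \<open>diagram_eq\<close> is a congruence, the unions below consist of equal classes.\<close>

definition presented_prop ::
    "('g \<Rightarrow> nat \<times> nat) \<Rightarrow> ('g diagram \<times> 'g diagram) set \<Rightarrow> 'g diagram set prop_cat" where
  "presented_prop ar E =
    \<lparr>arr = (\<lambda>m n. {diagram_class ar E t |t. typed ar t m n}),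
     ide = (\<lambda>n. diagram_class ar E (Idn n)),
     seq = (\<lambda>X Y. \<Union>t\<in>X. \<Union>u\<in>Y. diagram_class ar E (t ;; u)),
     tens = (\<lambda>X Y. \<Union>t\<in>X. \<Union>u\<in>Y. diagram_class ar E (t \<parallel> u)),
     swp = (\<lambda>m n. diagram_class ar E (Swap m n))\<rparr>"

primrec eval_diagram :: "'a prop_cat \<Rightarrow> ('g \<Rightarrow> 'a) \<Rightarrow> 'g diagram \<Rightarrow> 'a" where
  "eval_diagram P \<gamma> (Idn n) = ide P n"
| "eval_diagram P \<gamma> (Swap m n) = swp P m n"
| "eval_diagram P \<gamma> (Gen g) = \<gamma> g"
| "eval_diagram P \<gamma> (t ;; u) = eval_diagram P \<gamma> t \<Zcomp>\<^bsub>P\<^esub> eval_diagram P \<gamma> u"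
| "eval_diagram P \<gamma> (t \<parallel> u) = eval_diagram P \<gamma> t \<boxplus>\<^bsub>P\<^esub> eval_diagram P \<gamma> u"

text \<open>The common value of the diagrams in an equivalence class; this is only meaningful if
  evaluation is constant on the class.\<close>

definition eval_class :: "'a prop_cat \<Rightarrow> ('g \<Rightarrow> 'a) \<Rightarrow> 'g diagram set \<Rightarrow> 'a" where
  "eval_class P \<gamma> X = the_elem (eval_diagram P \<gamma> ` X)"


section \<open>The prop of Gaussian maps\<close>

text \<open>Positive semidefinite real matrices are, as covariance matrices, required to be
  symmetric.\<close>

definition pos_semidef :: "nat \<Rightarrow> real mat \<Rightarrow> bool" where
  "pos_semidef n S \<longleftrightarrow> S \<in> carrier_mat n n \<and> S\<^sup>T = S \<and>
    (\<forall>v \<in> carrier_vec n. 0 \<le> v \<bullet> (S *\<^sub>v v))"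

definition direct_sum :: "real mat \<Rightarrow> real mat \<Rightarrow> real mat" where
  "direct_sum A B =
    four_block_mat A (0\<^sub>m (dim_row A) (dim_col B)) (0\<^sub>m (dim_row B) (dim_col A)) B"

type_synonym gaussian = "real mat \<times> real vec \<times> real mat"

definition affine_gaussian :: "real mat \<Rightarrow> real vec \<Rightarrow> gaussian" where
  "affine_gaussian A b = (A, b, 0\<^sub>m (dim_row A) (dim_row A))"

definition Gauss :: "gaussian prop_cat" where
  "Gauss =
    \<lparr>arr = (\<lambda>m n. {(A, b, S). A \<in> carrier_mat n m \<and> b \<in> carrier_vec n \<and> pos_semidef n S}),
     ide = (\<lambda>n. affine_gaussian (1\<^sub>m n) (0\<^sub>v n)),
     seq = (\<lambda>(A, b, S) (C, d, X). (C * A, C *\<^sub>v b + d, C * S * C\<^sup>T + X)),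
     tens = (\<lambda>(A, b, S) (C, d, X). (direct_sum A C, b @\<^sub>v d, direct_sum S X)),
     swp = (\<lambda>m n. affine_gaussian
        (four_block_mat (0\<^sub>m n m) (1\<^sub>m n) (1\<^sub>m m) (0\<^sub>m m n)) (0\<^sub>v (n + m)))\<rparr>"


section \<open>Causal Graphical Quadratic Algebra\<close>

datatype gqa_gen = Copy | Discard | Add | Zero | Scale real | One | Nu

primrec gqa_arity :: "gqa_gen \<Rightarrow> nat \<times> nat" where
  "gqa_arity Copy = (1, 2)"
| "gqa_arity Discard = (1, 0)"
| "gqa_arity Add = (2, 1)"
| "gqa_arity Zero = (0, 1)"
| "gqa_arity (Scale k) = (1, 1)"
| "gqa_arity One = (0, 1)"
| "gqa_arity Nu = (0, 1)"

abbreviation "g_copy \<equiv> Gen Copy"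
abbreviation "g_discard \<equiv> Gen Discard"
abbreviation "g_add \<equiv> Gen Add"
abbreviation "g_zero \<equiv> Gen Zero"
abbreviation "g_scale k \<equiv> Gen (Scale k)"
abbreviation "g_one \<equiv> Gen One"
abbreviation "g_nu \<equiv> Gen Nu"

text \<open>The diagram of the matrix with rows \<open>(cos \<phi>, - sin \<phi>)\<close> and \<open>(sin \<phi>, cos \<phi>)\<close>.\<close>

definition rotation :: "real \<Rightarrow> gqa_gen diagram" where
  "rotation \<phi> =
    (g_copy \<parallel> g_copy) ;;
    (g_scale (cos \<phi>) \<parallel> g_scale (sin \<phi>) \<parallel> g_scale (- sin \<phi>) \<parallel> g_scale (cos \<phi>)) ;;
    (Idn 1 \<parallel> Swap 1 1 \<parallel> Idn 1) ;;
    (g_add \<parallel> g_add)"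

text \<open>The antipode of the Hopf structure is \<open>g_scale (- 1)\<close>; its law
  \<open>g_copy ;; (Idn 1 \<parallel> g_scale (- 1)) ;; g_add = g_discard ;; g_zero\<close> is the combination of
  \<open>scale_one\<close>, \<open>scale_plus\<close> and \<open>scale_zero\<close>.\<close>

inductive_set gqa_equations :: "(gqa_gen diagram \<times> gqa_gen diagram) set" where
  copy_coassoc: "(g_copy ;; (g_copy \<parallel> Idn 1), g_copy ;; (Idn 1 \<parallel> g_copy)) \<in> gqa_equations"
| copy_counit: "(g_copy ;; (g_discard \<parallel> Idn 1), Idn 1) \<in> gqa_equations"
| copy_cocomm: "(g_copy ;; Swap 1 1, g_copy) \<in> gqa_equations"
| add_assoc: "((g_add \<parallel> Idn 1) ;; g_add, (Idn 1 \<parallel> g_add) ;; g_add) \<in> gqa_equations"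
| add_unit: "((g_zero \<parallel> Idn 1) ;; g_add, Idn 1) \<in> gqa_equations"
| add_comm: "(Swap 1 1 ;; g_add, g_add) \<in> gqa_equations"
| add_copy:
    "(g_add ;; g_copy, (g_copy \<parallel> g_copy) ;; (Idn 1 \<parallel> Swap 1 1 \<parallel> Idn 1) ;; (g_add \<parallel> g_add))
      \<in> gqa_equations"
| add_discard: "(g_add ;; g_discard, g_discard \<parallel> g_discard) \<in> gqa_equations"
| zero_copy: "(g_zero ;; g_copy, g_zero \<parallel> g_zero) \<in> gqa_equations"
| zero_discard: "(g_zero ;; g_discard, Idn 0) \<in> gqa_equations"
| scale_copy: "(g_scale k ;; g_copy, g_copy ;; (g_scale k \<parallel> g_scale k)) \<in> gqa_equations"
| scale_discard: "(g_scale k ;; g_discard, g_discard) \<in> gqa_equations"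
| add_scale: "(g_add ;; g_scale k, (g_scale k \<parallel> g_scale k) ;; g_add) \<in> gqa_equations"
| zero_scale: "(g_zero ;; g_scale k, g_zero) \<in> gqa_equations"
| scale_one: "(g_scale 1, Idn 1) \<in> gqa_equations"
| scale_times: "(g_scale k ;; g_scale l, g_scale (k * l)) \<in> gqa_equations"
| scale_zero: "(g_scale 0, g_discard ;; g_zero) \<in> gqa_equations"
| scale_plus: "(g_copy ;; (g_scale k \<parallel> g_scale l) ;; g_add, g_scale (k + l)) \<in> gqa_equations"
| one_copy: "(g_one ;; g_copy, g_one \<parallel> g_one) \<in> gqa_equations"
| one_discard: "(g_one ;; g_discard, Idn 0) \<in> gqa_equations"
| nu_discard: "(g_nu ;; g_discard, Idn 0) \<in> gqa_equations"
| nu_rotation: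
    "\<lbrakk>0 \<le> \<phi>; \<phi> < 2 * pi\<rbrakk> \<Longrightarrow> ((g_nu \<parallel> g_nu) ;; rotation \<phi>, g_nu \<parallel> g_nu) \<in> gqa_equations"

definition GQA :: "gqa_gen diagram set prop_cat" where
  "GQA = presented_prop gqa_arity gqa_equations"


section \<open>The interpretation\<close>

primrec gauss_gen :: "gqa_gen \<Rightarrow> gaussian" where
  "gauss_gen Copy = affine_gaussian (mat 2 1 (\<lambda>_. 1)) (0\<^sub>v 2)"
| "gauss_gen Discard = affine_gaussian (0\<^sub>m 0 1) (0\<^sub>v 0)"
| "gauss_gen Add = affine_gaussian (mat 1 2 (\<lambda>_. 1)) (0\<^sub>v 1)"
| "gauss_gen Zero = affine_gaussian (0\<^sub>m 1 0) (0\<^sub>v 1)"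
| "gauss_gen (Scale k) = affine_gaussian (mat 1 1 (\<lambda>_. k)) (0\<^sub>v 1)"
| "gauss_gen One = affine_gaussian (0\<^sub>m 1 0) (vec 1 (\<lambda>_. 1))"
| "gauss_gen Nu = (0\<^sub>m 1 0, 0\<^sub>v 1, 1\<^sub>m 1)"

definition interpretation_map :: "gqa_gen diagram set \<Rightarrow> gaussian" where
  "interpretation_map = eval_class Gauss gauss_gen"

end

theory Submission
  imports Defs
begin

text \<open>Soundness is a matrix computation for each equation, so the interpretation is a prop
  morphism; what has to be shown is that it is full and faithful.

  Diagrams without \<open>One\<close> and \<open>Nu\<close> commute with copying and discarding of all their wires, and
  dually with addition and zero. Hence such a diagram is determined by its composites with the
  inclusion of an input wire and the projection to an output wire. These are scalars, namely
  the entries of its matrix, so linear diagrams are faithfully represented by matrices.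

  Sliding the generators \<open>One\<close> and \<open>Nu\<close> to the side brings every diagram into the form
  \<open>A x + b + \<Sum>\<^sub>i v\<^sub>i \<nu>\<^sub>i\<close>, whose interpretation is \<open>(A, b, \<Sum>\<^sub>i v\<^sub>i v\<^sub>i\<^sup>T)\<close>. Each positive
  semidefinite matrix is such a sum, by Cholesky elimination. Conversely, two families \<open>v\<close>, \<open>w\<close>
  with the same Gram matrix define the same state: rotating pairs of columns concentrates the
  first row of either family in one nonnegative entry. The first row of the Gram matrix then
  determines this column or makes it vanish there, and one proceeds with the remaining rows.\<close>

section \<open>Presented props\<close>

text \<open>Typing is the recurring obstacle. Composition in a prop obeys its laws only on
  composable morphisms, and membership in hom-sets would accompany every rewriting step on string
  diagrams. Therefore all morphisms are collected in one type \<open>arrow\<close> with a total,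
  associative composition; the remaining side conditions are equations between natural numbers.
  Addition is dual to copying, so facts about bundles of wires are proved once, for a comonoid in a
  prop, and used again in the opposite prop. No axiom lets \<open>Nu\<close> absorb a change of
  sign, although covariances do not see the sign of a column. The sign comes from discarding and
  rotating together: discarding \<open>Nu\<close> permits an extra zero column, and a rotation by pi
  turns the columns \<open>v, 0\<close> into \<open>- v, 0\<close>. This is why nonnegative pivots
  can always be reached, and why families of different lengths can be compared.\<close>

lemma typed_unique:
  "typed ar t m n \<Longrightarrow> typed ar t m' n' \<Longrightarrow> m = m' \<and> n = n'"
proof (induction arbitrary: m' n' rule: typed.induct)
  case (4 t m n u p)
  from 4(5) show ?case by cases (use 4 in blast)
next
  case (5 t m n u p q)
  from 5(5) show ?case by cases (use 5 in blast)
qed (auto elim: typed.cases)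

lemma diagram_eq_typed:
  "diagram_eq ar E m n t u \<Longrightarrow> typed ar t m n \<and> typed ar u m n"
proof (induction rule: diagram_eq.induct)
  case (par_assoc t m n u m' n' v m'' n'')
  then have "typed ar (t \<parallel> (u \<parallel> v)) (m + (m' + m'')) (n + (n' + n''))"
    by (intro typed.intros)
  moreover from par_assoc have
    "typed ar ((t \<parallel> u) \<parallel> v) (m + m' + m'') (n + n' + n'')"
    by (intro typed.intros)
  ultimately show ?case by (simp add: add.assoc)
next
  case (id_par t m n)
  then show ?case using typed.intros(5)[OF typed.intros(1)[of ar 0]] by fastforce
next
  case (par_id t m n)
  then show ?case using typed.intros(5)[OF _ typed.intros(1)[of ar 0]] by fastforce
next
  case (swap_swap m n)
  then show ?case by (metis typed.intros(1,2,4))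
next
  case (swap_hexagon m n p)
  have "typed ar (Swap m n \<parallel> Idn p) (m + (n + p)) (n + m + p)"
    using typed.intros(5)[OF typed.intros(2,1)] by (metis add.assoc)
  moreover have "typed ar (Idn n \<parallel> Swap m p) (n + m + p) (n + p + m)"
    using typed.intros(5)[OF typed.intros(1,2)] by (metis add.assoc)
  ultimately show ?case by (auto intro: typed.intros)
qed (auto intro: typed.intros)

text \<open>A class quantifies over the types at which its members are related. Uniqueness of types
  makes them agree, so that transitivity applies.\<close>

lemma diagram_class_eqI:
  "diagram_eq ar E m n t u \<Longrightarrow> diagram_class ar E t = diagram_class ar E u"
  unfolding diagram_class_def
  by (auto; metis diagram_eq.sym diagram_eq.trans diagram_eq_typed typed_unique)

lemma diagram_class_self: "typed ar t m n \<Longrightarrow> t \<in> diagram_class ar E t"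
  unfolding diagram_class_def using diagram_eq.refl by blast

lemma diagram_class_eq_iff:
  assumes "typed ar t m n"
  shows "diagram_class ar E t = diagram_class ar E u \<longleftrightarrow> diagram_eq ar E m n t u"
proof
  assume eq: "diagram_class ar E t = diagram_class ar E u"
  have "t \<in> diagram_class ar E u"
    using diagram_class_self[OF assms, of E] by (simp only: eq)
  then obtain m' n' where "diagram_eq ar E m' n' u t"
    unfolding diagram_class_def by blast
  then show "diagram_eq ar E m n t u"
    using assms diagram_eq_typed typed_unique diagram_eq.sym by metis
qed (rule diagram_class_eqI)

lemma seq_diagram_class:
  assumes "typed ar t m n" "typed ar u n p"
  shows "seq (presented_prop ar E) (diagram_class ar E t) (diagram_class ar E u)
    = diagram_class ar E (t ;; u)"
proof -
  have "diagram_class ar E (t' ;; u') = diagram_class ar E (t ;; u)"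
    if "t' \<in> diagram_class ar E t" "u' \<in> diagram_class ar E u" for t' u'
  proof -
    have "diagram_eq ar E m n t t'" "diagram_eq ar E n p u u'"
      using that assms diagram_eq_typed typed_unique unfolding diagram_class_def by blast+
    then show ?thesis using diagram_class_eqI diagram_eq.seq_cong by metis
  qed
  moreover have "t \<in> diagram_class ar E t" "u \<in> diagram_class ar E u"
    using assms diagram_class_self by blast+
  ultimately show ?thesis
    unfolding presented_prop_def prop_cat.simps by (intro SUP_eq_const) blast+
qed

lemma tens_diagram_class:
  assumes "typed ar t m n" "typed ar u m' n'"
  shows "tens (presented_prop ar E) (diagram_class ar E t) (diagram_class ar E u)
    = diagram_class ar E (t \<parallel> u)"
proof -
  have "diagram_class ar E (t' \<parallel> u') = diagram_class ar E (t \<parallel> u)"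
    if "t' \<in> diagram_class ar E t" "u' \<in> diagram_class ar E u" for t' u'
  proof -
    have "diagram_eq ar E m n t t'" "diagram_eq ar E m' n' u u'"
      using that assms diagram_eq_typed typed_unique unfolding diagram_class_def by blast+
    then show ?thesis using diagram_class_eqI diagram_eq.par_cong by metis
  qed
  moreover have "t \<in> diagram_class ar E t" "u \<in> diagram_class ar E u"
    using assms diagram_class_self by blast+
  ultimately show ?thesis
    unfolding presented_prop_def prop_cat.simps by (intro SUP_eq_const) blast+
qed

lemma arr_presented_prop:
  "f \<in> arr (presented_prop ar E) m n \<longleftrightarrow> (\<exists>t. typed ar t m n \<and> f = diagram_class ar E t)"
  by (auto simp: presented_prop_def)

lemma ide_presented_prop: "ide (presented_prop ar E) n = diagram_class ar E (Idn n)"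
  by (simp add: presented_prop_def)

lemma swp_presented_prop: "swp (presented_prop ar E) m n = diagram_class ar E (Swap m n)"
  by (simp add: presented_prop_def)

lemma typed_swap_par:
  "typed ar (Swap m n \<parallel> Idn p) (m + (n + p)) (n + (m + p))"
  "typed ar (Idn n \<parallel> Swap m p) (n + (m + p)) (n + p + m)"
  using typed.intros(5)[OF typed.intros(2,1)] typed.intros(5)[OF typed.intros(1,2)]
  by (metis add.assoc)+

text \<open>Each law of props is a constructor of \<open>diagram_eq\<close>, read on
  representatives. Objects are passed to the rules by hand, since premises such as
  \<open>typed ar u n p\<close> mention objects that the rewritten term does not contain.\<close>

lemma presented_prop_category: "prop_category (presented_prop ar E)"
proof
  let ?P = "presented_prop ar E" and ?c = "diagram_class ar E"
  note typed.intros[intro]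
  note simps = arr_presented_prop ide_presented_prop swp_presented_prop
  show "m = m' \<and> n = n'" if "f \<in> arr ?P m n" "f \<in> arr ?P m' n'" for f m n m' n'
    using that unfolding arr_presented_prop
    by (metis diagram_class_eq_iff diagram_eq_typed typed_unique)
  show "ide ?P n \<in> arr ?P n n" for n
    unfolding simps by blast
  show "swp ?P m n \<in> arr ?P (m + n) (n + m)" for m n
    unfolding simps by blast
  show "seq ?P f g \<in> arr ?P m p" if "f \<in> arr ?P m n" "g \<in> arr ?P n p" for f g m n p
    using that unfolding arr_presented_prop by (auto simp: seq_diagram_class)
  show "tens ?P f g \<in> arr ?P (m + m') (n + n')"
    if "f \<in> arr ?P m n" "g \<in> arr ?P m' n'" for f g m n m' n'
    using that unfolding arr_presented_prop by (auto simp: tens_diagram_class)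
  show "seq ?P (ide ?P m) f = f" if "f \<in> arr ?P m n" for f m n
    using that unfolding simps
    by (metis diagram_class_eqI diagram_eq.id_seq seq_diagram_class typed.intros(1))
  show "seq ?P f (ide ?P n) = f" if "f \<in> arr ?P m n" for f m n
    using that unfolding simps
    by (metis diagram_class_eqI diagram_eq.seq_id seq_diagram_class typed.intros(1))
  show "seq ?P (seq ?P f g) h = seq ?P f (seq ?P g h)"
    if "f \<in> arr ?P m n" "g \<in> arr ?P n p" "h \<in> arr ?P p q" for f g h m n p q
  proof -
    from that obtain t u v where
      "typed ar t m n" "f = ?c t" "typed ar u n p" "g = ?c u" "typed ar v p q" "h = ?c v"
      unfolding simps by blast
    then show ?thesis
      using diagram_class_eqI[OF diagram_eq.seq_assoc[of ar t m n u p v q E]]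
      by (simp add: seq_diagram_class[of ar _ m n _ p] seq_diagram_class[of ar _ m n _ q]
        seq_diagram_class[of ar _ m p _ q] seq_diagram_class[of ar _ n p _ q]
        typed.intros(4)[of ar _ m n _ p] typed.intros(4)[of ar _ n p _ q])
  qed
  show "tens ?P (ide ?P 0) f = f" if "f \<in> arr ?P m n" for f m n
    using that unfolding simps
    by (metis diagram_class_eqI diagram_eq.id_par tens_diagram_class typed.intros(1))
  show "tens ?P f (ide ?P 0) = f" if "f \<in> arr ?P m n" for f m n
    using that unfolding simps
    by (metis diagram_class_eqI diagram_eq.par_id tens_diagram_class typed.intros(1))
  show "tens ?P (tens ?P f g) h = tens ?P f (tens ?P g h)"
    if "f \<in> arr ?P m n" "g \<in> arr ?P m' n'" "h \<in> arr ?P m'' n''" for f g h m n m' n' m'' n''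
  proof -
    from that obtain t u v where
      "typed ar t m n" "f = ?c t" "typed ar u m' n'" "g = ?c u" "typed ar v m'' n''" "h = ?c v"
      unfolding simps by blast
    then show ?thesis
      using diagram_class_eqI[OF diagram_eq.par_assoc[of ar t m n u m' n' v m'' n'' E]]
      by (simp add: tens_diagram_class[of ar _ m n _ m' n'] tens_diagram_class[of ar _ m' n' _ m'' n'']
        tens_diagram_class[of ar _ "m + m'" "n + n'" _ m'' n'']
        tens_diagram_class[of ar _ m n _ "m' + m''" "n' + n''"]
        typed.intros(5)[of ar _ m n _ m' n'] typed.intros(5)[of ar _ m' n' _ m'' n''])
  qed
  show "tens ?P (ide ?P m) (ide ?P n) = ide ?P (m + n)" for m n
    unfolding simps by (metis tens_diagram_class typed.intros(1) diagram_class_eqI diagram_eq.id_par_id)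
  show "tens ?P (seq ?P f g) (seq ?P f' g') = seq ?P (tens ?P f f') (tens ?P g g')"
    if "f \<in> arr ?P m n" "g \<in> arr ?P n p" "f' \<in> arr ?P m' n'" "g' \<in> arr ?P n' p'"
    for f g f' g' m n p m' n' p'
  proof -
    from that obtain t u t' u' where
      "typed ar t m n" "f = ?c t" "typed ar u n p" "g = ?c u"
      "typed ar t' m' n'" "f' = ?c t'" "typed ar u' n' p'" "g' = ?c u'"
      unfolding simps by blast
    then show ?thesis
      using diagram_class_eqI[OF diagram_eq.interchange[of ar t m n u p t' m' n' u' p' E]]
      by (simp add: tens_diagram_class[of ar _ m n _ m' n'] tens_diagram_class[of ar _ n p _ n' p']
        tens_diagram_class[of ar _ m p _ m' p'] seq_diagram_class[of ar _ m n _ p]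
        seq_diagram_class[of ar _ m' n' _ p'] typed.intros(4)[of ar _ m n _ p]
        typed.intros(4)[of ar _ m' n' _ p'] typed.intros(5)[of ar _ m n _ m' n']
        typed.intros(5)[of ar _ n p _ n' p'] seq_diagram_class[of ar _ "m + m'" "n + n'" _ "p + p'"])
  qed
  show "seq ?P (tens ?P f g) (swp ?P n n') = seq ?P (swp ?P m m') (tens ?P g f)"
    if "f \<in> arr ?P m n" "g \<in> arr ?P m' n'" for f g m n m' n'
  proof -
    from that obtain t u where "typed ar t m n" "f = ?c t" "typed ar u m' n'" "g = ?c u"
      unfolding simps by blast
    then show ?thesis
      using diagram_class_eqI[OF diagram_eq.swap_natural[of ar t m n u m' n' E]]
      by (simp add: swp_presented_prop tens_diagram_class[of ar _ m n _ m' n']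
        tens_diagram_class[of ar _ m' n' _ m n] typed.intros(2)[of ar]
        typed.intros(5)[of ar _ m n _ m' n'] typed.intros(5)[of ar _ m' n' _ m n]
        seq_diagram_class[of ar _ "m + m'" "n + n'" _ "n' + n"]
        seq_diagram_class[of ar _ "m + m'" "m' + m" _ "n' + n"])
  qed
  show "seq ?P (swp ?P m n) (swp ?P n m) = ide ?P (m + n)" for m n
    unfolding simps by (metis diagram_class_eqI diagram_eq.swap_swap seq_diagram_class typed.intros(2))
  show "swp ?P m (n + p) = seq ?P (tens ?P (swp ?P m n) (ide ?P p)) (tens ?P (ide ?P n) (swp ?P m p))"
    for m n p
    using diagram_class_eqI[OF diagram_eq.swap_hexagon[of ar E m n p]]
    by (simp add: swp_presented_prop ide_presented_prop
        tens_diagram_class[of ar _ "m + n" "n + m" _ p p] tens_diagram_class[of ar _ n n _ "m + p" "p + m"]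
        typed.intros(1,2)[of ar]
        seq_diagram_class[OF typed_swap_par(1,2)])
qed

section \<open>Evaluation of diagrams in a prop\<close>

lemma eval_diagram_arr:
  assumes "prop_category Q" and "\<And>g. \<gamma> g \<in> arr Q (fst (ar g)) (snd (ar g))"
  shows "typed ar t m n \<Longrightarrow> eval_diagram Q \<gamma> t \<in> arr Q m n"
proof (induction rule: typed.induct)
  case (3 g m n)
  then show ?case using assms(2)[of g] by simp
qed (auto intro: assms prop_category.ide_arr prop_category.swp_arr prop_category.seq_arr
    prop_category.tens_arr)

lemma eval_diagram_sound:
  assumes Q: "prop_category Q" and "\<And>g. \<gamma> g \<in> arr Q (fst (ar g)) (snd (ar g))"
    and E: "\<And>t u. (t, u) \<in> E \<Longrightarrow> eval_diagram Q \<gamma> t = eval_diagram Q \<gamma> u"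
  shows "diagram_eq ar E m n t u \<Longrightarrow> eval_diagram Q \<gamma> t = eval_diagram Q \<gamma> u"
proof (induction rule: diagram_eq.induct)
  note arr = eval_diagram_arr[of Q \<gamma> ar, OF assms(1,2)]
  interpret prop_category Q by fact
  {
    case (id_seq t m n) then show ?case using ide_seq[OF arr] by simp
  next
    case (seq_id t m n) then show ?case using seq_ide[OF arr] by simp
  next
    case seq_assoc then show ?case using prop_category.seq_assoc[OF Q arr arr arr] by simp
  next
    case (id_par t m n) then show ?case using ide_tens[OF arr] by simp
  next
    case (par_id t m n) then show ?case using tens_ide[OF arr] by simp
  next
    case par_assoc then show ?case using tens_assoc[OF arr arr arr] by simp
  next
    case interchange then show ?case using prop_category.interchange[OF Q arr arr arr arr] by simp
  next
    case swap_natural then show ?case using swp_natural[OF arr arr] by simp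
  }
qed (auto simp: prop_category.ide_tens_ide[OF Q] prop_category.swp_swp[OF Q]
    prop_category.swp_hexagon[OF Q] dest: E)

text \<open>Universal property of a presentation: if the assignment of generators respects
  \<open>E\<close>, evaluation is constant on each class, so the set to which
  \<open>the_elem\<close> is applied is a singleton.\<close>

lemma presented_prop_morphism:
  assumes Q: "prop_category Q" and \<gamma>: "\<And>g. \<gamma> g \<in> arr Q (fst (ar g)) (snd (ar g))"
    and E: "\<And>t u. (t, u) \<in> E \<Longrightarrow> eval_diagram Q \<gamma> t = eval_diagram Q \<gamma> u"
  shows eval_class_diagram_class:
      "typed ar t m n \<Longrightarrow> eval_class Q \<gamma> (diagram_class ar E t) = eval_diagram Q \<gamma> t"
    and eval_class_morphism: "prop_morphism (presented_prop ar E) Q (eval_class Q \<gamma>)"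
proof -
  have ev: "eval_class Q \<gamma> (diagram_class ar E t) = eval_diagram Q \<gamma> t" if "typed ar t m n" for t m n
  proof -
    have "eval_diagram Q \<gamma> ` diagram_class ar E t = {eval_diagram Q \<gamma> t}"
      using diagram_class_self[OF that] eval_diagram_sound[of Q \<gamma> ar E, OF assms]
      unfolding diagram_class_def by fastforce
    then show ?thesis by (simp add: eval_class_def)
  qed
  then show "typed ar t m n \<Longrightarrow> eval_class Q \<gamma> (diagram_class ar E t) = eval_diagram Q \<gamma> t" .
  show "prop_morphism (presented_prop ar E) Q (eval_class Q \<gamma>)"
    unfolding prop_morphism_def prop_morphism_axioms_def
    by (auto simp: presented_prop_category Q arr_presented_prop seq_diagram_class tens_diagram_class
        ide_presented_prop swp_presented_prop ev ev[OF typed.intros(1)]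
        ev[OF typed.intros(2)] ev[OF typed.intros(4)] ev[OF typed.intros(5)]
        intro: eval_diagram_arr[of Q \<gamma> ar, OF Q \<gamma>])
qed

text \<open>The inverse chooses a preimage of unspecified type. As \<open>F\<close> preserves types
  and the hom-sets of \<open>Q\<close> are disjoint, the preimage has the type of the given
  morphism. The inverse preserves the operations because \<open>F\<close> does and is
  injective.\<close>

lemma prop_isomorphismI:
  assumes F: "prop_morphism P Q F"
    and inj: "\<And>m n f g. \<lbrakk>f \<in> arr P m n; g \<in> arr P m n; F f = F g\<rbrakk> \<Longrightarrow> f = g"
    and surj: "\<And>m n g. g \<in> arr Q m n \<Longrightarrow> \<exists>f \<in> arr P m n. F f = g"
  shows "prop_isomorphism P Q F"
proof -
  interpret prop_morphism P Q F by fact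
  define G where "G g = (SOME f. \<exists>m n. f \<in> arr P m n \<and> F f = g)" for g
  have G: "G g \<in> arr P m n" "F (G g) = g" if "g \<in> arr Q m n" for g m n
  proof -
    have "\<exists>f m n. f \<in> arr P m n \<and> F f = g" using surj[OF that] by blast
    then have "\<exists>m n. G g \<in> arr P m n \<and> F (G g) = g" unfolding G_def by (rule someI_ex)
    then show "G g \<in> arr P m n" "F (G g) = g"
      using map_arr Q.hom_disjoint that by metis+
  qed
  have GF: "G (F f) = f" if "f \<in> arr P m n" for f m n
    using inj G map_arr that by metis
  have "prop_morphism Q P G"
  proof
    show "G g \<in> arr P m n" if "g \<in> arr Q m n" for g m n using G that by blast
    show "G (ide Q n) = ide P n" for n using GF P.ide_arr map_ide by metis
    show "G (swp Q m n) = swp P m n" for m n using GF P.swp_arr map_swp by metis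
    show "G (seq Q f g) = seq P (G f) (G g)" if "f \<in> arr Q m n" "g \<in> arr Q n p" for f g m n p
      using GF G[OF that(1)] G[OF that(2)] P.seq_arr map_seq by metis
    show "G (tens Q f g) = tens P (G f) (G g)"
      if "f \<in> arr Q m n" "g \<in> arr Q m' n'" for f g m n m' n'
      using GF G[OF that(1)] G[OF that(2)] P.tens_arr map_tens by metis
  qed
  then show ?thesis
    unfolding prop_isomorphism_def using F G GF by blast
qed

section \<open>The prop of Gaussian maps\<close>

lemma arr_Gauss:
  "(A, b, S) \<in> arr Gauss m n \<longleftrightarrow> A \<in> carrier_mat n m \<and> b \<in> carrier_vec n \<and> pos_semidef n S"
  by (simp add: Gauss_def)

lemma ide_Gauss: "ide Gauss n = (1\<^sub>m n, 0\<^sub>v n, 0\<^sub>m n n)"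
  by (simp add: Gauss_def affine_gaussian_def)

lemma seq_Gauss:
  "seq Gauss (A, b, S) (C, d, X) = (C * A, C *\<^sub>v b + d, C * S * C\<^sup>T + X)"
  by (simp add: Gauss_def)

lemma tens_Gauss:
  "tens Gauss (A, b, S) (C, d, X) = (direct_sum A C, b @\<^sub>v d, direct_sum S X)"
  by (simp add: Gauss_def)

definition swap_mat :: "nat \<Rightarrow> nat \<Rightarrow> real mat" where
  "swap_mat m n = four_block_mat (0\<^sub>m n m) (1\<^sub>m n) (1\<^sub>m m) (0\<^sub>m m n)"

lemma swap_mat_carrier [simp]: "swap_mat m n \<in> carrier_mat (n + m) (m + n)"
  by (simp add: swap_mat_def)

lemma swp_Gauss: "swp Gauss m n = (swap_mat m n, 0\<^sub>v (n + m), 0\<^sub>m (n + m) (n + m))"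
  by (simp add: Gauss_def affine_gaussian_def swap_mat_def)

lemma direct_sum_dims [simp]:
  "dim_row (direct_sum A B) = dim_row A + dim_row B"
  "dim_col (direct_sum A B) = dim_col A + dim_col B"
  by (simp_all add: direct_sum_def)

lemma direct_sum_carrier [simp, intro]:
  "\<lbrakk>A \<in> carrier_mat m n; B \<in> carrier_mat m' n'\<rbrakk>
    \<Longrightarrow> direct_sum A B \<in> carrier_mat (m + m') (n + n')"
  by (simp add: direct_sum_def)

lemma index_direct_sum:
  "\<lbrakk>i < dim_row A + dim_row B; j < dim_col A + dim_col B\<rbrakk> \<Longrightarrow> direct_sum A B $$ (i, j) =
    (if i < dim_row A \<and> j < dim_col A then A $$ (i, j)
     else if i \<ge> dim_row A \<and> j \<ge> dim_col A then B $$ (i - dim_row A, j - dim_col A) else 0)"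
  by (auto simp: direct_sum_def)

lemma direct_sum_mult:
  assumes "A \<in> carrier_mat m n" "B \<in> carrier_mat n p" "A' \<in> carrier_mat m' n'" "B' \<in> carrier_mat n' p'"
  shows "direct_sum A A' * direct_sum B B' = direct_sum (A * B) (A' * B')"
  unfolding direct_sum_def using assms
  by (subst mult_four_block_mat[of _ m n _ n' _ m' _ _ p _ p']) (auto intro!: cong_four_block_mat)

lemma direct_sum_mult_vec:
  assumes "A \<in> carrier_mat m n" "v \<in> carrier_vec n" "A' \<in> carrier_mat m' n'" "v' \<in> carrier_vec n'"
  shows "direct_sum A A' *\<^sub>v (v @\<^sub>v v') = (A *\<^sub>v v) @\<^sub>v (A' *\<^sub>v v')"
  unfolding direct_sum_def using assms
  by (subst four_block_mat_mult_vec[of _ m n _ n' _ m']) auto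

lemma direct_sum_transpose:
  "(direct_sum A B)\<^sup>T = direct_sum (A\<^sup>T) (B\<^sup>T)"
  unfolding direct_sum_def
  by (subst transpose_four_block_mat[of _ "dim_row A" "dim_col A" _ "dim_col B" _ "dim_row B"]) auto

lemma direct_sum_add:
  assumes "A \<in> carrier_mat m n" "B \<in> carrier_mat m n" "A' \<in> carrier_mat m' n'" "B' \<in> carrier_mat m' n'"
  shows "direct_sum A A' + direct_sum B B' = direct_sum (A + B) (A' + B')"
  unfolding direct_sum_def using assms
  by (subst add_four_block_mat[of _ m n _ n' _ m']) (auto intro!: cong_four_block_mat)

lemma direct_sum_one: "direct_sum (1\<^sub>m m) (1\<^sub>m n) = 1\<^sub>m (m + n)"
  by (rule eq_matI) (auto simp: index_direct_sum)

lemma direct_sum_zero: "direct_sum (0\<^sub>m m n) (0\<^sub>m m' n') = 0\<^sub>m (m + m') (n + n')"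
  by (rule eq_matI) (auto simp: index_direct_sum)

lemma append_zero_vec: "0\<^sub>v m @\<^sub>v 0\<^sub>v n = 0\<^sub>v (m + n)"
  by (rule eq_vecI) auto

lemma append_vec_assoc: "(u @\<^sub>v v) @\<^sub>v w = u @\<^sub>v (v @\<^sub>v w)"
  by (rule eq_vecI) (auto simp: add.assoc)

lemma append_vec_0 [simp]:
  "u \<in> carrier_vec 0 \<Longrightarrow> u @\<^sub>v v = v" "u \<in> carrier_vec 0 \<Longrightarrow> v @\<^sub>v u = v"
  by (rule eq_vecI; auto)+

lemma direct_sum_assoc: "direct_sum (direct_sum A B) C = direct_sum A (direct_sum B C)"
  unfolding direct_sum_def by (rule assoc_four_block_mat[symmetric])

lemma direct_sum_0 [simp]:
  "A \<in> carrier_mat 0 0 \<Longrightarrow> direct_sum A B = B" "A \<in> carrier_mat 0 0 \<Longrightarrow> direct_sum B A = B"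
  by (rule eq_matI; auto simp: index_direct_sum)+

section \<open>Closure properties of positive semidefinite matrices\<close>

lemma pos_semidefI:
  assumes "S \<in> carrier_mat n n" "S\<^sup>T = S" "\<And>v. v \<in> carrier_vec n \<Longrightarrow> 0 \<le> v \<bullet> (S *\<^sub>v v)"
  shows "pos_semidef n S"
  using assms by (simp add: pos_semidef_def)

lemma zero_mat_mult_vec [simp]: "v \<in> carrier_vec n \<Longrightarrow> 0\<^sub>m m n *\<^sub>v v = 0\<^sub>v m"
  by (rule eq_vecI) auto

lemma mat_mult_zero_vec: "A \<in> carrier_mat m n \<Longrightarrow> A *\<^sub>v 0\<^sub>v n = 0\<^sub>v m"
  by (rule eq_vecI) auto

lemma pos_semidef_zero: "pos_semidef n (0\<^sub>m n n)"
  by (rule pos_semidefI) auto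

lemma pos_semidef_one: "pos_semidef n (1\<^sub>m n)"
  by (rule pos_semidefI) (auto simp: scalar_prod_def intro: sum_nonneg)

lemma pos_semidef_add:
  assumes "pos_semidef n S" "pos_semidef n X"
  shows "pos_semidef n (S + X)"
proof (rule pos_semidefI)
  have c: "S \<in> carrier_mat n n" "X \<in> carrier_mat n n" and t: "S\<^sup>T = S" "X\<^sup>T = X"
    using assms by (auto simp: pos_semidef_def)
  then show "S + X \<in> carrier_mat n n" by simp
  show "(S + X)\<^sup>T = S + X"
    using transpose_add[OF c] t by simp
  show "0 \<le> v \<bullet> ((S + X) *\<^sub>v v)" if "v \<in> carrier_vec n" for v
    using assms that c
    by (auto simp: pos_semidef_def add_mult_distrib_mat_vec[of _ n n] scalar_prod_add_distrib[of _ n])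
qed

text \<open>The quadratic form of \<open>C * S * C\<^sup>T\<close> at \<open>v\<close> is that of
  \<open>S\<close> at \<open>C\<^sup>T *\<^sub>v v\<close>.\<close>

lemma pos_semidef_congruence:
  assumes S: "pos_semidef n S" and C: "C \<in> carrier_mat p n"
  shows "pos_semidef p (C * S * C\<^sup>T)"
proof (rule pos_semidefI)
  have c: "S \<in> carrier_mat n n" and t: "S\<^sup>T = S"
    using S by (auto simp: pos_semidef_def)
  show "C * S * C\<^sup>T \<in> carrier_mat p p"
    using c C by simp
  have "(C * S * C\<^sup>T)\<^sup>T = C * (C * S)\<^sup>T"
    using c C by (subst transpose_mult[of _ p n _ p]) auto
  also have "(C * S)\<^sup>T = S * C\<^sup>T"
    using c C t by (subst transpose_mult[of _ p n _ n]) auto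
  also have "C * (S * C\<^sup>T) = C * S * C\<^sup>T"
    using c C by (subst assoc_mult_mat[of _ p n _ n _ p]) auto
  finally show "(C * S * C\<^sup>T)\<^sup>T = C * S * C\<^sup>T" .
  show "0 \<le> v \<bullet> (C * S * C\<^sup>T *\<^sub>v v)" if v: "v \<in> carrier_vec p" for v
  proof -
    have "v \<bullet> (C * S * C\<^sup>T *\<^sub>v v) = v \<bullet> (C *\<^sub>v (S *\<^sub>v (C\<^sup>T *\<^sub>v v)))"
      using c C v by (simp add: assoc_mult_mat_vec[of _ p n _ n] assoc_mult_mat_vec[of _ p n _ p])
    also have "\<dots> = (C\<^sup>T *\<^sub>v v) \<bullet> (S *\<^sub>v (C\<^sup>T *\<^sub>v v))"
      using c C v by (simp add: transpose_vec_mult_scalar[of _ p n])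
    finally show ?thesis using S c C v by (simp add: pos_semidef_def)
  qed
qed

lemma pos_semidef_direct_sum:
  assumes "pos_semidef m S" "pos_semidef n X"
  shows "pos_semidef (m + n) (direct_sum S X)"
proof (rule pos_semidefI)
  have c: "S \<in> carrier_mat m m" "X \<in> carrier_mat n n" and t: "S\<^sup>T = S" "X\<^sup>T = X"
    using assms by (auto simp: pos_semidef_def)
  then show "direct_sum S X \<in> carrier_mat (m + n) (m + n)" by simp
  show "(direct_sum S X)\<^sup>T = direct_sum S X"
    using t by (simp add: direct_sum_transpose)
  show "0 \<le> v \<bullet> (direct_sum S X *\<^sub>v v)" if v: "v \<in> carrier_vec (m + n)" for v
  proof -
    let ?u = "vec_first v m" and ?w = "vec_last v n"
    have "v \<bullet> (direct_sum S X *\<^sub>v v) = (?u @\<^sub>v ?w) \<bullet> (direct_sum S X *\<^sub>v (?u @\<^sub>v ?w))"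
      using v by simp
    also have "\<dots> = ?u \<bullet> (S *\<^sub>v ?u) + ?w \<bullet> (X *\<^sub>v ?w)"
      using c by (simp add: direct_sum_mult_vec[of _ m m _ _ n n] scalar_prod_append[of _ m _ n])
    finally show ?thesis using assms by (simp add: pos_semidef_def)
  qed
qed

section \<open>Block swap matrices\<close>

lemma swap_mat_mult_direct_sum:
  assumes "A \<in> carrier_mat n m" "B \<in> carrier_mat n' m'"
  shows "swap_mat n n' * direct_sum A B = direct_sum B A * swap_mat m m'"
  using assms unfolding direct_sum_def swap_mat_def
  by (simp add: mult_four_block_mat[of _ n' n _ n' _ n _ _ m _ m']
      mult_four_block_mat[of _ n' m' _ m _ n _ _ m _ m'])

lemma swap_mat_mult_swap_mat: "swap_mat n m * swap_mat m n = 1\<^sub>m (m + n)"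
  unfolding swap_mat_def
  by (simp add: mult_four_block_mat[of _ m n _ m _ n _ _ m _ n])

lemma swap_mat_transpose: "(swap_mat m n)\<^sup>T = swap_mat n m"
  unfolding swap_mat_def
  by (simp add: transpose_four_block_mat[of _ n m _ n _ m])

lemma swap_mat_mult_append:
  assumes "u \<in> carrier_vec m" "v \<in> carrier_vec n"
  shows "swap_mat m n *\<^sub>v (u @\<^sub>v v) = v @\<^sub>v u"
  using assms unfolding swap_mat_def
  by (simp add: four_block_mat_mult_vec[of _ n m _ n _ m])

lemma mat_eq_mult_vecI:
  fixes A B :: "real mat"
  assumes "A \<in> carrier_mat m n" "B \<in> carrier_mat m n"
    and eq: "\<And>v. v \<in> carrier_vec n \<Longrightarrow> A *\<^sub>v v = B *\<^sub>v v"
  shows "A = B"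
proof (rule eq_matI)
  fix i j assume "i < dim_row B" "j < dim_col B"
  then have *: "i < m" "j < n" using assms by auto
  then have "(A *\<^sub>v unit_vec n j) $ i = (B *\<^sub>v unit_vec n j) $ i" using eq by simp
  then show "A $$ (i, j) = B $$ (i, j)" using * assms(1,2) by (auto simp: scalar_prod_right_unit)
qed (use assms in auto)

text \<open>The matrices involved are cut into blocks at different places. They are therefore
  compared by their action on a vector cut into three pieces, which both sides merely
  permute.\<close>

lemma swap_mat_hexagon:
  "swap_mat m (n + p) = direct_sum (1\<^sub>m n) (swap_mat m p) * direct_sum (swap_mat m n) (1\<^sub>m p)"
    (is "_ = ?B * ?A")
proof (rule mat_eq_mult_vecI[of _ "n + p + m" "m + n + p"])
  show "swap_mat m (n + p) \<in> carrier_mat (n + p + m) (m + n + p)"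
    using swap_mat_carrier[of m "n + p"] by (simp add: add.assoc)
  have A: "?A \<in> carrier_mat (n + m + p) (m + n + p)" by (intro direct_sum_carrier) auto
  have "?B \<in> carrier_mat (n + (p + m)) (n + (m + p))" by (intro direct_sum_carrier) auto
  then have B: "?B \<in> carrier_mat (n + p + m) (n + m + p)" by (simp add: add.assoc)
  show "?B * ?A \<in> carrier_mat (n + p + m) (m + n + p)" using A B by (rule mult_carrier_mat[rotated])
  fix v :: "real vec" assume v: "v \<in> carrier_vec (m + n + p)"
  define u where "u = vec_first (vec_first v (m + n)) m"
  define w where "w = vec_last (vec_first v (m + n)) n"
  define x where "x = vec_last v p"
  have c: "u \<in> carrier_vec m" "w \<in> carrier_vec n" "x \<in> carrier_vec p"
    by (simp_all add: u_def w_def x_def)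
  have v_eq: "v = (u @\<^sub>v w) @\<^sub>v x" using v by (simp add: u_def w_def x_def)
  have "?B * ?A *\<^sub>v v = ?B *\<^sub>v (?A *\<^sub>v v)" by (rule assoc_mult_mat_vec[OF B A v])
  also have "?A *\<^sub>v v = w @\<^sub>v (u @\<^sub>v x)"
    unfolding v_eq using c
    by (subst direct_sum_mult_vec[of _ "n + m" "m + n" _ _ p p])
      (auto simp: swap_mat_mult_append append_vec_assoc)
  also have "?B *\<^sub>v \<dots> = w @\<^sub>v (x @\<^sub>v u)"
    using c by (simp add: direct_sum_mult_vec[of _ n n _ _ "p + m" "m + p"] swap_mat_mult_append)
  also have "\<dots> = swap_mat m (n + p) *\<^sub>v v"
    unfolding v_eq append_vec_assoc using c
    by (simp add: swap_mat_mult_append append_vec_assoc)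
  finally show "swap_mat m (n + p) *\<^sub>v v = ?B * ?A *\<^sub>v v" ..
qed

text \<open>Covariance part of associativity in \<open>Gauss\<close>: the noise \<open>S\<close>
  passes through \<open>E * C\<close>, the noise \<open>X\<close> only through
  \<open>E\<close>.\<close>

lemma conjugate_compose:
  fixes S X Y C E :: "real mat"
  assumes "S \<in> carrier_mat n n" "C \<in> carrier_mat p n" "X \<in> carrier_mat p p"
    "E \<in> carrier_mat q p" "Y \<in> carrier_mat q q"
  shows "E * (C * S * C\<^sup>T + X) * E\<^sup>T + Y = E * C * S * (E * C)\<^sup>T + (E * X * E\<^sup>T + Y)"
proof -
  have "E * (C * S * C\<^sup>T + X) * E\<^sup>T = E * (C * S * C\<^sup>T) * E\<^sup>T + E * X * E\<^sup>T"
    using assms by (simp add: mult_add_distrib_mat[of _ q p _ p] add_mult_distrib_mat[of _ q p _ _ q])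
  moreover have "E * (C * S * C\<^sup>T) * E\<^sup>T = E * C * S * (E * C)\<^sup>T"
    using assms by (simp add: transpose_mult[of _ q p _ n] assoc_mult_mat[of _ q p _ n _ n]
        assoc_mult_mat[of _ q p _ n _ q] assoc_mult_mat[of _ q p _ p _ q] assoc_mult_mat[of _ p n _ n _ p]
        assoc_mult_mat[of _ p n _ n _ q] assoc_mult_mat[of _ p n _ p _ q] assoc_mult_mat[of _ q n _ n _ q]
        assoc_mult_mat[of _ n n _ p _ q])
  moreover have "E * C * S * (E * C)\<^sup>T \<in> carrier_mat q q" "E * X * E\<^sup>T \<in> carrier_mat q q"
    using assms by auto
  ultimately show ?thesis using assms(5) by (simp add: assoc_add_mat[of _ q q])
qed

lemma Gauss_category: "prop_category Gauss"
proof
  have cases: "thesis" if "f \<in> arr Gauss m n"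
    "\<And>A b S. \<lbrakk>f = (A, b, S); A \<in> carrier_mat n m; b \<in> carrier_vec n; S \<in> carrier_mat n n;
      pos_semidef n S\<rbrakk> \<Longrightarrow> thesis" for f m n thesis
    using that by (cases f) (auto simp: arr_Gauss pos_semidef_def)
  show "m = m' \<and> n = n'" if "f \<in> arr Gauss m n" "f \<in> arr Gauss m' n'" for f m n m' n'
    using that by (cases f) (auto simp: arr_Gauss)
  show "ide Gauss n \<in> arr Gauss n n" for n
    by (simp add: ide_Gauss arr_Gauss pos_semidef_zero)
  show "swp Gauss m n \<in> arr Gauss (m + n) (n + m)" for m n
    by (simp add: swp_Gauss arr_Gauss pos_semidef_zero)
  show "seq Gauss f g \<in> arr Gauss m p" if "f \<in> arr Gauss m n" "g \<in> arr Gauss n p" for f g m n p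
    using that
    by (auto elim!: cases simp: seq_Gauss arr_Gauss pos_semidef_add pos_semidef_congruence)
  show "tens Gauss f g \<in> arr Gauss (m + m') (n + n')"
    if "f \<in> arr Gauss m n" "g \<in> arr Gauss m' n'" for f g m n m' n'
    using that
    by (auto elim!: cases simp: tens_Gauss arr_Gauss pos_semidef_direct_sum)
  show "seq Gauss (ide Gauss m) f = f" if "f \<in> arr Gauss m n" for f m n
    using that by (rule cases) (auto simp: ide_Gauss seq_Gauss)
  show "seq Gauss f (ide Gauss n) = f" if "f \<in> arr Gauss m n" for f m n
    using that by (rule cases) (auto simp: ide_Gauss seq_Gauss)
  show "seq Gauss (seq Gauss f g) h = seq Gauss f (seq Gauss g h)"
    if "f \<in> arr Gauss m n" "g \<in> arr Gauss n p" "h \<in> arr Gauss p q" for f g h m n p q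
    using that
    by (auto elim!: cases simp: seq_Gauss conjugate_compose[of _ n _ p _ _ q] assoc_mult_mat[of _ q p _ n _ m]
        mult_add_distrib_mat_vec[of _ q p] assoc_mult_mat_vec[of _ q p _ n] assoc_add_vec[of _ q]
        simp del: assoc_mult_mat)
  show "tens Gauss (ide Gauss 0) f = f" if "f \<in> arr Gauss m n" for f m n
    using that by (rule cases) (auto simp: ide_Gauss tens_Gauss)
  show "tens Gauss f (ide Gauss 0) = f" if "f \<in> arr Gauss m n" for f m n
    using that by (rule cases) (auto simp: ide_Gauss tens_Gauss)
  show "tens Gauss (tens Gauss f g) h = tens Gauss f (tens Gauss g h)"
    if "f \<in> arr Gauss m n" "g \<in> arr Gauss m' n'" "h \<in> arr Gauss m'' n''" for f g h m n m' n' m'' n''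
    by (cases f; cases g; cases h) (simp add: tens_Gauss direct_sum_assoc append_vec_assoc)
  show "tens Gauss (ide Gauss m) (ide Gauss n) = ide Gauss (m + n)" for m n
    by (simp add: tens_Gauss ide_Gauss direct_sum_one direct_sum_zero append_zero_vec)
  show "tens Gauss (seq Gauss f g) (seq Gauss f' g') = seq Gauss (tens Gauss f f') (tens Gauss g g')"
    if "f \<in> arr Gauss m n" "g \<in> arr Gauss n p" "f' \<in> arr Gauss m' n'" "g' \<in> arr Gauss n' p'"
    for f g f' g' m n p m' n' p'
    using that
    by (auto elim!: cases simp: seq_Gauss tens_Gauss direct_sum_mult[of _ p n _ m _ p' n' _ m']
        direct_sum_mult[of _ p n _ n _ p' n' _ n'] direct_sum_mult[of _ p n _ p _ p' n' _ p']
        direct_sum_transpose direct_sum_add[of _ p p _ _ p' p'] direct_sum_mult_vec[of _ p n _ _ p' n']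
        append_vec_add[of _ p _ _ p'])
  show "seq Gauss (tens Gauss f g) (swp Gauss n n') = seq Gauss (swp Gauss m m') (tens Gauss g f)"
    if "f \<in> arr Gauss m n" "g \<in> arr Gauss m' n'" for f g m n m' n'
  proof -
    from that(1) obtain A b S where f: "f = (A, b, S)" "A \<in> carrier_mat n m" "b \<in> carrier_vec n"
      "S \<in> carrier_mat n n" by (rule cases)
    from that(2) obtain C d X where g: "g = (C, d, X)" "C \<in> carrier_mat n' m'" "d \<in> carrier_vec n'"
      "X \<in> carrier_mat n' n'" by (rule cases)
    have XS: "direct_sum X S \<in> carrier_mat (n' + n) (n' + n)"
      using f g by auto
    \<comment> \<open>Covariance part of naturality: the transposed swap is the inverse swap, and
      conjugation exchanges the diagonal blocks.\<close>
    have "swap_mat n n' * direct_sum S X * (swap_mat n n')\<^sup>T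
        = direct_sum X S * (swap_mat n n' * swap_mat n' n)"
      using f g XS unfolding swap_mat_transpose
      by (simp add: swap_mat_mult_direct_sum[of _ n n _ n' n']
          assoc_mult_mat[of _ "n' + n" "n' + n" _ "n + n'" _ "n' + n"])
    also have "\<dots> = direct_sum X S"
      by (simp add: swap_mat_mult_swap_mat right_mult_one_mat[OF XS])
    finally have "swap_mat n n' * direct_sum S X * (swap_mat n n')\<^sup>T = direct_sum X S" .
    then show ?thesis
      using f g XS swap_mat_carrier[of m m'] direct_sum_carrier[of C n' m' A n m]
      by (auto simp: tens_Gauss swp_Gauss seq_Gauss swap_mat_mult_direct_sum swap_mat_mult_append
          right_mult_zero_mat[of _ "n' + n" "m' + m"] add.commute[of m m'])
  qed
  show "seq Gauss (swp Gauss m n) (swp Gauss n m) = ide Gauss (m + n)" for m n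
    by (simp add: seq_Gauss swp_Gauss ide_Gauss swap_mat_mult_swap_mat swap_mat_transpose
        right_mult_zero_mat[OF swap_mat_carrier] left_mult_zero_mat[OF swap_mat_carrier]
        mat_mult_zero_vec[OF swap_mat_carrier])
  show "swp Gauss m (n + p) = seq Gauss (tens Gauss (swp Gauss m n) (ide Gauss p))
      (tens Gauss (ide Gauss n) (swp Gauss m p))" for m n p
  proof -
    have "direct_sum (1\<^sub>m n) (swap_mat m p) \<in> carrier_mat (n + (p + m)) (n + (m + p))"
      by (intro direct_sum_carrier) auto
    then show ?thesis
      by (simp add: seq_Gauss tens_Gauss swp_Gauss ide_Gauss swap_mat_hexagon direct_sum_zero
        append_zero_vec add.assoc right_mult_zero_mat[of _ "n + (p + m)" "n + (m + p)"]
        left_mult_zero_mat[of _ "n + (m + p)" "n + (p + m)"]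
        mat_mult_zero_vec[of _ "n + (p + m)" "n + (m + p)"])
  qed
qed

section \<open>Soundness of the equations\<close>

lemma seq_affine_gaussian:
  assumes "dim_row A = dim_col C"
  shows "seq Gauss (affine_gaussian A b) (affine_gaussian C d) = affine_gaussian (C * A) (C *\<^sub>v b + d)"
proof -
  have "C * 0\<^sub>m (dim_row A) (dim_row A) * C\<^sup>T = 0\<^sub>m (dim_row C) (dim_row C)"
    using assms right_mult_zero_mat[of C "dim_row C" "dim_row A" "dim_row A"]
      left_mult_zero_mat[of "C\<^sup>T" "dim_row A" "dim_row C" "dim_row C"] by simp
  then show ?thesis by (simp add: seq_Gauss affine_gaussian_def)
qed

lemma tens_affine_gaussian:
  "tens Gauss (affine_gaussian A b) (affine_gaussian C d) = affine_gaussian (direct_sum A C) (b @\<^sub>v d)"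
  by (simp add: tens_Gauss affine_gaussian_def direct_sum_zero)

lemma ide_affine_gaussian: "ide Gauss n = affine_gaussian (1\<^sub>m n) (0\<^sub>v n)"
  by (simp add: Gauss_def)

lemma swp_affine_gaussian: "swp Gauss m n = affine_gaussian (swap_mat m n) (0\<^sub>v (n + m))"
  by (simp add: Gauss_def swap_mat_def)

lemma affine_gaussian_eqI:
  assumes "dim_row A = dim_row C" "dim_col A = dim_col C" "dim_vec b = dim_vec d"
    "\<forall>i<dim_row C. \<forall>j<dim_col C. A $$ (i, j) = C $$ (i, j)" "\<forall>i<dim_vec d. b $ i = d $ i"
  shows "affine_gaussian A b = affine_gaussian C d"
proof -
  have "A = C" using assms by (intro eq_matI) auto
  moreover have "b = d" using assms by (intro eq_vecI) auto
  ultimately show ?thesis by simp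
qed

lemma gauss_gen_arr: "gauss_gen g \<in> arr Gauss (fst (gqa_arity g)) (snd (gqa_arity g))"
  by (cases g) (auto simp: affine_gaussian_def arr_Gauss pos_semidef_zero pos_semidef_one)

definition rotation_mat :: "real \<Rightarrow> real mat" where
  "rotation_mat \<phi> = mat 2 2 (\<lambda>(i, j). if i = j then cos \<phi> else if i = 0 then - sin \<phi> else sin \<phi>)"

lemmas affine_eval = seq_affine_gaussian tens_affine_gaussian ide_affine_gaussian swp_affine_gaussian

lemma index_mult_mat_sum:
  "\<lbrakk>i < dim_row A; j < dim_col B; dim_col A = dim_row B\<rbrakk>
    \<Longrightarrow> (A * B) $$ (i, j) = (\<Sum>k<dim_row B. A $$ (i, k) * B $$ (k, j))"
  by (simp add: scalar_prod_def atLeast0LessThan)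

lemma index_mult_mat_vec_sum:
  "\<lbrakk>i < dim_row A; dim_col A = dim_vec v\<rbrakk>
    \<Longrightarrow> (A *\<^sub>v v) $ i = (\<Sum>k<dim_vec v. A $$ (i, k) * v $ k)"
  by (simp add: scalar_prod_def atLeast0LessThan)

lemmas small_mat = index_mult_mat_sum index_mult_mat_vec_sum index_direct_sum numeral_eq_Suc

lemma eval_rotation: "eval_diagram Gauss gauss_gen (rotation \<phi>) = affine_gaussian (rotation_mat \<phi>) (0\<^sub>v 2)"
  unfolding rotation_def
  by (simp add: affine_eval swap_mat_def)
    (rule affine_gaussian_eqI; simp add: numeral_eq_Suc All_less_Suc rotation_mat_def
      del: index_mult_mat(1) index_mult_mat_vec; (intro conjI)?;
      simp add: small_mat rotation_mat_def del: index_mult_mat(1) index_mult_mat_vec)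

text \<open>Only the two axioms on \<open>Nu\<close> involve noise. All others relate affine maps,
  whose covariances vanish, so comparing the entries of matrices of fixed small size
  suffices.\<close>

lemma gqa_equations_sound:
  "(t, u) \<in> gqa_equations \<Longrightarrow> eval_diagram Gauss gauss_gen t = eval_diagram Gauss gauss_gen u"
proof (induction rule: gqa_equations.induct)
  case nu_discard
  show ?case by (auto simp: seq_Gauss ide_Gauss affine_gaussian_def)
next
  case (nu_rotation \<phi>)
  \<comment> \<open>Two copies of \<open>Nu\<close> have the identity matrix as covariance; it is
    preserved because a rotation matrix is orthogonal.\<close>
  have "sin \<phi> * sin \<phi> + cos \<phi> * cos \<phi> = 1"
    by (metis add.commute sin_cos_squared_add3)
  then have "rotation_mat \<phi> * (rotation_mat \<phi>)\<^sup>T = 1\<^sub>m 2"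
    by (intro eq_matI) (auto simp: rotation_mat_def scalar_prod_def numeral_eq_Suc less_Suc_eq)
  moreover have "rotation_mat \<phi> \<in> carrier_mat 2 2"
    by (simp add: rotation_mat_def)
  moreover have "eval_diagram Gauss gauss_gen (g_nu \<parallel> g_nu) = (0\<^sub>m 2 0, 0\<^sub>v 2, 1\<^sub>m 2)"
    by (simp add: tens_Gauss direct_sum_one direct_sum_zero append_zero_vec numeral_2_eq_2)
  ultimately show ?case unfolding eval_diagram.simps(4) eval_rotation
    by (simp add: seq_Gauss affine_gaussian_def mat_mult_zero_vec[of _ 2 2]
        right_mult_zero_mat[of _ 2 2] right_mult_one_mat[of _ 2 2])
qed (simp add: affine_eval swap_mat_def; rule affine_gaussian_eqI;
  (simp add: numeral_eq_Suc All_less_Suc del: index_mult_mat(1) index_mult_mat_vec)?; (intro conjI)?;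
  simp add: small_mat algebra_simps del: index_mult_mat(1) index_mult_mat_vec)+

lemma interpretation_map_diagram_class:
  "typed gqa_arity t m n \<Longrightarrow>
    interpretation_map (diagram_class gqa_arity gqa_equations t) = eval_diagram Gauss gauss_gen t"
  unfolding interpretation_map_def
  by (rule eval_class_diagram_class) (auto intro: Gauss_category gauss_gen_arr gqa_equations_sound)

lemma interpretation_map_morphism: "prop_morphism GQA Gauss interpretation_map"
  unfolding interpretation_map_def GQA_def
  by (rule eval_class_morphism) (auto intro: Gauss_category gauss_gen_arr gqa_equations_sound)

section \<open>Commutative comonoids in props\<close>

text \<open>The locale covers copying in the prop and addition in the opposite prop. Passing to the
  opposite exchanges the hexagons \<open>swap_right\<close> and \<open>swap_left\<close>, so both
  appear. One wire is written \<open>Suc 0\<close> because this is the form that simplification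
  produces.\<close>

locale comonoid_prop =
  fixes dom cod :: "'a \<Rightarrow> nat" and sq :: "'a \<Rightarrow> 'a \<Rightarrow> 'a" (infixl \<open>\<rhd>\<close> 60)
    and ts :: "'a \<Rightarrow> 'a \<Rightarrow> 'a" (infixl \<open>\<boxtimes>\<close> 65)
    and I :: "nat \<Rightarrow> 'a" and S :: "nat \<Rightarrow> nat \<Rightarrow> 'a" and cp ds :: 'a
  assumes dims [simp]:
      "dom (f \<rhd> g) = dom f" "cod (f \<rhd> g) = cod g" "dom (f \<boxtimes> g) = dom f + dom g"
      "cod (f \<boxtimes> g) = cod f + cod g" "dom (I n) = n" "cod (I n) = n"
      "dom (S m n) = m + n" "cod (S m n) = n + m"
      "dom cp = Suc 0" "cod cp = Suc (Suc 0)" "dom ds = Suc 0" "cod ds = 0"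
    and id_sq [simp]: "dom f = n \<Longrightarrow> I n \<rhd> f = f"
    and sq_id [simp]: "cod f = n \<Longrightarrow> f \<rhd> I n = f"
    and sq_assoc: "f \<rhd> g \<rhd> h = f \<rhd> (g \<rhd> h)"
    and id_ts [simp]: "I 0 \<boxtimes> f = f"
    and ts_id [simp]: "f \<boxtimes> I 0 = f"
    and ts_assoc: "f \<boxtimes> g \<boxtimes> h = f \<boxtimes> (g \<boxtimes> h)"
    and id_ts_id [simp]: "I m \<boxtimes> I n = I (m + n)"
    and interchange: "\<lbrakk>cod f = dom g; cod f' = dom g'\<rbrakk> \<Longrightarrow> (f \<boxtimes> f') \<rhd> (g \<boxtimes> g') = (f \<rhd> g) \<boxtimes> (f' \<rhd> g')"
    and swap_natural: "\<lbrakk>cod f = n; cod g = n'; dom f = m; dom g = m'\<rbrakk>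
      \<Longrightarrow> (f \<boxtimes> g) \<rhd> S n n' = S m m' \<rhd> (g \<boxtimes> f)"
    and swap_swap [simp]: "S m n \<rhd> S n m = I (m + n)"
    and swap_right: "S m (n + p) = (S m n \<boxtimes> I p) \<rhd> (I n \<boxtimes> S m p)"
    and swap_left: "S (m + n) p = (I m \<boxtimes> S n p) \<rhd> (S m p \<boxtimes> I n)"
    and coassoc: "cp \<rhd> (cp \<boxtimes> I (Suc 0)) = cp \<rhd> (I (Suc 0) \<boxtimes> cp)"
    and counit: "cp \<rhd> (ds \<boxtimes> I (Suc 0)) = I (Suc 0)"
    and cocomm: "cp \<rhd> S (Suc 0) (Suc 0) = cp"
begin

lemma id_ts_id_ts [simp]: "I m \<boxtimes> (I n \<boxtimes> f) = I (m + n) \<boxtimes> f"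
  by (simp flip: ts_assoc)

lemma swap_swap_sq [simp]: "dom f = m + n \<Longrightarrow> S m n \<rhd> (S n m \<rhd> f) = f"
  by (simp flip: sq_assoc)

text \<open>The hexagon for two empty bundles makes \<open>S m 0\<close> idempotent; being
  invertible, it is an identity.\<close>

lemma swap_0 [simp]: "S m 0 = I m" "S 0 m = I m"
proof -
  have "S m 0 \<rhd> S m 0 = S m 0" using swap_right[of m 0 0] by simp
  then have "S m 0 \<rhd> S m 0 \<rhd> S 0 m = S m 0 \<rhd> S 0 m" by simp
  then show "S m 0 = I m" by (simp add: sq_assoc)
  then have "S m 0 \<rhd> S 0 m = S 0 m" by simp
  then show "S 0 m = I m" by simp
qed

lemma slide: "\<lbrakk>cod f = n; dom g = m\<rbrakk> \<Longrightarrow> (f \<boxtimes> I m) \<rhd> (I n \<boxtimes> g) = f \<boxtimes> g"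
  "\<lbrakk>dom f = n; cod g = m\<rbrakk> \<Longrightarrow> (I n \<boxtimes> g) \<rhd> (f \<boxtimes> I m) = f \<boxtimes> g"
  by (simp_all add: interchange)

lemma whisker:
  "cod f = dom g \<Longrightarrow> I n \<boxtimes> (f \<rhd> g) = (I n \<boxtimes> f) \<rhd> (I n \<boxtimes> g)"
  "cod f = dom g \<Longrightarrow> (f \<rhd> g) \<boxtimes> I n = (f \<boxtimes> I n) \<rhd> (g \<boxtimes> I n)"
  by (simp_all add: interchange)

text \<open>The two copies come out as consecutive blocks of \<open>n\<close> wires: the swap
  carries the second copy of the first wire past the first copy of the others.\<close>

primrec copies :: "nat \<Rightarrow> 'a" where
  "copies 0 = I 0"
| "copies (Suc n) = (cp \<boxtimes> copies n) \<rhd> (I 1 \<boxtimes> S 1 n \<boxtimes> I n)"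

primrec discards :: "nat \<Rightarrow> 'a" where
  "discards 0 = I 0"
| "discards (Suc n) = ds \<boxtimes> discards n"

lemma discards_dims [simp]: "dom (discards n) = n" "cod (discards n) = 0"
  by (induction n) auto

lemma copies_dims [simp]: "dom (copies n) = n" "cod (copies n) = n + n"
  by (induction n) auto

lemma copies_1 [simp]: "copies (Suc 0) = cp"
  by simp

lemma discards_1 [simp]: "discards (Suc 0) = ds"
  by simp

lemma discards_add: "discards (m + n) = discards m \<boxtimes> discards n"
  by (induction m) (auto simp: ts_assoc)

text \<open>The hexagons split the swap of one wire with \<open>m + n\<close> wires on the left, and
  that of \<open>Suc m\<close> with \<open>n\<close> wires on the right. The resulting pieces agree
  after sliding independent swaps past each other.\<close>

lemma copies_add: "copies (m + n) = (copies m \<boxtimes> copies n) \<rhd> (I m \<boxtimes> S m n \<boxtimes> I n)"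
proof (induction m)
  case (Suc m)
  let ?A = "cp \<boxtimes> (copies m \<boxtimes> copies n)"
  let ?e = "I 1 \<boxtimes> (S 1 m \<boxtimes> (S m n \<boxtimes> I n))" and ?c = "I (1 + m) \<boxtimes> (S 1 n \<boxtimes> I (m + n))"
  have e: "(I (2 + m) \<boxtimes> (S m n \<boxtimes> I n)) \<rhd> (I 1 \<boxtimes> (S 1 m \<boxtimes> I (n + (m + n)))) = ?e"
    using slide(2)[of "I 1 \<boxtimes> S 1 m" "2 + m" "S m n \<boxtimes> I n" "n + (m + n)"] by (simp add: ts_assoc)
  have "copies (Suc m + n) = (cp \<boxtimes> ((copies m \<boxtimes> copies n) \<rhd> (I m \<boxtimes> S m n \<boxtimes> I n)))
      \<rhd> (I 1 \<boxtimes> S 1 (m + n) \<boxtimes> I (m + n))"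
    using Suc by simp
  also have "cp \<boxtimes> ((copies m \<boxtimes> copies n) \<rhd> (I m \<boxtimes> S m n \<boxtimes> I n)) = ?A \<rhd> (I (2 + m) \<boxtimes> (S m n \<boxtimes> I n))"
    using interchange[of cp "I 2" "copies m \<boxtimes> copies n" "I m \<boxtimes> S m n \<boxtimes> I n"] by (simp add: ts_assoc)
  also have "I 1 \<boxtimes> S 1 (m + n) \<boxtimes> I (m + n)
      = (I 1 \<boxtimes> (S 1 m \<boxtimes> I (n + (m + n)))) \<rhd> ?c"
    by (simp add: swap_right whisker ts_assoc)
  also have "?A \<rhd> (I (2 + m) \<boxtimes> (S m n \<boxtimes> I n)) \<rhd> \<dots> = ?A \<rhd> (?e \<rhd> ?c)"
    unfolding e[symmetric] sq_assoc ..
  also have "?A \<rhd> (?e \<rhd> ?c) = (copies (Suc m) \<boxtimes> copies n) \<rhd> (I (Suc m) \<boxtimes> S (Suc m) n \<boxtimes> I n)"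
  proof -
    have a: "I (Suc m) \<boxtimes> S (Suc m) n \<boxtimes> I n = (I (2 + m) \<boxtimes> (S m n \<boxtimes> I n)) \<rhd> ?c"
      using swap_left[of 1 m n] by (simp add: whisker ts_assoc)
    have b: "copies (Suc m) \<boxtimes> copies n = ?A \<rhd> (I 1 \<boxtimes> (S 1 m \<boxtimes> I (m + (n + n))))"
      using interchange[of "cp \<boxtimes> copies m" "I 1 \<boxtimes> S 1 m \<boxtimes> I m" "copies n" "I (n + n)"]
      by (simp add: ts_assoc)
    have c: "(I 1 \<boxtimes> (S 1 m \<boxtimes> I (m + (n + n)))) \<rhd> (I (2 + m) \<boxtimes> (S m n \<boxtimes> I n)) = ?e"
      using slide(1)[of "I 1 \<boxtimes> S 1 m" "2 + m" "S m n \<boxtimes> I n" "m + (n + n)"] by (simp add: ts_assoc)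
    show ?thesis unfolding a b c[symmetric] sq_assoc ..
  qed
  finally show ?case .
qed simp

lemma counit': "cp \<rhd> (I (Suc 0) \<boxtimes> ds) = I (Suc 0)"
proof -
  have "cp \<rhd> (I (Suc 0) \<boxtimes> ds) = cp \<rhd> S (Suc 0) (Suc 0) \<rhd> (I (Suc 0) \<boxtimes> ds)"
    by (simp add: cocomm)
  also have "\<dots> = cp \<rhd> (ds \<boxtimes> I (Suc 0))"
    using swap_natural[of ds 0 "I (Suc 0)" "Suc 0" "Suc 0" "Suc 0"] by (simp add: sq_assoc)
  finally show ?thesis by (simp add: counit)
qed

lemma copies_discards: "copies n \<rhd> (discards n \<boxtimes> I n) = I n"
proof (induction n)
  case (Suc n)
  have "S 1 n \<rhd> (discards n \<boxtimes> I 1) = I 1 \<boxtimes> discards n"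
    using swap_natural[of "I 1" 1 "discards n" 0 1 n] by simp
  then have "(I 1 \<boxtimes> S 1 n \<boxtimes> I n) \<rhd> (ds \<boxtimes> (discards n \<boxtimes> I 1) \<boxtimes> I n) = ds \<boxtimes> (I 1 \<boxtimes> discards n) \<boxtimes> I n"
    by (simp add: interchange)
  moreover have "copies (Suc n) \<rhd> (discards (Suc n) \<boxtimes> I (Suc n))
      = (cp \<boxtimes> copies n) \<rhd> ((I 1 \<boxtimes> S 1 n \<boxtimes> I n) \<rhd> (ds \<boxtimes> (discards n \<boxtimes> I 1) \<boxtimes> I n))"
    by (simp add: sq_assoc ts_assoc)
  ultimately have "copies (Suc n) \<rhd> (discards (Suc n) \<boxtimes> I (Suc n))
      = (cp \<boxtimes> copies n) \<rhd> ((ds \<boxtimes> I 1) \<boxtimes> (discards n \<boxtimes> I n))"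
    by (simp add: ts_assoc)
  also have "\<dots> = I (Suc n)"
    using Suc by (simp add: interchange counit)
  finally show ?case .
qed simp

text \<open>Keeping the first wire of one copy and the other wires of the second restores the
  bundle. This is what allows a map to be rebuilt from its components.\<close>

lemma copies_Suc_split: "copies (Suc n) \<rhd> ((I 1 \<boxtimes> discards n) \<boxtimes> (ds \<boxtimes> I n)) = I (Suc n)"
proof -
  have "S 1 n \<rhd> (discards n \<boxtimes> ds) = ds \<boxtimes> discards n"
    using swap_natural[of ds 0 "discards n" 0 1 n] by simp
  then have "(I 1 \<boxtimes> S 1 n \<boxtimes> I n) \<rhd> (I 1 \<boxtimes> (discards n \<boxtimes> ds) \<boxtimes> I n) = I 1 \<boxtimes> (ds \<boxtimes> discards n) \<boxtimes> I n"
    by (simp add: interchange)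
  moreover have "copies (Suc n) \<rhd> ((I 1 \<boxtimes> discards n) \<boxtimes> (ds \<boxtimes> I n))
      = (cp \<boxtimes> copies n) \<rhd> ((I 1 \<boxtimes> S 1 n \<boxtimes> I n) \<rhd> (I 1 \<boxtimes> (discards n \<boxtimes> ds) \<boxtimes> I n))"
    by (simp add: sq_assoc ts_assoc)
  ultimately have "copies (Suc n) \<rhd> ((I 1 \<boxtimes> discards n) \<boxtimes> (ds \<boxtimes> I n))
      = (cp \<boxtimes> copies n) \<rhd> ((I 1 \<boxtimes> ds) \<boxtimes> (discards n \<boxtimes> I n))"
    by (simp add: ts_assoc)
  then show ?thesis
    by (simp add: interchange counit' copies_discards)
qed

text \<open>These are the homomorphisms of comonoids. For copying they are the maps that can be
  duplicated and deleted; in the opposite prop, the maps that preserve addition and zero.\<close>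

definition natural :: "'a \<Rightarrow> bool" where
  "natural f \<longleftrightarrow> f \<rhd> copies (cod f) = copies (dom f) \<rhd> (f \<boxtimes> f) \<and> f \<rhd> discards (cod f) = discards (dom f)"

lemma naturalD:
  assumes "natural f"
  shows natural_copies: "cod f = n \<Longrightarrow> f \<rhd> copies n = copies (dom f) \<rhd> (f \<boxtimes> f)"
    and natural_discards: "cod f = n \<Longrightarrow> f \<rhd> discards n = discards (dom f)"
  using assms by (auto simp: natural_def)

lemma natural_id: "natural (I n)"
  by (simp add: natural_def)

lemma natural_sq: "\<lbrakk>natural f; natural g; cod f = dom g\<rbrakk> \<Longrightarrow> natural (f \<rhd> g)"
  by (auto simp: natural_def sq_assoc interchange simp flip: sq_assoc[of f])

lemma natural_ts:
  assumes "natural f" "natural g"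
  shows "natural (f \<boxtimes> g)"
proof -
  let ?m = "dom f" and ?m' = "dom g" and ?n = "cod f" and ?n' = "cod g"
  have "(f \<boxtimes> g) \<rhd> copies (?n + ?n') = (f \<boxtimes> g) \<rhd> (copies ?n \<boxtimes> copies ?n') \<rhd> (I ?n \<boxtimes> S ?n ?n' \<boxtimes> I ?n')"
    by (simp add: copies_add sq_assoc)
  also have "(f \<boxtimes> g) \<rhd> (copies ?n \<boxtimes> copies ?n') = (copies ?m \<boxtimes> copies ?m') \<rhd> ((f \<boxtimes> f) \<boxtimes> (g \<boxtimes> g))"
    using assms by (simp add: interchange natural_copies)
  also have "(copies ?m \<boxtimes> copies ?m') \<rhd> ((f \<boxtimes> f) \<boxtimes> (g \<boxtimes> g)) \<rhd> (I ?n \<boxtimes> S ?n ?n' \<boxtimes> I ?n')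
      = (copies ?m \<boxtimes> copies ?m') \<rhd> ((f \<boxtimes> (f \<boxtimes> g) \<boxtimes> g) \<rhd> (I ?n \<boxtimes> S ?n ?n' \<boxtimes> I ?n'))"
    by (simp add: sq_assoc ts_assoc)
  also have "(f \<boxtimes> (f \<boxtimes> g) \<boxtimes> g) \<rhd> (I ?n \<boxtimes> S ?n ?n' \<boxtimes> I ?n') = f \<boxtimes> ((f \<boxtimes> g) \<rhd> S ?n ?n') \<boxtimes> g"
    by (simp add: interchange)
  also have "(f \<boxtimes> g) \<rhd> S ?n ?n' = S ?m ?m' \<rhd> (g \<boxtimes> f)"
    by (simp add: swap_natural)
  also have "f \<boxtimes> (S ?m ?m' \<rhd> (g \<boxtimes> f)) \<boxtimes> g = (I ?m \<boxtimes> S ?m ?m' \<boxtimes> I ?m') \<rhd> (f \<boxtimes> (g \<boxtimes> f) \<boxtimes> g)"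
    by (simp add: interchange)
  finally show ?thesis
    using assms by (simp add: natural_def discards_add interchange copies_add sq_assoc ts_assoc)
qed

text \<open>Both composites take blocks \<open>m m n n\<close> to \<open>n m n m\<close>. Splitting
  the large swap by hexagons exposes a swap of the middle blocks, which cancels.\<close>

lemma natural_swap: "natural (S m n)"
proof -
  have "S (m + m) (n + n) \<rhd> (I n \<boxtimes> S n m \<boxtimes> I m) = (I m \<boxtimes> S m n \<boxtimes> I n) \<rhd> (S m n \<boxtimes> S m n)"
  proof -
    have "I m \<boxtimes> S m (n + n) = (I m \<boxtimes> S m n \<boxtimes> I n) \<rhd> (I (m + n) \<boxtimes> S m n)"
      by (simp add: swap_right whisker ts_assoc)
    moreover have "S m (n + n) \<boxtimes> I m = (S m n \<boxtimes> I (n + m)) \<rhd> (I n \<boxtimes> S m n \<boxtimes> I m)"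
      by (simp add: swap_right whisker ts_assoc)
    moreover have "(I n \<boxtimes> S m n \<boxtimes> I m) \<rhd> (I n \<boxtimes> S n m \<boxtimes> I m) = I (n + (m + n) + m)"
      by (simp add: interchange)
    moreover have "(I (m + n) \<boxtimes> S m n) \<rhd> (S m n \<boxtimes> I (n + m)) = S m n \<boxtimes> S m n"
      by (simp add: slide)
    ultimately show ?thesis
      unfolding swap_left by (metis dims sq_assoc sq_id add.assoc)
  qed
  moreover have "S m n \<rhd> (copies n \<boxtimes> copies m) = (copies m \<boxtimes> copies n) \<rhd> S (m + m) (n + n)"
    by (simp add: swap_natural)
  ultimately have "S m n \<rhd> copies (n + m) = copies (m + n) \<rhd> (S m n \<boxtimes> S m n)"
    unfolding copies_add by (metis sq_assoc)
  moreover have "S m n \<rhd> discards (n + m) = discards (m + n)"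
    unfolding discards_add using swap_natural[of "discards m" 0 "discards n" 0 m n] by simp
  ultimately show ?thesis by (simp add: natural_def)
qed

lemma copy_discard_discard: "cp \<rhd> (ds \<boxtimes> ds) = ds"
proof -
  have "cp \<rhd> (ds \<boxtimes> ds) = cp \<rhd> (ds \<boxtimes> I (Suc 0)) \<rhd> ds"
    using slide(1)[of ds 0 ds 1] by (simp add: sq_assoc)
  then show ?thesis by (simp add: counit)
qed

lemma coassoc_sq: "cp \<rhd> ((I (Suc 0) \<boxtimes> cp) \<rhd> f) = cp \<rhd> ((cp \<boxtimes> I (Suc 0)) \<rhd> f)"
  by (simp add: coassoc flip: sq_assoc)

text \<open>Coassociativity rebrackets the four copies so that the two middle wires come from a
  single \<open>cp\<close>. There cocommutativity absorbs the swap.\<close>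

lemma natural_copy: "natural cp"
proof -
  let ?I = "I (Suc 0)" and ?S = "S (Suc 0) (Suc 0)"
  have "cp \<rhd> (cp \<boxtimes> cp) = cp \<rhd> (?I \<boxtimes> cp) \<rhd> (cp \<boxtimes> I (Suc (Suc 0)))"
    by (simp add: sq_assoc slide)
  also have "\<dots> = cp \<rhd> ((cp \<rhd> (cp \<boxtimes> ?I)) \<boxtimes> ?I)"
    by (simp add: sq_assoc whisker ts_assoc coassoc_sq)
  also have "\<dots> = cp \<rhd> (cp \<boxtimes> ?I) \<rhd> ((?I \<boxtimes> cp) \<boxtimes> ?I)"
    by (simp add: coassoc sq_assoc whisker ts_assoc flip: coassoc_sq)
  finally have *: "cp \<rhd> (cp \<boxtimes> cp) = cp \<rhd> (cp \<boxtimes> ?I) \<rhd> ((?I \<boxtimes> cp) \<boxtimes> ?I)" .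
  then have "cp \<rhd> (cp \<boxtimes> cp) \<rhd> (?I \<boxtimes> ?S \<boxtimes> ?I) = cp \<rhd> (cp \<boxtimes> ?I) \<rhd> ((?I \<boxtimes> (cp \<rhd> ?S)) \<boxtimes> ?I)"
    by (simp add: sq_assoc whisker)
  then have "cp \<rhd> (cp \<boxtimes> cp) \<rhd> (?I \<boxtimes> ?S \<boxtimes> ?I) = cp \<rhd> (cp \<boxtimes> cp)"
    by (simp add: cocomm *)
  then show ?thesis
    by (simp add: natural_def sq_assoc copy_discard_discard)
qed

lemma natural_discard: "natural ds"
  by (simp add: natural_def copy_discard_discard)

text \<open>Naturality moves the copying from the output of \<open>f\<close> to its input; one copy
  of \<open>f\<close> then computes the first wire and the other the remaining ones.\<close>

lemma natural_pairing:
  assumes "natural f" "cod f = Suc n"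
  shows "f = copies (dom f) \<rhd> ((f \<rhd> (I 1 \<boxtimes> discards n)) \<boxtimes> (f \<rhd> (ds \<boxtimes> I n)))"
proof -
  have "f = f \<rhd> copies (Suc n) \<rhd> ((I 1 \<boxtimes> discards n) \<boxtimes> (ds \<boxtimes> I n))"
    unfolding sq_assoc copies_Suc_split using assms by simp
  also have "\<dots> = copies (dom f) \<rhd> ((f \<boxtimes> f) \<rhd> ((I 1 \<boxtimes> discards n) \<boxtimes> (ds \<boxtimes> I n)))"
    using natural_copies[OF assms] by (simp add: sq_assoc)
  also have "(f \<boxtimes> f) \<rhd> ((I 1 \<boxtimes> discards n) \<boxtimes> (ds \<boxtimes> I n)) = (f \<rhd> (I 1 \<boxtimes> discards n)) \<boxtimes> (f \<rhd> (ds \<boxtimes> I n))"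
    using assms by (intro interchange) auto
  finally show ?thesis .
qed

lemma natural_discards_all: "natural (discards n)"
  by (induction n) (auto intro: natural_id natural_ts natural_discard)

section \<open>Projections and tuples\<close>

definition proj :: "nat \<Rightarrow> nat \<Rightarrow> 'a" where
  "proj n i = discards i \<boxtimes> I 1 \<boxtimes> discards (n - Suc i)"

lemma proj_dims [simp]: "i < n \<Longrightarrow> dom (proj n i) = n" "cod (proj n i) = Suc 0"
  by (simp_all add: proj_def)

lemma natural_proj: "natural (proj n i)"
  by (simp add: proj_def natural_ts natural_id natural_discards_all)

lemma proj_0: "proj (Suc n) 0 = I 1 \<boxtimes> discards n"
  by (simp add: proj_def)

lemma proj_Suc: "proj (Suc n) (Suc i) = ds \<boxtimes> proj n i"
  by (simp add: proj_def ts_assoc)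

lemma proj_Suc_sq: "i < n \<Longrightarrow> (ds \<boxtimes> I n) \<rhd> proj n i = proj (Suc n) (Suc i)"
  using slide(1)[of ds 0 "proj n i" n] by (simp add: proj_Suc)

text \<open>Among comonoid homomorphisms the monoidal product is cartesian, so projections are
  jointly monic. For \<open>n = 0\<close> preservation of \<open>discards\<close> makes the unit
  terminal.\<close>

lemma natural_eqI:
  assumes "natural f" "natural g" "dom f = dom g" "cod f = n" "cod g = n"
    "\<And>i. i < n \<Longrightarrow> f \<rhd> proj n i = g \<rhd> proj n i"
  shows "f = g"
  using assms
proof (induction n arbitrary: f g)
  case 0
  then show ?case using natural_discards[of f 0] natural_discards[of g 0] by simp
next
  case (Suc n)
  let ?r = "ds \<boxtimes> I n"
  have "f \<rhd> ?r = g \<rhd> ?r"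
  proof (rule Suc.IH)
    show "natural (f \<rhd> ?r)" "natural (g \<rhd> ?r)"
      using Suc.prems by (auto intro!: natural_sq natural_ts natural_id natural_discard)
    fix i assume "i < n"
    then show "f \<rhd> ?r \<rhd> proj n i = g \<rhd> ?r \<rhd> proj n i"
      using Suc.prems(6)[of "Suc i"] by (simp add: sq_assoc proj_Suc_sq)
  qed (use Suc.prems in auto)
  moreover have "f \<rhd> (I 1 \<boxtimes> discards n) = g \<rhd> (I 1 \<boxtimes> discards n)"
    using Suc.prems(6)[of 0] by (simp add: proj_0)
  ultimately show ?case
    using natural_pairing[of f n] natural_pairing[of g n] Suc.prems by metis
qed

lemma proj_add:
  "i < m \<Longrightarrow> proj (m + n) i = proj m i \<boxtimes> discards n"
  "proj (m + n) (m + i) = discards m \<boxtimes> proj n i"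
proof -
  assume "i < m"
  then have "m + n - Suc i = (m - Suc i) + n" by simp
  then show "proj (m + n) i = proj m i \<boxtimes> discards n"
    by (simp only: proj_def discards_add ts_assoc)
qed (simp add: proj_def discards_add ts_assoc)

text \<open>Joint monicity for two blocks. In \<open>copies_cocomm\<close> and
  \<open>copies_coassoc\<close> it replaces the shuffling of wires by counit laws.\<close>

lemma natural_pair_eqI:
  assumes "natural f" "natural g" "dom f = dom g" "cod f = m + n" "cod g = m + n"
    and l: "f \<rhd> (I m \<boxtimes> discards n) = g \<rhd> (I m \<boxtimes> discards n)"
    and r: "f \<rhd> (discards m \<boxtimes> I n) = g \<rhd> (discards m \<boxtimes> I n)"
  shows "f = g"
  using assms(1-5)
proof (rule natural_eqI)
  fix i assume i: "i < m + n"
  show "f \<rhd> proj (m + n) i = g \<rhd> proj (m + n) i"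
  proof (cases "i < m")
    case True
    then have "proj (m + n) i = (I m \<boxtimes> discards n) \<rhd> proj m i"
      using slide(2)[of "proj m i" m "discards n" 0] by (simp add: proj_add)
    then show ?thesis using l by (metis sq_assoc)
  next
    case False
    then obtain k where k: "i = m + k" "k < n" using i by (metis add_less_cancel_left le_iff_add not_le)
    then have "proj (m + n) i = (discards m \<boxtimes> I n) \<rhd> proj n k"
      using slide(1)[of "discards m" 0 "proj n k" n] by (simp add: proj_add)
    then show ?thesis using r by (metis sq_assoc)
  qed
qed

lemma natural_copies_all: "natural (copies n)"
  by (induction n) (auto intro!: natural_id natural_ts natural_sq natural_copy natural_swap)

lemma copies_discards': "copies n \<rhd> (I n \<boxtimes> discards n) = I n"
proof (induction n)
  case (Suc n)
  have "S 1 n \<rhd> (I n \<boxtimes> ds) = ds \<boxtimes> I n"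
    using swap_natural[of ds 0 "I n" n 1 n] by simp
  then have "(I 1 \<boxtimes> S 1 n) \<rhd> (I (Suc n) \<boxtimes> ds) = I 1 \<boxtimes> (ds \<boxtimes> I n)"
    using whisker(1)[of "S 1 n" "I n \<boxtimes> ds" 1] by simp
  then have "(I 1 \<boxtimes> S 1 n \<boxtimes> I n) \<rhd> (I 1 \<boxtimes> (I n \<boxtimes> ds) \<boxtimes> discards n) = I 1 \<boxtimes> (ds \<boxtimes> I n) \<boxtimes> discards n"
    by (simp add: interchange)
  moreover have "copies (Suc n) \<rhd> (I (Suc n) \<boxtimes> discards (Suc n))
      = (cp \<boxtimes> copies n) \<rhd> ((I 1 \<boxtimes> S 1 n \<boxtimes> I n) \<rhd> (I 1 \<boxtimes> (I n \<boxtimes> ds) \<boxtimes> discards n))"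
    by (simp add: sq_assoc ts_assoc)
  ultimately have "copies (Suc n) \<rhd> (I (Suc n) \<boxtimes> discards (Suc n))
      = (cp \<boxtimes> copies n) \<rhd> ((I 1 \<boxtimes> ds) \<boxtimes> (I n \<boxtimes> discards n))"
    by (simp add: ts_assoc)
  also have "\<dots> = I (Suc n)"
    using Suc by (simp add: interchange counit')
  finally show ?case .
qed simp

lemma copies_cocomm: "copies n \<rhd> S n n = copies n"
proof (rule natural_pair_eqI)
  show "natural (copies n \<rhd> S n n)" "natural (copies n)"
    by (simp_all add: natural_copies_all natural_sq natural_swap)
  have "S n n \<rhd> (I n \<boxtimes> discards n) = discards n \<boxtimes> I n" "S n n \<rhd> (discards n \<boxtimes> I n) = I n \<boxtimes> discards n"
    using swap_natural[of "discards n" 0 "I n" n n n] swap_natural[of "I n" n "discards n" 0 n n] by simp_all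
  then show "copies n \<rhd> S n n \<rhd> (I n \<boxtimes> discards n) = copies n \<rhd> (I n \<boxtimes> discards n)"
    "copies n \<rhd> S n n \<rhd> (discards n \<boxtimes> I n) = copies n \<rhd> (discards n \<boxtimes> I n)"
    by (simp_all add: sq_assoc copies_discards copies_discards')
qed simp_all

lemma copies_coassoc: "copies n \<rhd> (copies n \<boxtimes> I n) = copies n \<rhd> (I n \<boxtimes> copies n)"
proof (rule natural_pair_eqI)
  show "natural (copies n \<rhd> (copies n \<boxtimes> I n))" "natural (copies n \<rhd> (I n \<boxtimes> copies n))"
    by (simp_all add: natural_copies_all natural_sq natural_ts natural_id)
  have "(copies n \<boxtimes> I n) \<rhd> (I (n + n) \<boxtimes> discards n) = (I n \<boxtimes> discards n) \<rhd> copies n"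
    using slide(1)[of "copies n" "n + n" "discards n" n] slide(2)[of "copies n" n "discards n" 0] by simp
  moreover have "(I n \<boxtimes> copies n) \<rhd> (I (n + n) \<boxtimes> discards n) = I n \<boxtimes> (copies n \<rhd> (I n \<boxtimes> discards n))"
    by (simp add: whisker)
  ultimately show "copies n \<rhd> (copies n \<boxtimes> I n) \<rhd> (I (n + n) \<boxtimes> discards n)
      = copies n \<rhd> (I n \<boxtimes> copies n) \<rhd> (I (n + n) \<boxtimes> discards n)"
    by (simp add: sq_assoc copies_discards') (simp add: copies_discards' flip: sq_assoc)
  have "(copies n \<boxtimes> I n) \<rhd> (discards (n + n) \<boxtimes> I n) = discards n \<boxtimes> I n"
    using natural_discards[OF natural_copies_all, of n "n + n"] by (simp add: interchange)
  moreover have "(I n \<boxtimes> copies n) \<rhd> (discards (n + n) \<boxtimes> I n) = discards n \<boxtimes> (copies n \<rhd> (discards n \<boxtimes> I n))"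
    by (simp add: discards_add ts_assoc interchange)
  ultimately show "copies n \<rhd> (copies n \<boxtimes> I n) \<rhd> (discards (n + n) \<boxtimes> I n)
      = copies n \<rhd> (I n \<boxtimes> copies n) \<rhd> (discards (n + n) \<boxtimes> I n)"
    by (simp add: sq_assoc copies_discards)
qed (simp_all add: add.assoc)

primrec tuple :: "nat \<Rightarrow> nat \<Rightarrow> (nat \<Rightarrow> 'a) \<Rightarrow> 'a" where
  "tuple m 0 F = discards m"
| "tuple m (Suc n) F = copies m \<rhd> (F 0 \<boxtimes> tuple m n (\<lambda>i. F (Suc i)))"

lemma tuple_dims [simp]:
  "dom (tuple m n F) = m"
  "(\<And>i. i < n \<Longrightarrow> cod (F i) = 1) \<Longrightarrow> cod (tuple m n F) = n"
  by (induction n arbitrary: F) auto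

lemma natural_tuple:
  "(\<And>i. i < n \<Longrightarrow> natural (F i) \<and> dom (F i) = m) \<Longrightarrow> natural (tuple m n F)"
  by (induction n arbitrary: F)
    (auto intro!: natural_discards_all natural_sq natural_ts natural_copies_all)

text \<open>Discarding another component amounts, by its naturality, to discarding its copy of the
  input; the counit law then removes that copy.\<close>

lemma tuple_proj:
  assumes "\<And>i. i < n \<Longrightarrow> natural (F i) \<and> dom (F i) = m \<and> cod (F i) = 1" "i < n"
  shows "tuple m n F \<rhd> proj n i = F i"
  using assms
proof (induction n arbitrary: F i)
  case (Suc n)
  let ?T = "tuple m n (\<lambda>i. F (Suc i))"
  have T: "natural ?T" "cod ?T = n" "dom ?T = m" using Suc.prems by (auto intro!: natural_tuple)
  have F0: "natural (F 0)" "dom (F 0) = m" "cod (F 0) = 1" using Suc.prems(1)[of 0] by auto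
  show ?case
  proof (cases i)
    case 0
    have "(F 0 \<boxtimes> ?T) \<rhd> (I 1 \<boxtimes> discards n) = F 0 \<boxtimes> discards m"
      using T F0 by (simp add: interchange natural_discards)
    also have "\<dots> = (I m \<boxtimes> discards m) \<rhd> F 0"
      using slide(2)[of "F 0" m "discards m" 0] F0 by simp
    finally show ?thesis
      using F0 by (simp add: 0 proj_0 sq_assoc) (simp add: copies_discards' flip: sq_assoc)
  next
    case (Suc k)
    have "(F 0 \<boxtimes> ?T) \<rhd> (ds \<boxtimes> proj n k) = discards m \<boxtimes> F i"
      using T F0 Suc.prems Suc natural_discards[of "F 0" 1] Suc.IH[of "\<lambda>i. F (Suc i)" k]
      by (simp add: interchange)
    also have "\<dots> = (discards m \<boxtimes> I m) \<rhd> F i"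
      using slide(1)[of "discards m" 0 "F i" m] Suc.prems by simp
    finally show ?thesis
      using Suc.prems(1)[OF Suc.prems(2)]
      by (simp add: Suc proj_Suc sq_assoc) (simp add: copies_discards flip: sq_assoc)
  qed
qed simp

end

section \<open>Arrows of graphical quadratic algebra\<close>

interpretation GQA: prop_category GQA
  unfolding GQA_def by (rule presented_prop_category)

abbreviation gqa_class :: "gqa_gen diagram \<Rightarrow> gqa_gen diagram set" where
  "gqa_class \<equiv> diagram_class gqa_arity gqa_equations"

lemma arr_GQA: "f \<in> arr GQA m n \<longleftrightarrow> (\<exists>t. typed gqa_arity t m n \<and> f = gqa_class t)"
  by (simp add: GQA_def arr_presented_prop)

text \<open>Composing arrows whose types do not match through discards and zeros makes composition
  total and unconditionally associative, so that the laws of props become equations whose only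
  side conditions are equalities between natural numbers.\<close>

primrec discard_diagram :: "nat \<Rightarrow> gqa_gen diagram" where
  "discard_diagram 0 = Idn 0"
| "discard_diagram (Suc n) = g_discard \<parallel> discard_diagram n"

primrec zero_diagram :: "nat \<Rightarrow> gqa_gen diagram" where
  "zero_diagram 0 = Idn 0"
| "zero_diagram (Suc n) = g_zero \<parallel> zero_diagram n"

definition pad :: "nat \<Rightarrow> nat \<Rightarrow> gqa_gen diagram set" where
  "pad m n = (if m = n then ide GQA n else gqa_class (discard_diagram m \<parallel> zero_diagram n))"

lemma pad_arr: "pad m n \<in> arr GQA m n"
proof -
  have "typed gqa_arity (discard_diagram k) k 0" for k
  proof (induction k)
    case (Suc k)
    then show ?case using typed.intros(5)[OF typed.intros(3)[of gqa_arity Discard 1 0]] by fastforce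
  qed (auto intro: typed.intros)
  moreover have "typed gqa_arity (zero_diagram k) 0 k" for k
  proof (induction k)
    case (Suc k)
    then show ?case using typed.intros(5)[OF typed.intros(3)[of gqa_arity Zero 0 1]] by fastforce
  qed (auto intro: typed.intros)
  ultimately have "typed gqa_arity (discard_diagram m \<parallel> zero_diagram n) m n"
    using typed.intros(5) by fastforce
  then show ?thesis by (auto simp: pad_def arr_GQA GQA.ide_arr[unfolded arr_GQA])
qed

text \<open>Storing the types with the class turns source and target into functions, and every
  element of the type is a morphism, so laws carry no membership premises.\<close>

typedef arrow = "{(m, n, f). f \<in> arr GQA m n}"
  using GQA.ide_arr by auto

definition src :: "arrow \<Rightarrow> nat" where "src x = fst (Rep_arrow x)"
definition tgt :: "arrow \<Rightarrow> nat" where "tgt x = fst (snd (Rep_arrow x))"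
definition arr_class :: "arrow \<Rightarrow> gqa_gen diagram set" where "arr_class x = snd (snd (Rep_arrow x))"
definition mk :: "nat \<Rightarrow> nat \<Rightarrow> gqa_gen diagram set \<Rightarrow> arrow" where "mk m n f = Abs_arrow (m, n, f)"

lemma arr_class_arr: "arr_class x \<in> arr GQA (src x) (tgt x)"
  using Rep_arrow[of x] by (auto simp: src_def tgt_def arr_class_def split: prod.splits)

lemma mk_simps:
  assumes "f \<in> arr GQA m n"
  shows "src (mk m n f) = m" "tgt (mk m n f) = n" "arr_class (mk m n f) = f"
  using assms by (simp_all add: src_def tgt_def arr_class_def mk_def Abs_arrow_inverse)

lemma arr_class_inject: "arr_class x = arr_class y \<longleftrightarrow> x = y"
proof
  assume "arr_class x = arr_class y"
  moreover have "src x = src y" "tgt x = tgt y"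
    using GQA.hom_disjoint arr_class_arr calculation by metis+
  ultimately show "x = y"
    by (simp add: src_def tgt_def arr_class_def prod_eq_iff flip: Rep_arrow_inject)
qed simp

definition arr_seq :: "arrow \<Rightarrow> arrow \<Rightarrow> arrow" (infixl \<open>\<rhd>\<close> 60) where
  "x \<rhd> y = mk (src x) (tgt y) (arr_class x \<Zcomp>\<^bsub>GQA\<^esub> pad (tgt x) (src y) \<Zcomp>\<^bsub>GQA\<^esub> arr_class y)"

definition arr_par :: "arrow \<Rightarrow> arrow \<Rightarrow> arrow" (infixl \<open>\<boxtimes>\<close> 65) where
  "x \<boxtimes> y = mk (src x + src y) (tgt x + tgt y) (arr_class x \<boxplus>\<^bsub>GQA\<^esub> arr_class y)"

definition idn :: "nat \<Rightarrow> arrow" where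
  "idn n = mk n n (ide GQA n)"

definition swap :: "nat \<Rightarrow> nat \<Rightarrow> arrow" where
  "swap m n = mk (m + n) (n + m) (swp GQA m n)"

definition gen :: "gqa_gen \<Rightarrow> arrow" where
  "gen g = mk (fst (gqa_arity g)) (snd (gqa_arity g)) (gqa_class (Gen g))"

lemma arr_seq_arr: "arr_class x \<Zcomp>\<^bsub>GQA\<^esub> pad (tgt x) (src y) \<Zcomp>\<^bsub>GQA\<^esub> arr_class y \<in> arr GQA (src x) (tgt y)"
  by (intro GQA.seq_arr[OF GQA.seq_arr[OF arr_class_arr pad_arr]] arr_class_arr)

lemma gen_arr: "gqa_class (Gen g) \<in> arr GQA (fst (gqa_arity g)) (snd (gqa_arity g))"
proof -
  have "typed gqa_arity (Gen g) (fst (gqa_arity g)) (snd (gqa_arity g))"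
    by (rule typed.intros) simp
  then show ?thesis unfolding arr_GQA by blast
qed

lemma arrow_simps [simp]:
  "src (x \<rhd> y) = src x" "tgt (x \<rhd> y) = tgt y" "src (x \<boxtimes> y) = src x + src y"
  "tgt (x \<boxtimes> y) = tgt x + tgt y" "src (idn n) = n" "tgt (idn n) = n"
  "src (swap m n) = m + n" "tgt (swap m n) = n + m"
  "src (gen g) = fst (gqa_arity g)" "tgt (gen g) = snd (gqa_arity g)"
  by (simp_all add: arr_seq_def arr_par_def idn_def swap_def gen_def mk_simps[OF arr_seq_arr]
      mk_simps[OF GQA.tens_arr[OF arr_class_arr arr_class_arr]] mk_simps[OF GQA.ide_arr]
      mk_simps[OF GQA.swp_arr] mk_simps[OF gen_arr])

lemma arr_class_seq_pad: "arr_class (x \<rhd> y) = arr_class x \<Zcomp>\<^bsub>GQA\<^esub> pad (tgt x) (src y) \<Zcomp>\<^bsub>GQA\<^esub> arr_class y"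
  by (simp add: arr_seq_def mk_simps[OF arr_seq_arr])

lemma arr_class_seq: "tgt x = src y \<Longrightarrow> arr_class (x \<rhd> y) = arr_class x \<Zcomp>\<^bsub>GQA\<^esub> arr_class y"
  using GQA.seq_ide[OF arr_class_arr[of x]] by (simp add: arr_class_seq_pad pad_def)

lemma arr_class_par: "arr_class (x \<boxtimes> y) = arr_class x \<boxplus>\<^bsub>GQA\<^esub> arr_class y"
  by (simp add: arr_par_def mk_simps[OF GQA.tens_arr[OF arr_class_arr arr_class_arr]])

lemma arr_class_idn: "arr_class (idn n) = ide GQA n"
  by (simp add: idn_def mk_simps[OF GQA.ide_arr])

lemma arr_class_swap: "arr_class (swap m n) = swp GQA m n"
  by (simp add: swap_def mk_simps[OF GQA.swp_arr])

lemma arr_class_gen: "arr_class (gen g) = gqa_class (Gen g)"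
  by (simp add: gen_def mk_simps[OF gen_arr])

text \<open>A padding depends only on the target before it and the source after it, so both
  bracketings expand to the same chain of five composable morphisms.\<close>

lemma arr_seq_assoc: "x \<rhd> y \<rhd> z = x \<rhd> (y \<rhd> z)"
proof -
  let ?p = "pad (tgt x) (src y)" and ?q = "pad (tgt y) (src z)"
  have xp: "arr_class x \<Zcomp>\<^bsub>GQA\<^esub> ?p \<in> arr GQA (src x) (src y)"
    and yq: "arr_class y \<Zcomp>\<^bsub>GQA\<^esub> ?q \<in> arr GQA (src y) (src z)"
    by (intro GQA.seq_arr[OF arr_class_arr pad_arr])+
  have "arr_class (x \<rhd> y \<rhd> z) = arr_class x \<Zcomp>\<^bsub>GQA\<^esub> ?p \<Zcomp>\<^bsub>GQA\<^esub> arr_class y \<Zcomp>\<^bsub>GQA\<^esub> ?q \<Zcomp>\<^bsub>GQA\<^esub> arr_class z"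
    by (simp add: arr_class_seq_pad)
  also have "\<dots> = arr_class x \<Zcomp>\<^bsub>GQA\<^esub> ?p \<Zcomp>\<^bsub>GQA\<^esub> (arr_class y \<Zcomp>\<^bsub>GQA\<^esub> ?q \<Zcomp>\<^bsub>GQA\<^esub> arr_class z)"
    by (simp only: GQA.seq_assoc[OF xp arr_class_arr pad_arr] GQA.seq_assoc[OF xp yq arr_class_arr])
  finally show ?thesis by (simp add: arr_class_seq_pad flip: arr_class_inject)
qed

lemma arr_par_assoc: "x \<boxtimes> y \<boxtimes> z = x \<boxtimes> (y \<boxtimes> z)"
  using GQA.tens_assoc[OF arr_class_arr arr_class_arr arr_class_arr] by (simp add: arr_class_par flip: arr_class_inject)

lemma arr_par_seq:
  "\<lbrakk>tgt x = src y; tgt x' = src y'\<rbrakk> \<Longrightarrow> (x \<boxtimes> x') \<rhd> (y \<boxtimes> y') = (x \<rhd> y) \<boxtimes> (x' \<rhd> y')"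
  using GQA.interchange[OF arr_class_arr[of x] _ arr_class_arr[of x'], of "arr_class y" _ "arr_class y'"]
    arr_class_arr[of y] arr_class_arr[of y']
  by (simp add: arr_class_par arr_class_seq flip: arr_class_inject)

lemma swap_swap: "swap m n \<rhd> swap n m = idn (m + n)"
  by (simp add: arr_class_seq arr_class_swap arr_class_idn GQA.swp_swp flip: arr_class_inject)

lemma swap_add_right: "swap m (n + p) = (swap m n \<boxtimes> idn p) \<rhd> (idn n \<boxtimes> swap m p)"
  using GQA.swp_hexagon by (simp add: arr_class_seq arr_class_swap arr_class_idn arr_class_par flip: arr_class_inject)

lemma idn_seq: "src x = n \<Longrightarrow> idn n \<rhd> x = x"
  using GQA.ide_seq[OF arr_class_arr[of x]] by (simp add: arr_class_seq arr_class_idn flip: arr_class_inject)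

lemma seq_idn: "tgt x = n \<Longrightarrow> x \<rhd> idn n = x"
  using GQA.seq_ide[OF arr_class_arr[of x]] by (simp add: arr_class_seq arr_class_idn flip: arr_class_inject)

lemma idn_par_idn: "idn m \<boxtimes> idn n = idn (m + n)"
  by (simp add: arr_class_par arr_class_idn GQA.ide_tens_ide flip: arr_class_inject)

text \<open>The hexagon of a prop splits the second argument of a swap. Its mirror image follows by
  inverting: the candidate composed with \<open>swap p (m + n)\<close> is an identity.\<close>

lemma swap_add_left: "swap (m + n) p = (idn m \<boxtimes> swap n p) \<rhd> (swap m p \<boxtimes> idn n)"
proof -
  let ?f = "(idn m \<boxtimes> swap n p) \<rhd> (swap m p \<boxtimes> idn n)"
  have "?f \<rhd> swap p (m + n) = (idn m \<boxtimes> swap n p) \<rhd> ((swap m p \<boxtimes> idn n) \<rhd> (swap p m \<boxtimes> idn n) \<rhd> (idn m \<boxtimes> swap p n))"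
    by (simp add: swap_add_right arr_seq_assoc)
  also have "(swap m p \<boxtimes> idn n) \<rhd> (swap p m \<boxtimes> idn n) = idn (m + p + n)"
    by (simp add: arr_par_seq swap_swap idn_seq idn_par_idn)
  also have "(idn m \<boxtimes> swap n p) \<rhd> (idn (m + p + n) \<rhd> (idn m \<boxtimes> swap p n)) = idn (m + (n + p))"
    by (simp add: arr_par_seq swap_swap idn_seq idn_par_idn)
  finally have "?f \<rhd> (swap p (m + n) \<rhd> swap (m + n) p) = idn (m + (n + p)) \<rhd> swap (m + n) p"
    by (simp flip: arr_seq_assoc)
  then show ?thesis
    by (simp add: swap_swap seq_idn idn_seq add.assoc)
qed

section \<open>Diagrams as arrows\<close>

primrec arrow_of :: "gqa_gen diagram \<Rightarrow> arrow" where
  "arrow_of (Idn n) = idn n"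
| "arrow_of (Swap m n) = swap m n"
| "arrow_of (Gen g) = gen g"
| "arrow_of (t ;; u) = arrow_of t \<rhd> arrow_of u"
| "arrow_of (t \<parallel> u) = arrow_of t \<boxtimes> arrow_of u"

lemma arrow_of_typed:
  "typed gqa_arity t m n \<Longrightarrow>
    src (arrow_of t) = m \<and> tgt (arrow_of t) = n \<and> arr_class (arrow_of t) = gqa_class t"
proof (induction rule: typed.induct)
  case (4 t m n u p)
  then show ?case
    by (simp add: arr_class_seq) (simp add: GQA_def seq_diagram_class)
next
  case (5 t m n u m' n')
  then show ?case
    by (simp add: arr_class_par) (simp add: GQA_def tens_diagram_class)
qed (auto simp: arr_class_idn arr_class_swap arr_class_gen GQA_def ide_presented_prop swp_presented_prop)

lemma arrow_of_surj:
  obtains t where "typed gqa_arity t (src x) (tgt x)" "x = arrow_of t"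
  using arr_class_arr[of x] arrow_of_typed unfolding arr_GQA by (metis arr_class_inject)

text \<open>Type inference as a function, so that the types of concrete diagrams such as the two
  sides of an axiom are found by simplification.\<close>

primrec well_typed :: "('g \<Rightarrow> nat \<times> nat) \<Rightarrow> 'g diagram \<Rightarrow> (nat \<times> nat) option" where
  "well_typed ar (Idn n) = Some (n, n)"
| "well_typed ar (Swap m n) = Some (m + n, n + m)"
| "well_typed ar (Gen g) = Some (ar g)"
| "well_typed ar (t ;; u) = (case (well_typed ar t, well_typed ar u) of
    (Some (m, n), Some (n', p)) \<Rightarrow> if n = n' then Some (m, p) else None | _ \<Rightarrow> None)"
| "well_typed ar (t \<parallel> u) = (case (well_typed ar t, well_typed ar u) of
    (Some (m, n), Some (m', n')) \<Rightarrow> Some (m + m', n + n') | _ \<Rightarrow> None)"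

lemma well_typed_typed: "well_typed ar t = Some (m, n) \<Longrightarrow> typed ar t m n"
  by (induction t arbitrary: m n)
    (auto intro: typed.intros split: option.splits prod.splits if_splits)

lemma gqa_equations_arrow_of:
  assumes "(t, u) \<in> gqa_equations"
  shows "arrow_of t = arrow_of u"
proof -
  have "well_typed gqa_arity t \<noteq> None \<and> well_typed gqa_arity t = well_typed gqa_arity u"
    using assms by cases (simp_all add: rotation_def)
  then obtain m n where "typed gqa_arity t m n" "typed gqa_arity u m n"
    using well_typed_typed by (metis not_None_eq surj_pair)
  then show ?thesis
    using diagram_class_eqI[OF diagram_eq.equation[OF assms]] arrow_of_typed by (metis arr_class_inject)
qed

text \<open>The order of the axioms is kept: 1 to 3 are the comonoid laws, 4 to 6 the monoid laws,
  19 is \<open>one_copy\<close> and 22 is \<open>nu_rotation\<close>.\<close>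

lemmas gqa_axioms = gqa_equations.intros[THEN gqa_equations_arrow_of, simplified]

global_interpretation copying: comonoid_prop src tgt arr_seq arr_par idn swap "gen Copy" "gen Discard"
  defines copies = copying.copies and discards = copying.discards and prj = copying.proj
    and tuple = copying.tuple and copy_natural = copying.natural
proof
  show "idn 0 \<boxtimes> x = x" "x \<boxtimes> idn 0 = x" for x
    using GQA.ide_tens[OF arr_class_arr] GQA.tens_ide[OF arr_class_arr] by (simp_all add: arr_class_par arr_class_idn flip: arr_class_inject)
  show "(x \<boxtimes> y) \<rhd> swap n n' = swap m m' \<rhd> (y \<boxtimes> x)"
    if "tgt x = n" "tgt y = n'" "src x = m" "src y = m'" for x y m m' n n'
    using GQA.swp_natural[OF arr_class_arr[of x] arr_class_arr[of y]] that
    by (simp add: arr_class_seq arr_class_par arr_class_swap flip: arr_class_inject)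
  show "swap m (n + p) = (swap m n \<boxtimes> idn p) \<rhd> (idn n \<boxtimes> swap m p)" for m n p
    by (rule swap_add_right)
  show "swap (m + n) p = (idn m \<boxtimes> swap n p) \<rhd> (swap m p \<boxtimes> idn n)" for m n p
    by (rule swap_add_left)
qed (simp_all add: arr_seq_assoc arr_par_assoc arr_par_seq idn_seq seq_idn idn_par_idn swap_swap gqa_axioms(1-3))

text \<open>Addition and zero form a comonoid in the opposite prop.\<close>

global_interpretation adding: comonoid_prop tgt src "\<lambda>x y. y \<rhd> x" arr_par idn "\<lambda>m n. swap n m" "gen Add" "gen Zero"
  defines adds = adding.copies and zeros = adding.discards and inc = adding.proj
    and cotuple = adding.tuple and add_natural = adding.natural
proof
  show "swap n' n \<rhd> (x \<boxtimes> y) = (y \<boxtimes> x) \<rhd> swap m' m"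
    if "src x = n" "src y = n'" "tgt x = m" "tgt y = m'" for x y m m' n n'
    using copying.swap_natural that by metis
  show "swap (n + p) m = (idn n \<boxtimes> swap p m) \<rhd> (swap n m \<boxtimes> idn p)" for m n p
    by (rule swap_add_left)
  show "swap p (m + n) = (swap p m \<boxtimes> idn n) \<rhd> (idn m \<boxtimes> swap p n)" for m n p
    by (rule swap_add_right)
  show "x \<rhd> (y \<rhd> z) = x \<rhd> y \<rhd> z" for x y z
    by (rule arr_seq_assoc[symmetric])
qed (simp_all add: arr_par_assoc arr_par_seq gqa_axioms(4-6) add.commute)

section \<open>Linear arrows\<close>

definition gauss_of :: "arrow \<Rightarrow> gaussian" where
  "gauss_of x = interpretation_map (arr_class x)"

interpretation interp: prop_morphism GQA Gauss interpretation_map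
  by (rule interpretation_map_morphism)

lemma gauss_of_arr: "gauss_of x \<in> arr Gauss (src x) (tgt x)"
  unfolding gauss_of_def by (rule interp.map_arr[OF arr_class_arr])

lemma gauss_of_simps:
  "gauss_of (idn n) = ide Gauss n" "gauss_of (swap m n) = swp Gauss m n"
  "gauss_of (gen g) = gauss_gen g"
  "tgt x = src y \<Longrightarrow> gauss_of (x \<rhd> y) = gauss_of x \<Zcomp>\<^bsub>Gauss\<^esub> gauss_of y"
  "gauss_of (x \<boxtimes> y) = gauss_of x \<boxplus>\<^bsub>Gauss\<^esub> gauss_of y"
proof -
  show "gauss_of (gen g) = gauss_gen g"
  proof -
    have "typed gqa_arity (Gen g) (fst (gqa_arity g)) (snd (gqa_arity g))"
      by (rule typed.intros) simp
    then show ?thesis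
      using interpretation_map_diagram_class by (simp add: gauss_of_def arr_class_gen)
  qed
  show "gauss_of (x \<rhd> y) = gauss_of x \<Zcomp>\<^bsub>Gauss\<^esub> gauss_of y" if "tgt x = src y"
    using interp.map_seq[OF arr_class_arr[of x], of "arr_class y"] arr_class_arr[of y] that
    by (simp add: gauss_of_def arr_class_seq)
  show "gauss_of (x \<boxtimes> y) = gauss_of x \<boxplus>\<^bsub>Gauss\<^esub> gauss_of y"
    using interp.map_tens[OF arr_class_arr[of x] arr_class_arr[of y]]
    by (simp add: gauss_of_def arr_class_par)
qed (simp_all add: gauss_of_def arr_class_idn arr_class_swap interp.map_ide interp.map_swp)

definition mat_of :: "arrow \<Rightarrow> real mat" where
  "mat_of x = fst (gauss_of x)"

lemma mat_of_carrier [simp]: "mat_of x \<in> carrier_mat (tgt x) (src x)"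
  using gauss_of_arr[of x] by (cases "gauss_of x") (simp add: arr_Gauss mat_of_def)

lemma mat_of_dims [simp]: "dim_row (mat_of x) = tgt x" "dim_col (mat_of x) = src x"
  using carrier_matD[OF mat_of_carrier[of x]] by auto

lemma mat_of_simps:
  "mat_of (idn n) = 1\<^sub>m n" "mat_of (swap m n) = swap_mat m n"
  "tgt x = src y \<Longrightarrow> mat_of (x \<rhd> y) = mat_of y * mat_of x"
  "mat_of (x \<boxtimes> y) = direct_sum (mat_of x) (mat_of y)"
  by (cases "gauss_of x"; cases "gauss_of y";
    simp add: mat_of_def gauss_of_simps ide_Gauss swp_Gauss seq_Gauss tens_Gauss)+

inductive is_linear :: "arrow \<Rightarrow> bool" where
  linear_idn: "is_linear (idn n)"
| linear_swap: "is_linear (swap m n)"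
| linear_gen: "\<lbrakk>g \<noteq> One; g \<noteq> Nu\<rbrakk> \<Longrightarrow> is_linear (gen g)"
| linear_seq: "\<lbrakk>is_linear x; is_linear y; tgt x = src y\<rbrakk> \<Longrightarrow> is_linear (x \<rhd> y)"
| linear_par: "\<lbrakk>is_linear x; is_linear y\<rbrakk> \<Longrightarrow> is_linear (x \<boxtimes> y)"

text \<open>\<open>Copy\<close> and \<open>Discard\<close> respect copying by the comonoid laws,
  \<open>Add\<close> and \<open>Zero\<close> respect addition dually; the other cases are axioms of
  bimonoids and scalars. \<open>One\<close> is excluded since it does not preserve zero,
  \<open>Nu\<close> since it is not copied.\<close>

lemma linear_natural: "is_linear x \<Longrightarrow> copy_natural x \<and> add_natural x"
proof (induction rule: is_linear.induct)
  case (linear_gen g)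
  show ?case
  proof (cases g)
    case Copy
    then show ?thesis
      by (auto simp: copying.natural_copy adding.natural_def numeral_2_eq_2 gqa_axioms arr_seq_assoc)
  next
    case Discard
    then show ?thesis
      by (auto simp: copying.natural_discard adding.natural_def gqa_axioms)
  next
    case Add
    then show ?thesis
      by (auto simp: adding.natural_copy copying.natural_def numeral_2_eq_2 gqa_axioms arr_seq_assoc)
  next
    case Zero
    then show ?thesis
      by (auto simp: adding.natural_discard copying.natural_def gqa_axioms)
  next
    case (Scale k)
    then show ?thesis
      by (auto simp: copying.natural_def adding.natural_def gqa_axioms)
  qed (use linear_gen in auto)
qed (auto intro: copying.natural_id adding.natural_id copying.natural_swap adding.natural_swap
    copying.natural_sq adding.natural_sq copying.natural_ts adding.natural_ts)

lemma linear_copies: "is_linear (copies n)" "is_linear (discards n)"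
  by (induction n) (auto intro!: is_linear.intros)

lemma linear_adds: "is_linear (adds n)" "is_linear (zeros n)"
  by (induction n) (auto intro!: is_linear.intros simp: numeral_2_eq_2)

lemma linear_prj: "is_linear (prj n i)" "is_linear (inc n i)"
  unfolding copying.proj_def adding.proj_def by (auto intro!: is_linear.intros linear_copies linear_adds)

lemma linear_tuple:
  "(\<And>i. i < n \<Longrightarrow> is_linear (F i) \<and> src (F i) = m \<and> tgt (F i) = 1) \<Longrightarrow> is_linear (tuple m n F)"
  by (induction n arbitrary: F) (auto intro!: is_linear.intros linear_copies)

lemma linear_cotuple:
  "(\<And>i. i < n \<Longrightarrow> is_linear (F i) \<and> tgt (F i) = m \<and> src (F i) = 1) \<Longrightarrow> is_linear (cotuple m n F)"
  by (induction n arbitrary: F) (auto intro!: is_linear.intros linear_adds)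

text \<open>A column vector: one input wire is copied \<open>n\<close> times and the copies are
  scaled. Dually, \<open>cofan\<close> is a row vector.\<close>

definition fan :: "nat \<Rightarrow> (nat \<Rightarrow> real) \<Rightarrow> arrow" where
  "fan n a = tuple 1 n (\<lambda>i. gen (Scale (a i)))"

definition cofan :: "nat \<Rightarrow> (nat \<Rightarrow> real) \<Rightarrow> arrow" where
  "cofan n a = cotuple 1 n (\<lambda>i. gen (Scale (a i)))"

lemma linear_fan: "is_linear (fan n a)" "is_linear (cofan n a)"
  unfolding fan_def cofan_def by (auto intro!: linear_tuple linear_cotuple linear_gen)

lemma fan_dims [simp]: "src (fan n a) = Suc 0" "tgt (fan n a) = n" "src (cofan n a) = n" "tgt (cofan n a) = Suc 0"
  by (simp_all add: fan_def cofan_def)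

lemma fan_prj: "i < n \<Longrightarrow> fan n a \<rhd> prj n i = gen (Scale (a i))"
  unfolding fan_def using linear_natural[OF linear_gen[of "Scale _"]]
  by (subst copying.tuple_proj) auto

lemma inc_cofan: "i < n \<Longrightarrow> inc n i \<rhd> cofan n a = gen (Scale (a i))"
  unfolding cofan_def using linear_natural[OF linear_gen[of "Scale _"]]
  by (subst adding.tuple_proj) auto

text \<open>Row times column is the scalar product, since copying, scaling by \<open>k\<close> and
  \<open>l\<close> and adding is scaling by \<open>k + l\<close>. Matrix multiplication enters the
  syntax here.\<close>

lemma fan_cofan: "fan n a \<rhd> cofan n b = gen (Scale (\<Sum>i<n. a i * b i))"
proof (induction n arbitrary: a b)
  case 0
  then show ?case by (simp add: fan_def cofan_def gqa_axioms)
next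
  case (Suc n)
  have "fan (Suc n) a = gen Copy \<rhd> (gen (Scale (a 0)) \<boxtimes> fan n (\<lambda>i. a (Suc i)))"
    and "cofan (Suc n) b = (gen (Scale (b 0)) \<boxtimes> cofan n (\<lambda>i. b (Suc i))) \<rhd> gen Add"
    by (simp_all add: fan_def cofan_def)
  then have "fan (Suc n) a \<rhd> cofan (Suc n) b = gen Copy \<rhd> (((gen (Scale (a 0)) \<boxtimes> fan n (\<lambda>i. a (Suc i)))
      \<rhd> (gen (Scale (b 0)) \<boxtimes> cofan n (\<lambda>i. b (Suc i)))) \<rhd> gen Add)"
    by (simp add: arr_seq_assoc)
  then show ?case
    by (simp add: arr_par_seq Suc gqa_axioms sum.lessThan_Suc_shift del: sum.lessThan_Suc flip: arr_seq_assoc)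
qed

lemma eq_fanI:
  "\<lbrakk>is_linear x; src x = 1; tgt x = n; \<And>j. j < n \<Longrightarrow> x \<rhd> prj n j = gen (Scale (a j))\<rbrakk> \<Longrightarrow> x = fan n a"
  by (rule copying.natural_eqI[of _ _ n]) (auto simp: linear_natural linear_fan fan_prj)

lemma eq_cofanI:
  "\<lbrakk>is_linear x; tgt x = 1; src x = n; \<And>j. j < n \<Longrightarrow> inc n j \<rhd> x = gen (Scale (a j))\<rbrakk> \<Longrightarrow> x = cofan n a"
  by (rule adding.natural_eqI[of _ _ n]) (auto simp: linear_natural linear_fan inc_cofan)

text \<open>These are the entries of a direct sum that link different blocks.\<close>

lemma discard_par_zero: "gen Discard \<boxtimes> gen Zero = gen (Scale 0)" "gen Zero \<boxtimes> gen Discard = gen (Scale 0)"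
  using copying.slide(1)[of "gen Discard" 0 "gen Zero" 0] copying.slide(2)[of "gen Discard" 1 "gen Zero" 1]
    copying.slide(2)[of "gen Zero" 0 "gen Discard" 0] by (simp_all add: gqa_axioms)

lemma linear_discards: "\<lbrakk>is_linear x; tgt x = n\<rbrakk> \<Longrightarrow> x \<rhd> discards n = discards (src x)"
  using linear_natural copying.natural_discards by blast

lemma zeros_linear: "\<lbrakk>is_linear x; src x = n\<rbrakk> \<Longrightarrow> zeros n \<rhd> x = zeros (tgt x)"
  using linear_natural adding.natural_discards by blast

lemma linear_entry:
  assumes "is_linear x" "i < src x" "j < tgt x"
  shows "inc (src x) i \<rhd> x \<rhd> prj (tgt x) j = gen (Scale (mat_of x $$ (j, i)))"
proof -
  \<comment> \<open>Proved outside the induction, since identities also use it. In a diagonal block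
    the other factor reduces to \<open>idn 0\<close>. Off the diagonal, the factor receiving the
    wire is discarded and the other one emits zero.\<close>
  have par: "inc (src x + src y) i \<rhd> (x \<boxtimes> y) \<rhd> prj (tgt x + tgt y) j = gen (Scale (mat_of (x \<boxtimes> y) $$ (j, i)))"
    if lin: "is_linear x" "is_linear y"
    and x: "\<And>i j. \<lbrakk>i < src x; j < tgt x\<rbrakk> \<Longrightarrow> inc (src x) i \<rhd> x \<rhd> prj (tgt x) j = gen (Scale (mat_of x $$ (j, i)))"
    and y: "\<And>i j. \<lbrakk>i < src y; j < tgt y\<rbrakk> \<Longrightarrow> inc (src y) i \<rhd> y \<rhd> prj (tgt y) j = gen (Scale (mat_of y $$ (j, i)))"
    and ij: "i < src x + src y" "j < tgt x + tgt y" for x y i j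
  proof -
    have zd: "zeros (src z) \<rhd> z \<rhd> discards (tgt z) = idn 0" if "is_linear z" for z
      using that zeros_linear[OF that] linear_discards[OF linear_adds(2)[of "tgt z"]] by simp
    have id: "inc (src z) i \<rhd> z \<rhd> discards (tgt z) = gen Discard" if "is_linear z" "i < src z" for z i
      using that linear_discards[of z "tgt z"] linear_discards[OF linear_prj(2)[of "src z" i]]
      by (simp add: arr_seq_assoc)
    have zp: "zeros (src z) \<rhd> z \<rhd> prj (tgt z) j = gen Zero" if "is_linear z" "j < tgt z" for z j
      using that zeros_linear[of z "src z"] zeros_linear[OF linear_prj(1)[of "tgt z" j]]
      by simp
    have i: "(\<exists>k. k < src x \<and> i = k) \<or> (\<exists>k. k < src y \<and> i = src x + k)"
      using ij by (metis add_less_cancel_left le_iff_add not_le)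
    have j: "(\<exists>k. k < tgt x \<and> j = k) \<or> (\<exists>k. k < tgt y \<and> j = tgt x + k)"
      using ij by (metis add_less_cancel_left le_iff_add not_le)
    show ?thesis
      using i j lin
      by (elim disjE exE conjE)
        (simp_all add: copying.proj_add adding.proj_add arr_par_seq x y zd id zp mat_of_simps
          index_direct_sum discard_par_zero copying.id_ts copying.ts_id)
  qed
  \<comment> \<open>An identity is split into one wire beside the others, which makes it a parallel
    product.\<close>
  have idn: "inc n i \<rhd> idn n \<rhd> prj n j = gen (Scale (mat_of (idn n) $$ (j, i)))"
    if "i < n" "j < n" for n i j
    using that
  proof (induction n arbitrary: i j)
    case (Suc n)
    have 1: "inc (Suc 0) 0 \<rhd> idn (Suc 0) \<rhd> prj (Suc 0) 0 = gen (Scale (mat_of (idn (Suc 0)) $$ (0, 0)))"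
      by (simp add: copying.proj_def adding.proj_def gqa_axioms mat_of_simps)
    show ?case
      using par[OF linear_idn linear_idn, of "Suc 0" n i j] 1 Suc by simp
  qed simp
  show ?thesis using assms
  proof (induction arbitrary: i j rule: is_linear.induct)
    case (linear_idn n)
    then show ?case using idn by simp
  next
    case (linear_par x y)
    then show ?case using par by simp
  next
    case (linear_seq x y)
    let ?n = "tgt x"
    \<comment> \<open>By the induction hypotheses, column \<open>i\<close> of \<open>x\<close> is a
      fan and row \<open>j\<close> of \<open>y\<close> a cofan; they meet at the middle object in an
      entry of the matrix product.\<close>
    have "inc (src x) i \<rhd> x = fan ?n (\<lambda>k. mat_of x $$ (k, i))"
      using linear_seq by (intro eq_fanI) (auto intro: is_linear.linear_seq linear_prj)
    moreover have "y \<rhd> prj (tgt y) j = cofan ?n (\<lambda>k. mat_of y $$ (j, k))"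
      using linear_seq by (intro eq_cofanI) (auto intro: is_linear.linear_seq linear_prj simp flip: arr_seq_assoc)
    ultimately have "inc (src x) i \<rhd> x \<rhd> (y \<rhd> prj (tgt y) j)
        = gen (Scale (\<Sum>k<?n. mat_of x $$ (k, i) * mat_of y $$ (j, k)))"
      by (simp add: fan_cofan)
    then show ?case
      using linear_seq by (simp add: mat_of_simps index_mult_mat_sum arr_seq_assoc mult.commute
        del: index_mult_mat(1))
  next
    case (linear_swap m n)
    \<comment> \<open>Including a wire and then swapping is the inclusion of the permuted wire,
      which reduces the entry to one of an identity matrix.\<close>
    have swap: "inc (m + n) i \<rhd> swap m n = inc (n + m) (if i < m then n + i else i - m)"
    proof (cases "i < m")
      case True
      then show ?thesis
        using copying.swap_natural[of "inc m i" m "zeros n" n 1 0] by (simp add: adding.proj_add)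
    next
      case False
      then obtain k where k: "i = m + k" "k < n"
        using linear_swap by simp (metis add_less_cancel_left le_iff_add not_le)
      then show ?thesis
        using copying.swap_natural[of "zeros m" m "inc n k" n 0 1] by (simp add: adding.proj_add)
    qed
    then show ?case
      using linear_swap idn[of "if i < m then n + i else i - m" "n + m" j]
      by (auto simp: mat_of_simps swap_mat_def copying.sq_id split: if_splits)
  next
    case (linear_gen g)
    have p: "prj (Suc 0) 0 = idn (Suc 0)" "inc (Suc 0) 0 = idn (Suc 0)"
      "prj (Suc (Suc 0)) 0 = idn (Suc 0) \<boxtimes> gen Discard" "prj (Suc (Suc 0)) (Suc 0) = gen Discard \<boxtimes> idn (Suc 0)"
      "inc (Suc (Suc 0)) 0 = idn (Suc 0) \<boxtimes> gen Zero" "inc (Suc (Suc 0)) (Suc 0) = gen Zero \<boxtimes> idn (Suc 0)"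
      by (simp_all add: copying.proj_def adding.proj_def)
    show ?case
    proof (cases g)
      case Copy
      then show ?thesis using linear_gen
        by (auto simp: numeral_2_eq_2 less_Suc_eq p mat_of_def gauss_of_simps affine_gaussian_def gqa_axioms
            copying.counit copying.counit')
    next
      case Add
      then show ?thesis using linear_gen
        by (auto simp: numeral_2_eq_2 less_Suc_eq p mat_of_def gauss_of_simps affine_gaussian_def gqa_axioms
            adding.counit adding.counit')
    next
      case (Scale k)
      then show ?thesis using linear_gen
        by (auto simp: p mat_of_def gauss_of_simps affine_gaussian_def)
    qed (use linear_gen in auto)
  qed
qed

lemma linear_eqI:
  assumes "is_linear x" "is_linear y" "src x = src y" "tgt x = tgt y" "mat_of x = mat_of y"
  shows "x = y"
proof (rule adding.natural_eqI[of _ _ "src x"])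
  fix i assume i: "i < src x"
  show "inc (src x) i \<rhd> x = inc (src x) i \<rhd> y"
  proof (rule copying.natural_eqI[of _ _ "tgt x"])
    show "copy_natural (inc (src x) i \<rhd> x)" "copy_natural (inc (src x) i \<rhd> y)"
      using assms i by (auto intro!: linear_natural[THEN conjunct1] linear_seq linear_prj)
    show "inc (src x) i \<rhd> x \<rhd> prj (tgt x) j = inc (src x) i \<rhd> y \<rhd> prj (tgt x) j" if "j < tgt x" for j
      using linear_entry[of x i j] linear_entry[of y i j] that i assms by simp
  qed (use assms in auto)
qed (use assms linear_natural in auto)

text \<open>Soundness separates scalars. An equation of scalar arrows derived syntactically thus
  yields an equation of matrix entries, which is how the matrices of tuples and sums are computed
  below.\<close>

lemma scale_inject: "gen (Scale k) = gen (Scale l) \<longleftrightarrow> k = l"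
proof
  assume "gen (Scale k) = gen (Scale l)"
  then have "mat_of (gen (Scale k)) $$ (0, 0) = mat_of (gen (Scale l)) $$ (0, 0)" by simp
  then show "k = l" by (simp add: mat_of_def gauss_of_simps affine_gaussian_def)
qed simp

text \<open>The arrow is assembled as the cotuple of its columns, each of which is a fan.\<close>

lemma linear_ex:
  assumes "A \<in> carrier_mat n m"
  obtains x where "is_linear x" "src x = m" "tgt x = n" "mat_of x = A"
proof
  let ?F = "\<lambda>i. fan n (\<lambda>j. A $$ (j, i))"
  let ?x = "cotuple n m ?F"
  show lin: "is_linear ?x" by (rule linear_cotuple) (auto simp: linear_fan)
  show dims: "src ?x = m" "tgt ?x = n" by simp_all
  show "mat_of ?x = A"
  proof (rule eq_matI)
    fix j i assume "j < dim_row A" "i < dim_col A"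
    then have ij: "i < m" "j < n" using assms by auto
    have "inc m i \<rhd> ?x = ?F i"
      using ij by (intro adding.tuple_proj) (auto simp: linear_fan linear_natural)
    then have "inc m i \<rhd> ?x \<rhd> prj n j = gen (Scale (A $$ (j, i)))"
      using ij by (simp add: fan_prj)
    then show "mat_of ?x $$ (j, i) = A $$ (j, i)"
      using linear_entry[OF lin, of i j] ij dims by (simp add: scale_inject)
  qed (use assms dims in auto)
qed

section \<open>Normal forms\<close>

text \<open>The outputs of \<open>x\<close> and \<open>y\<close> are added while their inputs stay
  separate. If \<open>y\<close> has source 0, this adds a state to a map.\<close>

definition join :: "arrow \<Rightarrow> arrow \<Rightarrow> arrow" (infixl \<open>\<uplus>\<close> 62) where
  "x \<uplus> y = (x \<boxtimes> y) \<rhd> adds (tgt x)"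

lemma join_dims [simp]: "src (x \<uplus> y) = src x + src y" "tgt (x \<uplus> y) = tgt x"
  by (simp_all add: join_def)

lemma linear_join: "\<lbrakk>is_linear x; is_linear y; tgt y = tgt x\<rbrakk> \<Longrightarrow> is_linear (x \<uplus> y)"
  by (auto simp: join_def intro!: is_linear.intros linear_adds)

lemma join_assoc:
  assumes "tgt y = tgt x" "tgt z = tgt x"
  shows "x \<uplus> y \<uplus> z = x \<uplus> (y \<uplus> z)"
proof -
  let ?n = "tgt x"
  have "x \<uplus> y \<uplus> z = (x \<boxtimes> y \<boxtimes> z) \<rhd> ((adds ?n \<boxtimes> idn ?n) \<rhd> adds ?n)"
    using assms by (simp add: join_def arr_par_seq seq_idn flip: arr_seq_assoc)
  also have "\<dots> = (x \<boxtimes> (y \<boxtimes> z)) \<rhd> ((idn ?n \<boxtimes> adds ?n) \<rhd> adds ?n)"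
    by (simp add: adding.copies_coassoc arr_par_assoc)
  also have "\<dots> = x \<uplus> (y \<uplus> z)"
    using assms by (simp add: join_def arr_par_seq seq_idn flip: arr_seq_assoc)
  finally show ?thesis .
qed

lemma join_zeros: "tgt x = n \<Longrightarrow> x \<uplus> zeros n = x" "tgt x = n \<Longrightarrow> zeros n \<uplus> x = x"
  using copying.slide(2)[of x "src x" "zeros n" n] copying.slide(1)[of "zeros n" n x "src x"]
    copying.slide(1)[of x n "zeros n" 0] copying.slide(2)[of "zeros n" 0 x n]
  by (simp_all add: join_def seq_idn arr_seq_assoc adding.copies_discards adding.copies_discards'
      flip: copying.slide(1)[of x n "zeros n" 0] copying.slide(2)[of "zeros n" 0 x n])

lemma join_commute:
  assumes "src x = 0" "src y = 0" "tgt y = tgt x"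
  shows "x \<uplus> y = y \<uplus> x"
proof -
  have "x \<boxtimes> y = (y \<boxtimes> x) \<rhd> swap (tgt x) (tgt x)"
    using copying.swap_natural[of y "tgt x" x "tgt x" 0 0] assms by simp
  then show ?thesis
    using assms by (simp add: join_def arr_seq_assoc adding.copies_cocomm)
qed

lemma join_linear:
  assumes "is_linear z" "tgt x = src z" "tgt y = src z"
  shows "(x \<uplus> y) \<rhd> z = (x \<rhd> z) \<uplus> (y \<rhd> z)"
proof -
  have "adds (src z) \<rhd> z = (z \<boxtimes> z) \<rhd> adds (tgt z)"
    using linear_natural[OF assms(1)] adding.natural_copies by blast
  then have "(x \<uplus> y) \<rhd> z = (x \<boxtimes> y) \<rhd> (z \<boxtimes> z) \<rhd> adds (tgt z)"
    using assms by (simp add: join_def arr_seq_assoc)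
  then show ?thesis using assms by (simp add: join_def arr_par_seq)
qed

text \<open>As \<open>y\<close> has no inputs, naturality of the swap moves it across
  \<open>x'\<close> without permuting inputs.\<close>

lemma join_par:
  assumes "tgt x = n" "tgt y = n" "tgt x' = n'" "tgt y' = n'" "src y = 0"
  shows "(x \<uplus> y) \<boxtimes> (x' \<uplus> y') = (x \<boxtimes> x') \<uplus> (y \<boxtimes> y')"
proof -
  have "(x' \<boxtimes> y) \<rhd> swap n' n = y \<boxtimes> x'"
    using copying.swap_natural[of x' n' y n "src x'" 0] assms by simp
  then have "(x \<boxtimes> (x' \<boxtimes> y) \<boxtimes> y') \<rhd> (idn n \<boxtimes> swap n' n \<boxtimes> idn n') = x \<boxtimes> (y \<boxtimes> x') \<boxtimes> y'"
    using assms by (simp add: arr_par_seq seq_idn)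
  moreover have "(x \<boxtimes> x') \<uplus> (y \<boxtimes> y')
      = (x \<boxtimes> (x' \<boxtimes> y) \<boxtimes> y') \<rhd> (idn n \<boxtimes> swap n' n \<boxtimes> idn n') \<rhd> (adds n \<boxtimes> adds n')"
    using assms by (simp add: join_def adding.copies_add arr_par_assoc arr_seq_assoc)
  ultimately show ?thesis
    using assms by (simp add: join_def arr_par_assoc[symmetric] flip: arr_par_seq)
qed

lemma seq_join: "\<lbrakk>tgt x = src y; src s = 0\<rbrakk> \<Longrightarrow> x \<rhd> (y \<uplus> s) = (x \<rhd> y) \<uplus> s"
  using arr_par_seq[of x y "idn 0" s] by (simp add: join_def idn_seq flip: arr_seq_assoc)

text \<open>Constants count as noise here: both \<open>One\<close> and \<open>Nu\<close> are pushed
  through linear maps and summed. The list-like form supports induction;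
  \<open>noise_canonical\<close> separates the two kinds later.\<close>

inductive noise :: "nat \<Rightarrow> arrow \<Rightarrow> bool" for n where
  noise_zeros: "noise n (zeros n)"
| noise_join: "\<lbrakk>noise n s; g = One \<or> g = Nu; is_linear x; src x = 1; tgt x = n\<rbrakk> \<Longrightarrow> noise n ((gen g \<rhd> x) \<uplus> s)"

lemma noise_dims: "noise n s \<Longrightarrow> src s = 0 \<and> tgt s = n"
  by (induction rule: noise.induct) auto

lemma noise_add: "\<lbrakk>noise n s; noise n t\<rbrakk> \<Longrightarrow> noise n (s \<uplus> t)"
proof (induction rule: noise.induct)
  case noise_zeros
  then show ?case using noise_dims by (simp add: join_zeros)
next
  case (noise_join s g x)
  then show ?case using noise_dims by (auto simp: join_assoc intro: noise.noise_join)
qed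

lemma noise_linear: "\<lbrakk>noise n s; is_linear z; src z = n\<rbrakk> \<Longrightarrow> noise (tgt z) (s \<rhd> z)"
proof (induction rule: noise.induct)
  case noise_zeros
  then show ?case by (simp add: zeros_linear noise.noise_zeros)
next
  case (noise_join s g x)
  then show ?case using noise_dims
    by (auto simp: join_linear arr_seq_assoc intro!: noise.noise_join linear_seq)
qed

text \<open>Filling the other block of each state with zeros turns the parallel product into a sum
  of linear images.\<close>

lemma noise_par:
  assumes "noise m s" "noise n t"
  shows "noise (m + n) (s \<boxtimes> t)"
proof -
  note d = assms[THEN noise_dims]
  have "s \<boxtimes> t = (s \<uplus> zeros m) \<boxtimes> (zeros n \<uplus> t)"
    using d by (simp add: join_zeros)
  also have "\<dots> = (s \<boxtimes> zeros n) \<uplus> (zeros m \<boxtimes> t)"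
    using d by (intro join_par) auto
  also have "\<dots> = (s \<rhd> (idn m \<boxtimes> zeros n)) \<uplus> (t \<rhd> (zeros m \<boxtimes> idn n))"
    using d copying.slide(1)[of s m "zeros n" 0] copying.slide(2)[of "zeros m" 0 t n] by simp
  also have "noise (m + n) \<dots>"
    using noise_linear[OF assms(1), of "idn m \<boxtimes> zeros n"] noise_linear[OF assms(2), of "zeros m \<boxtimes> idn n"]
    by (auto intro!: noise_add linear_par linear_idn linear_adds)
  finally show ?thesis .
qed

lemma linear_noise_decomposition:
  "\<exists>a s. is_linear a \<and> noise (tgt x) s \<and> x = a \<uplus> s"
proof -
  have lin: "\<exists>a s. is_linear a \<and> noise (tgt x) s \<and> x = a \<uplus> s" if "is_linear x" for x
    using that noise_zeros join_zeros by metis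
  have "typed gqa_arity t m n \<Longrightarrow> \<exists>a s. is_linear a \<and> noise n s \<and> arrow_of t = a \<uplus> s" for t m n
  proof (induction rule: typed.induct)
    case (1 n)
    then show ?case using lin[OF linear_idn[of n]] by simp
  next
    case (2 m n)
    then show ?case using lin[OF linear_swap[of m n]] by simp
  next
    case (3 g m n)
    show ?case
    proof (cases "g = One \<or> g = Nu")
      case True
      then have "noise (Suc 0) ((gen g \<rhd> idn (Suc 0)) \<uplus> zeros (Suc 0))"
        by (auto intro!: noise.intros linear_idn simp del: adding.discards.simps adding.discards_1)
      moreover have "(gen g \<rhd> idn (Suc 0)) \<uplus> zeros (Suc 0) = gen g"
        using True by (auto simp: seq_idn join_zeros simp del: adding.discards.simps adding.discards_1)
      \<comment> \<open>The generator has no inputs, so its linear part is the zero state.\<close>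
      moreover have "gen g = zeros (Suc 0) \<uplus> gen g" using True 
        by (auto simp: join_zeros simp del: adding.discards.simps adding.discards_1)
      moreover have "n = 1" using 3 True by auto
      ultimately show ?thesis using linear_adds(2) by (metis One_nat_def arrow_of.simps(3))
    next
      case False
      then show ?thesis using lin[OF linear_gen[of g]] 3 by simp
    qed
  next
    case (4 t m n u p)
    then obtain a s b r where *: "is_linear a" "noise n s" "arrow_of t = a \<uplus> s"
      "is_linear b" "noise p r" "arrow_of u = b \<uplus> r" by auto
    have d: "src s = 0" "tgt s = n" "src r = 0" "tgt r = p" using * noise_dims by auto
    have "tgt (a \<uplus> s) = n" "src (b \<uplus> r) = n" "tgt (b \<uplus> r) = p"
      using arrow_of_typed 4(1,2) * by metis+
    then have e: "tgt a = n" "src b = n" "tgt b = p" using d by auto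
    \<comment> \<open>This mirrors composition in \<open>Gauss\<close>: the first noise passes
      through the second linear part before the second noise is added.\<close>
    then have "(a \<uplus> s) \<rhd> (b \<uplus> r) = (a \<rhd> b) \<uplus> ((s \<rhd> b) \<uplus> r)"
      using d * by (simp add: seq_join join_linear join_assoc)
    moreover have "is_linear (a \<rhd> b)" using * e by (intro linear_seq) auto
    moreover have "noise p ((s \<rhd> b) \<uplus> r)"
      using * e noise_linear[of n s b] by (auto intro: noise_add)
    ultimately show ?case using * by (metis arrow_of.simps(4))
  next
    case (5 t m n u m' n')
    then obtain a s b r where *: "is_linear a" "noise n s" "arrow_of t = a \<uplus> s"
      "is_linear b" "noise n' r" "arrow_of u = b \<uplus> r" by auto
    have d: "src s = 0" "tgt s = n" "src r = 0" "tgt r = n'" using * noise_dims by auto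
    have "tgt (a \<uplus> s) = n" "tgt (b \<uplus> r) = n'"
      using arrow_of_typed 5(1,2) * by metis+
    then have "(a \<uplus> s) \<boxtimes> (b \<uplus> r) = (a \<boxtimes> b) \<uplus> (s \<boxtimes> r)"
      using d by (intro join_par) auto
    then show ?case using * linear_par noise_par by (metis arrow_of.simps(5))
  qed
  then show ?thesis using arrow_of_surj by metis
qed

section \<open>Arithmetic of columns\<close>

lemma fan_cong: "(\<And>i. i < n \<Longrightarrow> a i = b i) \<Longrightarrow> fan n a = fan n b"
  by (rule eq_fanI) (auto simp: linear_fan fan_prj)

lemma fan_zero: "fan n (\<lambda>_. 0) = gen Discard \<rhd> zeros n"
proof (rule eq_fanI[symmetric])
  show "is_linear (gen Discard \<rhd> zeros n)" by (auto intro!: linear_seq linear_gen linear_adds)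
  show "gen Discard \<rhd> zeros n \<rhd> prj n j = gen (Scale 0)" if "j < n" for j
    using that zeros_linear[OF linear_prj(1)[of n j]] by (simp add: arr_seq_assoc gqa_axioms)
qed simp_all

text \<open>The leading \<open>Copy\<close> makes both columns read the same input; at each output
  wire the claim is then \<open>scale_plus\<close>.\<close>

lemma fan_plus: "gen Copy \<rhd> (fan n a \<uplus> fan n b) = fan n (\<lambda>i. a i + b i)"
proof (rule eq_fanI)
  show "is_linear (gen Copy \<rhd> (fan n a \<uplus> fan n b))"
    by (auto intro!: linear_seq linear_gen linear_join linear_fan)
  show "gen Copy \<rhd> (fan n a \<uplus> fan n b) \<rhd> prj n j = gen (Scale (a j + b j))" if "j < n" for j
    using that by (simp add: arr_seq_assoc join_linear linear_prj fan_prj)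
      (simp add: join_def gqa_axioms flip: arr_seq_assoc)
qed simp_all

lemma linear_eq_fan:
  assumes "is_linear x" "src x = 1" "tgt x = n"
  shows "x = fan n (\<lambda>j. mat_of x $$ (j, 0))"
proof (rule eq_fanI)
  show "x \<rhd> prj n j = gen (Scale (mat_of x $$ (j, 0)))" if "j < n" for j
    using linear_entry[of x 0 j] that assms by (simp add: adding.proj_def idn_seq)
qed (use assms in auto)

text \<open>A linear image of independent standard normals; the list holds the columns of its
  matrix. Of each column only the entries below \<open>n\<close> matter.\<close>

primrec nus :: "nat \<Rightarrow> (nat \<Rightarrow> real) list \<Rightarrow> arrow" where
  "nus n [] = zeros n"
| "nus n (v # vs) = (gen Nu \<rhd> fan n v) \<uplus> nus n vs"

lemma nus_dims [simp]: "src (nus n vs) = 0" "tgt (nus n vs) = n"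
  by (induction vs) auto

text \<open>All constants merge into one because \<open>One\<close> can be copied. \<open>Nu\<close>
  has no such law, so its columns are only collected in a list.\<close>

lemma noise_canonical:
  "noise n s \<Longrightarrow> \<exists>b vs. s = (gen One \<rhd> fan n b) \<uplus> nus n vs"
proof (induction rule: noise.induct)
  case noise_zeros
  have "(gen One \<rhd> fan n (\<lambda>_. 0)) \<uplus> nus n [] = zeros n"
    by (simp add: fan_zero join_zeros gqa_axioms copying.id_sq flip: arr_seq_assoc)
  then show ?case by metis
next
  case (noise_join s g x)
  then obtain b vs where s: "s = (gen One \<rhd> fan n b) \<uplus> nus n vs" by blast
  obtain a where x: "x = fan n a" using noise_join linear_eq_fan by blast
  from noise_join(2) show ?case
  proof
    assume "g = One"
    have "(gen One \<rhd> fan n a) \<uplus> (gen One \<rhd> fan n b) = (gen One \<boxtimes> gen One) \<rhd> (fan n a \<uplus> fan n b)"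
      by (simp add: join_def arr_par_seq flip: arr_seq_assoc)
    \<comment> \<open>The law \<open>one_copy\<close>, read backwards, replaces two constants by one
      that is copied.\<close>
    also have "\<dots> = gen One \<rhd> fan n (\<lambda>i. a i + b i)"
      by (simp add: arr_seq_assoc fan_plus flip: gqa_axioms(19))
    finally show ?thesis
      using \<open>g = One\<close> s x by (metis join_assoc arrow_simps(2) fan_dims(2) nus_dims(2))
  next
    assume "g = Nu"
    have "(gen Nu \<rhd> fan n a) \<uplus> ((gen One \<rhd> fan n b) \<uplus> nus n vs)
        = (gen One \<rhd> fan n b) \<uplus> nus n (a # vs)"
      using join_commute[of "gen Nu \<rhd> fan n a" "gen One \<rhd> fan n b"] by (simp flip: join_assoc)
    then show ?thesis using \<open>g = Nu\<close> s x by metis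
  qed
qed

section \<open>Rotations and Gram matrices\<close>

lemma linear_gauss_of: "is_linear x \<Longrightarrow> gauss_of x = affine_gaussian (mat_of x) (0\<^sub>v (tgt x))"
proof (induction rule: is_linear.induct)
  case (linear_gen g)
  then show ?case by (cases g) (auto simp: mat_of_def gauss_of_simps affine_gaussian_def)
next
  case (linear_seq x y)
  then show ?case
    by (simp add: gauss_of_simps mat_of_simps seq_affine_gaussian mat_mult_zero_vec[OF mat_of_carrier])
next
  case (linear_par x y)
  then show ?case by (simp add: gauss_of_simps mat_of_simps tens_affine_gaussian append_zero_vec)
qed (simp_all add: gauss_of_simps mat_of_simps ide_affine_gaussian swp_affine_gaussian)

text \<open>This is the block row \<open>(1 1)\<close>, written with empty lower blocks. Its entries
  are found by including one wire and joining with \<open>zeros\<close>.\<close>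

lemma mat_of_adds:
  "mat_of (adds n) = four_block_mat (1\<^sub>m n) (1\<^sub>m n) (0\<^sub>m 0 n) (0\<^sub>m 0 n)"
proof (rule eq_matI)
  fix j i assume "j < dim_row (four_block_mat (1\<^sub>m n) (1\<^sub>m n) (0\<^sub>m 0 n) (0\<^sub>m 0 n) :: real mat)"
    "i < dim_col (four_block_mat (1\<^sub>m n) (1\<^sub>m n) (0\<^sub>m 0 n) (0\<^sub>m 0 n) :: real mat)"
  then have ij: "j < n" "i < n + n" by auto
  have "inc (n + n) i \<rhd> adds n = inc n (if i < n then i else i - n)"
  proof (cases "i < n")
    case True
    then show ?thesis
      using join_zeros(1)[of "inc n i" n] by (simp add: adding.proj_add join_def)
  next
    case False
    then obtain k where k: "i = n + k" "k < n"
      using ij by (metis add_less_cancel_left le_iff_add not_le)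
    then show ?thesis
      using join_zeros(2)[of "inc n k" n] by (simp add: adding.proj_add join_def)
  qed
  then have "gen (Scale (mat_of (adds n) $$ (j, i)))
      = gen (Scale (mat_of (idn n) $$ (j, if i < n then i else i - n)))"
    using linear_entry[OF linear_adds(1)[of n], of i j] ij
      linear_entry[OF linear_idn[of n], of "if i < n then i else i - n" j]
    by (auto simp: seq_idn split: if_splits)
  then show "mat_of (adds n) $$ (j, i) = four_block_mat (1\<^sub>m n) (1\<^sub>m n) (0\<^sub>m 0 n) (0\<^sub>m 0 n) $$ (j, i)"
    using ij unfolding scale_inject by (auto simp: mat_of_simps)
qed auto

lemma mat_of_join:
  assumes "tgt y = tgt x"
  shows "mat_of (x \<uplus> y) = four_block_mat (mat_of x) (mat_of y) (0\<^sub>m 0 (src x)) (0\<^sub>m 0 (src y))"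
proof -
  let ?n = "tgt x"
  have "mat_of (x \<uplus> y) = mat_of (adds ?n) * direct_sum (mat_of x) (mat_of y)"
    using assms by (simp add: join_def mat_of_simps)
  also have "\<dots> = four_block_mat (mat_of x) (mat_of y) (0\<^sub>m 0 (src x)) (0\<^sub>m 0 (src y))"
    unfolding mat_of_adds direct_sum_def using assms mat_of_carrier[of x] mat_of_carrier[of y]
    by (subst mult_four_block_mat[of _ ?n ?n _ ?n _ 0 _ _ "src x" _ "src y"])
      (auto intro!: cong_four_block_mat)
  finally show ?thesis .
qed

text \<open>With \<open>J = (1 1)\<close>, the product \<open>J * direct_sum S X * J\<^sup>T\<close>
  is \<open>S + X\<close>: covariances of independent summands add. As \<open>y\<close> has no
  inputs, it contributes no columns to the matrix.\<close>

lemma gauss_of_join: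
  assumes x: "gauss_of x = (A, b, S)" and y: "gauss_of y = (C, d, X)"
    and dims: "tgt x = n" "tgt y = n" "src y = 0"
  shows "gauss_of (x \<uplus> y) = (A, b + d, S + X)"
proof -
  have c: "A \<in> carrier_mat n (src x)" "b \<in> carrier_vec n" "S \<in> carrier_mat n n"
    "C \<in> carrier_mat n 0" "d \<in> carrier_vec n" "X \<in> carrier_mat n n"
    using gauss_of_arr[of x] gauss_of_arr[of y] assms by (auto simp: arr_Gauss pos_semidef_def)
  let ?J = "four_block_mat (1\<^sub>m n) (1\<^sub>m n) (0\<^sub>m 0 n) (0\<^sub>m 0 n) :: real mat"
  have "?J * direct_sum A C = four_block_mat A C (0\<^sub>m 0 (src x)) (0\<^sub>m 0 0)"
    unfolding direct_sum_def using c
    by (subst mult_four_block_mat[of _ n n _ n _ 0 _ _ "src x" _ 0]) (auto intro!: cong_four_block_mat)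
  also have "\<dots> = A" using c by (intro eq_matI) auto
  finally have 1: "?J * direct_sum A C = A" .
  have "?J *\<^sub>v (b @\<^sub>v d) = (1\<^sub>m n *\<^sub>v b + 1\<^sub>m n *\<^sub>v d) @\<^sub>v (0\<^sub>m 0 n *\<^sub>v b + 0\<^sub>m 0 n *\<^sub>v d)"
    using c by (intro four_block_mat_mult_vec) auto
  also have "\<dots> = b + d" using c by (intro eq_vecI) auto
  finally have 2: "?J *\<^sub>v (b @\<^sub>v d) = b + d" .
  have "?J * direct_sum S X = four_block_mat S X (0\<^sub>m 0 n) (0\<^sub>m 0 n)"
    unfolding direct_sum_def using c
    by (subst mult_four_block_mat[of _ n n _ n _ 0 _ _ n _ n]) (auto intro!: cong_four_block_mat)
  moreover have "?J\<^sup>T = four_block_mat (1\<^sub>m n) (0\<^sub>m n 0) (1\<^sub>m n) (0\<^sub>m n 0)"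
    by (subst transpose_four_block_mat[of _ n n _ n _ 0]) auto
  moreover have "four_block_mat S X (0\<^sub>m 0 n) (0\<^sub>m 0 n) * four_block_mat (1\<^sub>m n) (0\<^sub>m n 0) (1\<^sub>m n) (0\<^sub>m n 0)
      = four_block_mat (S + X) (0\<^sub>m n 0) (0\<^sub>m 0 n) (0\<^sub>m 0 0)"
    using c by (subst mult_four_block_mat[of _ n n _ n _ 0 _ _ n _ 0]) (auto intro!: cong_four_block_mat)
  moreover have "four_block_mat (S + X) (0\<^sub>m n 0) (0\<^sub>m 0 n) (0\<^sub>m 0 0) = S + X"
    using c by (intro eq_matI) auto
  ultimately have 3: "?J * direct_sum S X * ?J\<^sup>T = S + X" by simp
  have "gauss_of (x \<uplus> y) = (direct_sum A C, b @\<^sub>v d, direct_sum S X) \<Zcomp>\<^bsub>Gauss\<^esub> affine_gaussian ?J (0\<^sub>v n)"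
    using x y dims linear_gauss_of[OF linear_adds(1)[of n]]
    by (simp add: join_def gauss_of_simps tens_Gauss mat_of_adds)
  then show ?thesis
    using c by (simp add: affine_gaussian_def seq_Gauss 1 2 3)
qed

text \<open>The product \<open>V * V\<^sup>T\<close> for the matrix \<open>V\<close> with columns
  \<open>vs\<close>, which is the covariance of \<open>nus n vs\<close>.\<close>

definition gram :: "nat \<Rightarrow> (nat \<Rightarrow> real) list \<Rightarrow> real mat" where
  "gram n vs = mat n n (\<lambda>(i, j). \<Sum>v\<leftarrow>vs. v i * v j)"

lemma mat_of_fan: "mat_of (fan n a) = mat n 1 (\<lambda>(j, _). a j)"
proof (rule eq_matI)
  fix j i assume "j < dim_row (mat n 1 (\<lambda>(j, _). a j))" "i < dim_col (mat n 1 (\<lambda>(j, _). a j))"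
  then have "j < n" "i = 0" by auto
  then show "mat_of (fan n a) $$ (j, i) = mat n 1 (\<lambda>(j, _). a j) $$ (j, i)"
    using linear_entry[OF linear_fan(1)[of n a], of 0 j]
    by (simp add: adding.proj_def idn_seq fan_prj scale_inject)
qed auto

lemma gauss_of_nus: "gauss_of (nus n vs) = (0\<^sub>m n 0, 0\<^sub>v n, gram n vs)"
proof (induction vs)
  case Nil
  have "gauss_of (zeros n) = (mat_of (zeros n), 0\<^sub>v n, 0\<^sub>m n n)"
    using linear_gauss_of[OF linear_adds(2)[of n]] by (simp add: affine_gaussian_def)
  moreover have "mat_of (zeros n) = 0\<^sub>m n 0"
    by (intro eq_matI) auto
  moreover have "gram n [] = 0\<^sub>m n n"
    by (intro eq_matI) (auto simp: gram_def)
  ultimately show ?case by simp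
next
  case (Cons v vs)
  let ?V = "mat n 1 (\<lambda>(j, _). v j)"
  have "gauss_of (gen Nu \<rhd> fan n v) = (?V * 0\<^sub>m 1 0, ?V *\<^sub>v 0\<^sub>v 1 + 0\<^sub>v n, ?V * 1\<^sub>m 1 * ?V\<^sup>T + 0\<^sub>m n n)"
    by (simp add: gauss_of_simps linear_gauss_of[OF linear_fan(1)] mat_of_fan affine_gaussian_def seq_Gauss)
  also have "?V * 0\<^sub>m 1 0 = 0\<^sub>m n 0" by (intro eq_matI) auto
  also have "?V *\<^sub>v 0\<^sub>v 1 + 0\<^sub>v n = 0\<^sub>v n" by (intro eq_vecI) auto
  also have "?V * 1\<^sub>m 1 * ?V\<^sup>T + 0\<^sub>m n n = gram n [v]"
    by (intro eq_matI) (auto simp: gram_def scalar_prod_def)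
  finally have "gauss_of (gen Nu \<rhd> fan n v) = (0\<^sub>m n 0, 0\<^sub>v n, gram n [v])" .
  then have "gauss_of (nus n (v # vs)) = (0\<^sub>m n 0, 0\<^sub>v n + 0\<^sub>v n, gram n [v] + gram n vs)"
    using gauss_of_join[OF _ Cons, of "gen Nu \<rhd> fan n v"] by simp
  moreover have "gram n [v] + gram n vs = gram n (v # vs)"
    by (intro eq_matI) (auto simp: gram_def)
  ultimately show ?case by simp
qed

lemma gram_eq_iff:
  "gram n vs = gram n ws \<longleftrightarrow> (\<forall>i<n. \<forall>j<n. (\<Sum>v\<leftarrow>vs. v i * v j) = (\<Sum>v\<leftarrow>ws. v i * v j))"
proof
  assume eq: "gram n vs = gram n ws"
  show "\<forall>i<n. \<forall>j<n. (\<Sum>v\<leftarrow>vs. v i * v j) = (\<Sum>v\<leftarrow>ws. v i * v j)"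
  proof (intro allI impI)
    fix i j assume "i < n" "j < n"
    then show "(\<Sum>v\<leftarrow>vs. v i * v j) = (\<Sum>v\<leftarrow>ws. v i * v j)"
      using arg_cong[OF eq, of "\<lambda>A. A $$ (i, j)"] by (simp add: gram_def)
  qed
qed (auto simp: gram_def intro!: eq_matI)

text \<open>The axiom inserts a rotation behind two copies of \<open>Nu\<close>. What follows is
  linear, so it may be computed with matrices: the rotation multiplies the pair of columns from the
  right.\<close>

lemma nus_rotate:
  assumes "0 \<le> \<phi>" "\<phi> < 2 * pi"
  shows "nus n (v # w # vs) =
    nus n ((\<lambda>i. cos \<phi> * v i + sin \<phi> * w i) # (\<lambda>i. - sin \<phi> * v i + cos \<phi> * w i) # vs)"
    (is "_ = nus n (?v # ?w # vs)")
proof -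
  let ?R = "arrow_of (rotation \<phi>)"
  have R: "is_linear ?R" "src ?R = 2" "tgt ?R = 2"
    by (auto simp: rotation_def numeral_2_eq_2 intro!: is_linear.intros)
  have wt: "typed gqa_arity (rotation \<phi>) 2 2"
    by (rule well_typed_typed) (simp add: rotation_def)
  have "gauss_of ?R = eval_diagram Gauss gauss_gen (rotation \<phi>)"
    using interpretation_map_diagram_class[OF wt] arrow_of_typed[OF wt] by (simp add: gauss_of_def)
  then have mR: "mat_of ?R = rotation_mat \<phi>"
    by (simp add: mat_of_def eval_rotation affine_gaussian_def)
  have fan2: "mat_of (fan n a \<uplus> fan n b) = mat n 2 (\<lambda>(j, i). if i = 0 then a j else b j)" for a b
    by (simp add: mat_of_join mat_of_fan) (intro eq_matI; auto)
  have "mat_of (?R \<rhd> (fan n v \<uplus> fan n w)) = mat_of (fan n ?v \<uplus> fan n ?w)"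
    using R by (simp add: mat_of_simps mR fan2)
      (intro eq_matI; auto simp: rotation_mat_def scalar_prod_def numeral_2_eq_2 less_Suc_eq algebra_simps)
  then have rot: "?R \<rhd> (fan n v \<uplus> fan n w) = fan n ?v \<uplus> fan n ?w"
    using R by (intro linear_eqI) (auto intro!: linear_seq linear_join linear_fan)
  have nunu: "(gen Nu \<rhd> fan n a) \<uplus> (gen Nu \<rhd> fan n b) = (gen Nu \<boxtimes> gen Nu) \<rhd> (fan n a \<uplus> fan n b)" for a b
    by (simp add: join_def arr_par_seq flip: arr_seq_assoc)
  have "(gen Nu \<rhd> fan n v) \<uplus> (gen Nu \<rhd> fan n w) = (gen Nu \<boxtimes> gen Nu) \<rhd> ?R \<rhd> (fan n v \<uplus> fan n w)"
    using gqa_axioms(22)[OF assms] by (simp add: nunu)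
  also have "\<dots> = (gen Nu \<rhd> fan n ?v) \<uplus> (gen Nu \<rhd> fan n ?w)"
    by (simp add: arr_seq_assoc rot nunu)
  finally show ?thesis by (simp flip: join_assoc)
qed

text \<open>A zero column discards its \<open>Nu\<close>, and \<open>nu_discard\<close> removes the
  rest.\<close>

lemma nus_zero: "nus n ((\<lambda>_. 0) # vs) = nus n vs"
  by (simp add: fan_zero gqa_axioms join_zeros idn_seq flip: arr_seq_assoc)

text \<open>The list is folded into one pivot column: each column is rotated against the pivot so
  that its entry in row \<open>r\<close> vanishes. Earlier rows stay zero, since a rotation only
  forms linear combinations.\<close>

lemma nus_pivot:
  assumes "\<And>v j. \<lbrakk>v \<in> set vs; j < r\<rbrakk> \<Longrightarrow> v j = 0"
  shows "\<exists>u vs'. nus n vs = nus n (u # vs') \<and> (\<forall>j<r. u j = 0) \<and> u r \<ge> 0 \<and> (\<forall>v\<in>set vs'. \<forall>j\<le>r. v j = 0)"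
  using assms
proof (induction vs)
  case Nil
  \<comment> \<open>The fold starts from an inserted zero column. Against it even a single column
    with a negative entry can be rotated to a nonnegative pivot.\<close>
  then show ?case using nus_zero[of n "[]"]
    by (intro exI[of _ "\<lambda>_. 0"] exI[of _ "[]"]) (simp del: nus.simps)
next
  case (Cons v vs)
  then obtain u vs' where u: "nus n vs = nus n (u # vs')" "\<And>j. j < r \<Longrightarrow> u j = 0" "u r \<ge> 0"
    "\<And>v j. \<lbrakk>v \<in> set vs'; j \<le> r\<rbrakk> \<Longrightarrow> v j = 0" by (metis list.set_intros(2))
  have v: "j < r \<Longrightarrow> v j = 0" for j using Cons.prems by simp
  define d where "d = sqrt ((u r)\<^sup>2 + (v r)\<^sup>2)"
  \<comment> \<open>The polar angle of \<open>(u r, - v r)\<close>. Rotating by it sends the entries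
    \<open>v r\<close> and \<open>u r\<close> to 0 and to the length \<open>d\<close>, which is
    nonnegative.\<close>
  obtain \<phi> where \<phi>: "0 \<le> \<phi>" "\<phi> < 2 * pi" "u r = d * cos \<phi>" "- v r = d * sin \<phi>"
  proof (cases "d = 0")
    case True
    then have "u r = 0" "v r = 0" by (auto simp: d_def sum_power2_eq_zero_iff)
    then show ?thesis using that[of 0] True by simp
  next
    case False
    then have "(u r)\<^sup>2 + (v r)\<^sup>2 = d\<^sup>2" by (simp add: d_def)
    then have "(u r / d)\<^sup>2 + (- v r / d)\<^sup>2 = 1"
      using False by (simp add: power_divide flip: add_divide_distrib)
    then obtain t where "0 \<le> t" "t < 2 * pi" "u r / d = cos t" "- v r / d = sin t"
      using sincos_total_2pi by metis
    then show ?thesis using that[of t] False by (simp add: field_simps)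
  qed
  have "nus n (v # vs) = nus n (v # u # vs')" using u(1) by simp
  also have "\<dots> = nus n ((\<lambda>i. cos \<phi> * v i + sin \<phi> * u i) # (\<lambda>i. - sin \<phi> * v i + cos \<phi> * u i) # vs')"
    (is "_ = nus n (?v # ?u # vs')")
    using \<phi> by (intro nus_rotate)
  also have "\<dots> = nus n (?u # ?v # vs')"
    using join_commute[of "gen Nu \<rhd> fan n ?u" "gen Nu \<rhd> fan n ?v"] by (simp flip: join_assoc)
  finally have eq: "nus n (v # vs) = nus n (?u # ?v # vs')" .
  have vr: "v r = - (d * sin \<phi>)" using \<phi>(4) by simp
  have "?v r = 0" by (simp add: \<phi>(3) vr algebra_simps)
  moreover have "?u r = d"
  proof -
    have "d * (cos \<phi> * cos \<phi>) + d * (sin \<phi> * sin \<phi>) = d"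
      using sin_cos_squared_add3[of \<phi>] by (metis distrib_left mult.right_neutral)
    then show ?thesis by (simp add: \<phi>(3) vr algebra_simps)
  qed
  moreover have "d \<ge> 0" by (simp add: d_def)
  moreover have "?v j = 0" "?u j = 0" if "j < r" for j using that u v by simp_all
  ultimately show ?case
    using u(4) by (intro exI[of _ ?u] exI[of _ "?v # vs'"] conjI eq) (auto simp: le_less)
qed

text \<open>\<open>k\<close> counts the rows still to be treated; above them all columns vanish. The
  lists may have different lengths throughout.\<close>

lemma nus_eqI_aux:
  assumes "k \<le> n" "gram n vs = gram n ws"
    "\<And>v j. \<lbrakk>v \<in> set vs \<union> set ws; j < n - k\<rbrakk> \<Longrightarrow> v j = 0"
  shows "nus n vs = nus n ws"
  using assms
proof (induction k arbitrary: vs ws)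
  case 0
  have "nus n vs = zeros n" if "\<And>v j. \<lbrakk>v \<in> set vs; j < n\<rbrakk> \<Longrightarrow> v j = 0" for vs
    using that
  proof (induction vs)
    case (Cons v vs)
    then have "nus n (v # vs) = nus n ((\<lambda>_. 0) # vs)"
      using fan_cong[of n v "\<lambda>_. 0"] by simp
    also have "\<dots> = nus n vs" by (rule nus_zero)
    finally show ?case using Cons by simp
  qed simp
  then show ?case using 0 by simp
next
  case (Suc k)
  define r where "r = n - Suc k"
  have r: "r < n" "n - k = Suc r" using Suc.prems(1) by (auto simp: r_def)
  obtain u vs' where u: "nus n vs = nus n (u # vs')" "\<And>j. j < r \<Longrightarrow> u j = 0" "u r \<ge> 0"
    "\<And>v j. \<lbrakk>v \<in> set vs'; j \<le> r\<rbrakk> \<Longrightarrow> v j = 0"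
    using nus_pivot[of vs r n] Suc.prems(3) unfolding r_def by (metis UnI1)
  obtain w ws' where w: "nus n ws = nus n (w # ws')" "\<And>j. j < r \<Longrightarrow> w j = 0" "w r \<ge> 0"
    "\<And>v j. \<lbrakk>v \<in> set ws'; j \<le> r\<rbrakk> \<Longrightarrow> v j = 0"
    using nus_pivot[of ws r n] Suc.prems(3) unfolding r_def by (metis UnI2)
  \<comment> \<open>Pivoting preserves the arrow, hence by soundness its covariance; no computation
    with rotated columns is required.\<close>
  have "gram n (u # vs') = gram n vs" "gram n (w # ws') = gram n ws"
    using u(1) w(1) gauss_of_nus by (metis prod.inject)+
  then have "gram n (u # vs') = gram n (w # ws')" using Suc.prems by simp
  then have g: "u i * u j + (\<Sum>v\<leftarrow>vs'. v i * v j) = w i * w j + (\<Sum>v\<leftarrow>ws'. v i * v j)"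
    if "i < n" "j < n" for i j
    using that by (auto simp: gram_eq_iff)
  have z: "(\<Sum>v\<leftarrow>xs. v r * v j) = 0" if "\<And>v. v \<in> set xs \<Longrightarrow> v r = 0"
    for xs :: "(nat \<Rightarrow> real) list" and j
    using that by (induction xs) auto
  \<comment> \<open>Only the pivot columns reach row \<open>r\<close>, so row \<open>r\<close> of
    the Gram matrix is the pivot column scaled by its own entry in that row.\<close>
  have row: "u r * u j = w r * w j" if "j < n" for j
    using g[of r j] z[of vs' j] z[of ws' j] u(4) w(4) r that by simp
  have urwr: "u r = w r"
  proof -
    have "(u r)\<^sup>2 = (w r)\<^sup>2" using row[of r] r by (simp add: power2_eq_square)
    then show ?thesis using u(3) w(3) by (simp add: power2_eq_iff_nonneg)
  qed
  show ?case
  proof (cases "u r = 0")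
    case True
    \<comment> \<open>A zero pivot means that row \<open>r\<close> vanishes in every column; the
      lists are kept whole and only \<open>k\<close> decreases.\<close>
    have "nus n (u # vs') = nus n (w # ws')"
    proof (rule Suc.IH)
      show "v j = 0" if "v \<in> set (u # vs') \<union> set (w # ws')" "j < n - k" for v j
        using that u(2,4) w(2,4) True urwr r by (auto simp: less_Suc_eq)
    qed (use Suc.prems \<open>gram n (u # vs') = gram n (w # ws')\<close> in auto)
    then show ?thesis using u(1) w(1) by simp
  next
    case False
    \<comment> \<open>Dividing by the common nonzero pivot identifies the pivot columns; their
      contributions then cancel from the Gram matrices of the tails.\<close>
    then have uw: "u j = w j" if "j < n" for j using row[OF that] urwr by simp
    have "nus n vs' = nus n ws'"
    proof (rule Suc.IH)
      show "gram n vs' = gram n ws'" unfolding gram_eq_iff using g uw by simp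
      show "v j = 0" if "v \<in> set vs' \<union> set ws'" "j < n - k" for v j
        using that u(4) w(4) r by auto
    qed (use Suc.prems in auto)
    moreover have "fan n u = fan n w" using uw by (rule fan_cong)
    ultimately show ?thesis using u(1) w(1) by simp
  qed
qed

lemma nus_eqI: "gram n vs = gram n ws \<Longrightarrow> nus n vs = nus n ws"
  by (rule nus_eqI_aux[of n]) auto

section \<open>Factorization of covariance matrices\<close>

text \<open>The bilinear form of \<open>S\<close> on functions instead of vectors, so that an
  argument can be perturbed by multiples of \<open>basis r\<close> without carrying
  dimensions.\<close>

definition bilin :: "nat \<Rightarrow> real mat \<Rightarrow> (nat \<Rightarrow> real) \<Rightarrow> (nat \<Rightarrow> real) \<Rightarrow> real" where
  "bilin n S x y = (\<Sum>i<n. \<Sum>j<n. x i * S $$ (i, j) * y j)"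

definition basis :: "nat \<Rightarrow> nat \<Rightarrow> real" where
  "basis r i = (if i = r then 1 else 0)"

lemma sum_basis:
  "r < n \<Longrightarrow> (\<Sum>i<n. basis r i * f i) = f r" "r < n \<Longrightarrow> (\<Sum>i<n. f i * basis r i) = f r"
  by (simp_all add: basis_def if_distrib[of "\<lambda>c. c * _"] if_distrib[of "\<lambda>c. _ * c"] cong: if_cong)

lemma bilin_basis:
  "r < n \<Longrightarrow> bilin n S (basis r) y = (\<Sum>j<n. S $$ (r, j) * y j)"
  "r < n \<Longrightarrow> bilin n S x (basis r) = (\<Sum>i<n. x i * S $$ (i, r))"
  by (simp_all add: bilin_def sum_basis) (simp add: mult.assoc sum_basis flip: sum_distrib_left)

lemma bilin_add:
  "bilin n S (\<lambda>i. x i + t * z i) (\<lambda>i. x i + t * z i)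
    = bilin n S x x + t * (bilin n S x z + bilin n S z x) + t\<^sup>2 * bilin n S z z"
  by (simp add: bilin_def algebra_simps power2_eq_square sum.distrib sum_distrib_left)

lemma pos_semidef_iff_bilin:
  "pos_semidef n S \<longleftrightarrow> S \<in> carrier_mat n n \<and> (\<forall>i<n. \<forall>j<n. S $$ (i, j) = S $$ (j, i))
    \<and> (\<forall>x. 0 \<le> bilin n S x x)"
proof (cases "S \<in> carrier_mat n n")
  case True
  have sym: "S\<^sup>T = S \<longleftrightarrow> (\<forall>i<n. \<forall>j<n. S $$ (i, j) = S $$ (j, i))"
  proof
    assume eq: "S\<^sup>T = S"
    show "\<forall>i<n. \<forall>j<n. S $$ (i, j) = S $$ (j, i)"
    proof (intro allI impI)
      fix i j assume "i < n" "j < n"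
      then show "S $$ (i, j) = S $$ (j, i)"
        using True arg_cong[OF eq, of "\<lambda>A. A $$ (j, i)"] by simp
    qed
  qed (use True in \<open>auto intro!: eq_matI\<close>)
  have q: "v \<bullet> (S *\<^sub>v v) = bilin n S (($) v) (($) v)" if "v \<in> carrier_vec n" for v
    using that True by (simp add: bilin_def scalar_prod_def atLeast0LessThan sum_distrib_left mult.assoc)
  have "bilin n S x x = bilin n S (($) (vec n x)) (($) (vec n x))" for x
    by (simp add: bilin_def)
  then have "(\<forall>v\<in>carrier_vec n. 0 \<le> v \<bullet> (S *\<^sub>v v)) \<longleftrightarrow> (\<forall>x. 0 \<le> bilin n S x x)"
    using q by (metis vec_carrier)
  then show ?thesis using True sym by (simp add: pos_semidef_def)
qed (auto simp: pos_semidef_def)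

text \<open>If the diagonal entry is 0, the quadratic form is affine in \<open>t\<close> along
  \<open>basis j + t * basis r\<close>, with slope twice the entry in question. Nonnegativity for
  all \<open>t\<close> forces the slope to vanish.\<close>

lemma pos_semidef_zero_row:
  assumes S: "pos_semidef n S" and r: "r < n" "S $$ (r, r) = 0" and j: "j < n"
  shows "S $$ (r, j) = 0"
proof (rule ccontr)
  assume nz: "S $$ (r, j) \<noteq> 0"
  \<comment> \<open>Chosen so that the form takes the value \<open>- 1\<close>.\<close>
  define t where "t = - (S $$ (j, j) + 1) / (2 * S $$ (r, j))"
  have "bilin n S (\<lambda>i. basis j i + t * basis r i) (\<lambda>i. basis j i + t * basis r i)
      = S $$ (j, j) + t * (S $$ (j, r) + S $$ (r, j))"
    unfolding bilin_add using r j by (simp add: bilin_basis(1) sum_basis)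
  also have "S $$ (j, r) = S $$ (r, j)" using S r j by (simp add: pos_semidef_iff_bilin)
  also have "S $$ (j, j) + t * (S $$ (r, j) + S $$ (r, j)) = - 1"
    using nz by (simp add: t_def field_simps)
  finally show False using S unfolding pos_semidef_iff_bilin by (metis neg_0_le_iff_le not_one_le_zero)
qed

text \<open>Cholesky elimination by induction on the number \<open>k\<close> of rows left; the first
  \<open>n - k\<close> rows are already zero.\<close>

lemma pos_semidef_gram_aux:
  assumes "k \<le> n" "pos_semidef n S" "\<And>i j. \<lbrakk>i < n - k; j < n\<rbrakk> \<Longrightarrow> S $$ (i, j) = 0"
  shows "\<exists>vs. gram n vs = S"
  using assms
proof (induction k arbitrary: S)
  case 0
  then have "gram n [] = S"
    by (intro eq_matI) (auto simp: gram_def pos_semidef_def)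
  then show ?case by blast
next
  case (Suc k)
  define r where "r = n - Suc k"
  have r: "r < n" "n - k = Suc r" using Suc.prems(1) by (auto simp: r_def)
  note S = Suc.prems(2)[unfolded pos_semidef_iff_bilin]
  have "S $$ (r, r) \<ge> 0"
    using S r by (metis bilin_basis(1) sum_basis(2))
  show ?case
  proof (cases "S $$ (r, r) = 0")
    case True
    show ?thesis
    proof (rule Suc.IH)
      show "S $$ (i, j) = 0" if "i < n - k" "j < n" for i j
        using that Suc.prems(3) pos_semidef_zero_row[OF Suc.prems(2) r(1) True, of j] r
        by (auto simp: less_Suc_eq r_def)
    qed (use Suc.prems in auto)
  next
    case False
    then have pos: "S $$ (r, r) > 0" using \<open>S $$ (r, r) \<ge> 0\<close> by simp
    \<comment> \<open>The Cholesky column: subtracting its square clears row and column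
      \<open>r\<close> and leaves the Schur complement \<open>T\<close>.\<close>
    define v where "v j = S $$ (r, j) / sqrt (S $$ (r, r))" for j
    have vv: "v i * v j = S $$ (r, i) * S $$ (r, j) / S $$ (r, r)" for i j
      using pos by (simp add: v_def)
    define T where "T = mat n n (\<lambda>(i, j). S $$ (i, j) - v i * v j)"
    have "bilin n T x x \<ge> 0" for x
    proof -
      define m where "m = (\<Sum>j<n. S $$ (r, j) * x j)"
      \<comment> \<open>The minimizer of the quadratic form of \<open>S\<close> on the line through
        \<open>x\<close> in direction \<open>basis r\<close>. The minimum is the value of the form
        of \<open>T\<close> at \<open>x\<close>, which is therefore nonnegative.\<close>
      define c where "c = - m / S $$ (r, r)"
      have sym: "(\<Sum>i<n. x i * S $$ (i, r)) = m"
        unfolding m_def using S r by (auto intro!: sum.cong)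
      have "bilin n S (\<lambda>i. x i + c * basis r i) (\<lambda>i. x i + c * basis r i)
          = bilin n S x x + c * (m + m) + c\<^sup>2 * S $$ (r, r)"
        unfolding bilin_add using r by (simp add: bilin_basis sum_basis sym flip: m_def)
      also have "\<dots> = bilin n S x x - m\<^sup>2 / S $$ (r, r)"
        using pos by (simp add: c_def field_simps power2_eq_square)
      also have "m\<^sup>2 / S $$ (r, r) = (\<Sum>i<n. \<Sum>j<n. x i * (v i * v j) * x j)"
        by (simp add: vv m_def power2_eq_square sum_product sum_divide_distrib field_simps)
      also have "bilin n S x x - \<dots> = bilin n T x x"
        by (simp add: bilin_def T_def algebra_simps sum_subtractf)
      finally show ?thesis using S by metis
    qed
    then have "pos_semidef n T"
      unfolding pos_semidef_iff_bilin using S by (auto simp: T_def)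
    \<comment> \<open>Row \<open>r\<close> is cleared by the subtraction. In earlier rows
      \<open>S\<close> vanishes, and by symmetry so do the corresponding entries of
      \<open>v\<close>.\<close>
    moreover have "T $$ (i, j) = 0" if "i < n - k" "j < n" for i j
    proof (cases "i = r")
      case True
      then show ?thesis using pos r that by (simp add: T_def vv)
    next
      case False
      then have i: "i < n - Suc k" "i < n" using that r by (auto simp: r_def)
      then have "S $$ (r, i) = 0" using Suc.prems(3)[of i r] S r by simp
      then show ?thesis using Suc.prems(3)[of i j] i that by (simp add: T_def vv)
    qed
    ultimately obtain vs where vs: "gram n vs = T" using Suc.IH[of T] Suc.prems(1) by auto
    have "gram n (v # vs) = S"
    proof (rule eq_matI)
      fix i j assume "i < dim_row S" "j < dim_col S"
      then have "i < n" "j < n" using S by auto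
      then show "gram n (v # vs) $$ (i, j) = S $$ (i, j)"
        using arg_cong[OF vs, of "\<lambda>A. A $$ (i, j)"] by (simp add: gram_def T_def)
    qed (use S in \<open>auto simp: gram_def\<close>)
    then show ?thesis by blast
  qed
qed

lemma pos_semidef_gram: "pos_semidef n S \<Longrightarrow> \<exists>vs. gram n vs = S"
  by (rule pos_semidef_gram_aux[of n]) auto

section \<open>Completeness\<close>

definition normal_form :: "nat \<Rightarrow> arrow \<Rightarrow> (nat \<Rightarrow> real) \<Rightarrow> (nat \<Rightarrow> real) list \<Rightarrow> arrow" where
  "normal_form n a b vs = a \<uplus> ((gen One \<rhd> fan n b) \<uplus> nus n vs)"

lemma normal_form_ex:
  obtains a b vs where "is_linear a" "src a = src x" "tgt a = tgt x" "x = normal_form (tgt x) a b vs"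
proof -
  obtain a s where as: "is_linear a" "noise (tgt x) s" "x = a \<uplus> s"
    using linear_noise_decomposition by blast
  then obtain b vs where "s = (gen One \<rhd> fan (tgt x) b) \<uplus> nus (tgt x) vs"
    using noise_canonical by blast
  moreover have "src a = src x" "tgt a = tgt x"
    using as noise_dims by auto
  ultimately show ?thesis using that as by (metis normal_form_def)
qed

lemma gauss_of_normal_form:
  assumes "is_linear a" "tgt a = n"
  shows "gauss_of (normal_form n a b vs) = (mat_of a, vec n b, gram n vs)"
proof -
  let ?V = "mat n 1 (\<lambda>(j, _). b j)"
  have g: "gram n vs \<in> carrier_mat n n" by (simp add: gram_def)
  have "gauss_of (gen One \<rhd> fan n b) = affine_gaussian (?V * 0\<^sub>m 1 0) (?V *\<^sub>v vec 1 (\<lambda>_. 1) + 0\<^sub>v n)"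
    by (simp add: gauss_of_simps linear_gauss_of[OF linear_fan(1)] mat_of_fan seq_affine_gaussian)
  also have "?V * 0\<^sub>m 1 0 = 0\<^sub>m n 0" by (intro eq_matI) auto
  also have "?V *\<^sub>v vec 1 (\<lambda>_. 1) + 0\<^sub>v n = vec n b" by (intro eq_vecI) (auto simp: scalar_prod_def)
  finally have "gauss_of (gen One \<rhd> fan n b) = (0\<^sub>m n 0, vec n b, 0\<^sub>m n n)"
    by (simp add: affine_gaussian_def)
  then have "gauss_of ((gen One \<rhd> fan n b) \<uplus> nus n vs) = (0\<^sub>m n 0, vec n b, gram n vs)"
    using gauss_of_join[OF _ gauss_of_nus, of "gen One \<rhd> fan n b"] g by simp
  moreover have "gauss_of a = (mat_of a, 0\<^sub>v n, 0\<^sub>m n n)"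
    using linear_gauss_of[OF assms(1)] assms by (simp add: affine_gaussian_def)
  ultimately show ?thesis
    using gauss_of_join[of a] assms g unfolding normal_form_def by simp
qed

text \<open>The columns in a normal form are not unique, so normal forms are compared as arrows: the
  matrix fixes the linear part, the mean the constant, and the covariance the noise.\<close>

lemma gauss_of_inject:
  assumes "src x = src y" "tgt x = tgt y" "gauss_of x = gauss_of y"
  shows "x = y"
proof -
  let ?n = "tgt x"
  obtain a b vs where x: "is_linear a" "src a = src x" "tgt a = ?n" "x = normal_form ?n a b vs"
    by (rule normal_form_ex)
  obtain c d ws where y: "is_linear c" "src c = src x" "tgt c = ?n" "y = normal_form ?n c d ws"
    using normal_form_ex[of y] assms by metis
  have eq: "mat_of a = mat_of c" "vec ?n b = vec ?n d" "gram ?n vs = gram ?n ws"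
    using assms(3) gauss_of_normal_form[OF x(1,3)] gauss_of_normal_form[OF y(1,3)] x(4) y(4)
    by (metis prod.inject)+
  have "a = c" using x y eq(1) by (intro linear_eqI) auto
  moreover have "fan ?n b = fan ?n d" using eq(2) by (intro fan_cong) (metis index_vec)
  moreover have "nus ?n vs = nus ?n ws" using eq(3) by (rule nus_eqI)
  ultimately show ?thesis using x(4) y(4) by (metis normal_form_def)
qed

lemma gauss_of_surj:
  assumes "f \<in> arr Gauss m n"
  obtains x where "src x = m" "tgt x = n" "gauss_of x = f"
proof -
  obtain A b S where f: "f = (A, b, S)" "A \<in> carrier_mat n m" "b \<in> carrier_vec n" "pos_semidef n S"
    using assms by (cases f) (auto simp: arr_Gauss)
  obtain a where a: "is_linear a" "src a = m" "tgt a = n" "mat_of a = A"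
    using linear_ex[OF f(2)] .
  obtain vs where vs: "gram n vs = S" using pos_semidef_gram[OF f(4)] by blast
  have "vec n (($) b) = b" using f(3) by auto
  then have "gauss_of (normal_form n a (($) b) vs) = f"
    using gauss_of_normal_form[OF a(1,3)] a vs f by simp
  then show ?thesis using that[of "normal_form n a (($) b) vs"] a by (simp add: normal_form_def)
qed

theorem theorem1:
  shows "prop_isomorphism GQA Gauss interpretation_map \<and>
    (\<forall>t m n. typed gqa_arity t m n \<longrightarrow>
      interpretation_map (diagram_class gqa_arity gqa_equations t) = eval_diagram Gauss gauss_gen t)"
proof (intro conjI allI impI)
  show "prop_isomorphism GQA Gauss interpretation_map"
  proof (rule prop_isomorphismI)
    show "prop_morphism GQA Gauss interpretation_map"
      by (rule interpretation_map_morphism)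
  next
    fix m n f g
    assume f: "f \<in> arr GQA m n" and g: "g \<in> arr GQA m n"
      and "interpretation_map f = interpretation_map g"
    \<comment> \<open>Faithfulness is available for \<open>arrow\<close>, so both morphisms are
      wrapped with their common type.\<close>
    then have "gauss_of (mk m n f) = gauss_of (mk m n g)"
      by (simp add: gauss_of_def mk_simps)
    then have "mk m n f = mk m n g"
      using f g by (intro gauss_of_inject) (simp_all add: mk_simps)
    then show "f = g" using f g mk_simps(3) by metis
  next
    fix m n g
    assume "g \<in> arr Gauss m n"
    then obtain x where "src x = m" "tgt x = n" "gauss_of x = g"
      by (rule gauss_of_surj)
    then show "\<exists>f\<in>arr GQA m n. interpretation_map f = g"
      using arr_class_arr[of x] by (auto simp: gauss_of_def)
  qed
qed (rule interpretation_map_diagram_class)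

end
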